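(* For every $n\geqslant 1$ there exists a constant $C(n)>0$, depending only on $n$, such that for any compact subdomain $\Omega\subset\mathbf{H}_n$ of the Heisenberg group and any pseudo-Hermitian structure $\theta$ on $\Omega$ (for the CR structure induced from $\mathbf{H}_n$) with positive definite Levi form, the counting function $N_\theta(\Omega,\lambda)$ of the Neumann eigenvalues of the sub-Laplacian on $\Omega$ satisfies $$N_\theta(\Omega,\lambda)\geqslant C(n)\cdot\mathrm{Vol}_\theta(\Omega)\,\lambda^{n+1}\qquad\text{for all }\lambda\geqslant 0,$$ where $\mathrm{Vol}_\theta$ is the volume with respect to the form $\theta\wedge(d\theta)^n$.
   Context: Heisenberg group. $\mathbf{H}_n=\mathbf{C}^n\times\mathbf{R}$ with the group operation $(z,t)\cdot(w,s)=(z+w,\,t+s+2\,\mathrm{Im}\langle z,w\rangle)$, where $\langle z,w\rangle=\sum_j z^j\bar w^j$. Its CR structure $H^{1,0}\subset T\mathbf{H}_n\otimes\mathbf{C}$ is the complex span of the vector fields $T_j=\frac{\partial}{\partial z^j}+i\bar z^j\frac{\partial}{\partial t}$, $j=1,\dots,n$. The Levi distribution is $H=\mathrm{Re}(H^{1,0}\oplus\overline{H^{1,0}})$, a real rank $2n$ sub-bundle of the tangent bundle with complex structure $J_b(v+\bar v)=i(v-\bar v)$, $v\in H^{1,0}$. A compact subdomain $\Omega$ is understood as a compact connected $(2n+1)$-dimensional submanifold with boundary of $\mathbf{H}_n$, with the restricted CR structure. A pseudo-Hermitian structure on $\Omega$ is a nowhere vanishing $1$-form $\theta$ on $\Omega$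 whose kernel is $H$; its Levi form is $L_\theta(v,\bar w)=-i\,d\theta(v,\bar w)$, $v,w\in H^{1,0}$. Webster metric and sub-Laplacian. Let $\theta$ have positive definite Levi form, and let $\pi_H:T\Omega\to H$ be the projection along the $1$-dimensional kernel of $d\theta$. The Webster metric is the Riemannian metric $d\theta(\pi_H\cdot,J_b\pi_H\cdot)+\theta\otimes\theta$. $\mathrm{Vol}_\theta$ is the measure associated with $\theta\wedge(d\theta)^n$. Put $\nabla_b u=\pi_H\nabla u$, where $\nabla u$ is the gradient in the Webster metric; the sub-Laplacian is $-\Delta_b u=-\mathrm{div}(\nabla_b u)$, with divergence with respect to $\theta\wedge(d\theta)^n$. Neumann eigenvalues and counting function. $-\Delta_b$ is considered on $C^\infty$ functions $u$ on $\Omega$ with $\langle\nabla_b u,\vec n\rangle=0$ on $\partial\Omega$ ($\vec n$ the outward normal, scalar product in the Webster metric). Its spectrum is discrete, and coincides with the spectrum of the Dirichlet form $\int_\Omega|\nabla_b u|^2\,d\mathrm{Vol}_\theta$ viewed as a form on smooth functions on $\Omega$ (in $L_2(\Omega,\mathrm{Vol}_\theta)$). $N_\theta(\Omega,\lambda)$ is the number of eigenvalues (with multiplicity) strictly less than $\lambda$. Equivalently, $$N_\theta(\Omega,\lambda)=\sup\Big\{\dim V:\ \int_\Omega|\nabla_b u|^2\,d\mathrm{Vol}_\theta<\lambda\int_\Omega u^2\,d\mathrm{Vol}_\theta\ \text{ for all }u\in V\setminus\{0\}\Big\},$$ where $V$ ranges over subspaces of smooth functions on $\Omega$ (the supremum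 over the empty set being $0$). *)

theory Defs
  imports "HOL-Analysis.Analysis" "HOL-Library.Function_Algebras"
begin

section \<open>Smooth maps and smooth domains in Euclidean spaces\<close>

primrec Ck_on :: "nat \<Rightarrow> 'a::real_normed_vector set \<Rightarrow> ('a \<Rightarrow> 'b::real_normed_vector) \<Rightarrow> bool" where
  "Ck_on 0 U f \<longleftrightarrow> continuous_on U f"
| "Ck_on (Suc k) U f \<longleftrightarrow> (\<forall>x\<in>U. f differentiable (at x)) \<and>
     (\<forall>v. Ck_on k U (\<lambda>x. frechet_derivative f (at x) v))"

text \<open>Smoothness on a set that need not be open is the existence of smooth local extensions. On a
  domain with smooth boundary this is smoothness up to the boundary.\<close>

definition smooth_on :: "'a::euclidean_space set \<Rightarrow> ('a \<Rightarrow> 'b::real_normed_vector) \<Rightarrow> bool" where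
  "smooth_on S f \<longleftrightarrow>
     (\<forall>p\<in>S. \<exists>U g. open U \<and> p \<in> U \<and> (\<forall>k. Ck_on k U g) \<and> (\<forall>x\<in>U \<inter> S. g x = f x))"

text \<open>Submanifolds with boundary of full dimension: every point has a chart of the ambient space
  which straightens the set to a half-space. At interior points the half-space may contain the
  whole range of the chart.\<close>

definition smooth_domain :: "'a::euclidean_space set \<Rightarrow> bool" where
  "smooth_domain M \<longleftrightarrow>
     (\<forall>p\<in>M. \<exists>U V (\<phi> :: 'a \<Rightarrow> 'a) \<psi>. \<exists>b\<in>Basis. open U \<and> open V \<and> p \<in> U \<and> homeomorphism U V \<phi> \<psi> \<and>
        smooth_on U \<phi> \<and> smooth_on V \<psi> \<and> \<phi> ` (M \<inter> U) = V \<inter> {y. 0 \<le> y \<bullet> b})"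

definition compact_subdomain :: "'a::euclidean_space set \<Rightarrow> bool" where
  "compact_subdomain \<Omega> \<longleftrightarrow> compact \<Omega> \<and> connected \<Omega> \<and> smooth_domain \<Omega>"


section \<open>The CR structure of the Heisenberg group\<close>

text \<open>The dimension \<open>n\<close> of the text is \<open>CARD('n)\<close>. Every tangent space is identified with the
  vector space \<open>'n heis\<close> itself.\<close>

type_synonym 'n heis = "(complex ^ 'n) \<times> real"

text \<open>A vector \<open>a + i b\<close> of the complexification of a real vector space is the pair \<open>(a, b)\<close>.\<close>

type_synonym 'a cplxfn = "'a \<times> 'a"

definition cplx_scale :: "complex \<Rightarrow> 'a::real_vector cplxfn \<Rightarrow> 'a cplxfn" where
  "cplx_scale c v = (Re c *\<^sub>R fst v - Im c *\<^sub>R snd v, Re c *\<^sub>R snd v + Im c *\<^sub>R fst v)"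

definition cplx_conj :: "'a::real_vector cplxfn \<Rightarrow> 'a cplxfn" where
  "cplx_conj v = (fst v, - snd v)"

text \<open>\<open>\<partial>/\<partial>z\<^sup>j = (\<partial>/\<partial>x\<^sup>j - i \<partial>/\<partial>y\<^sup>j) / 2\<close> for \<open>z\<^sup>j = x\<^sup>j + i y\<^sup>j\<close>.\<close>

definition d_dz :: "'n::finite \<Rightarrow> 'n heis cplxfn" where
  "d_dz j = ((1/2) *\<^sub>R (axis j 1, 0), - (1/2) *\<^sub>R (axis j \<i>, 0))"

definition d_dt :: "'n::finite heis cplxfn" where
  "d_dt = ((0, 1), 0)"

text \<open>The fields \<open>\<partial>/\<partial>z\<^sup>j + i cnj z\<^sup>j \<partial>/\<partial>t\<close> are left-invariant for the group operation
  \<open>(z, t) \<cdot> (w, s) = (z + w, t + s + 2 Im \<langle>z, w\<rangle>)\<close>.\<close>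

definition T_field :: "'n::finite \<Rightarrow> 'n heis \<Rightarrow> 'n heis cplxfn" where
  "T_field j p = d_dz j + cplx_scale (\<i> * cnj (fst p $ j)) d_dt"

definition H10 :: "'n::finite heis \<Rightarrow> 'n heis cplxfn set" where
  "H10 p = {\<Sum>j\<in>UNIV. cplx_scale (c j) (T_field j p) | c. True}"

definition levi_dist :: "'n::finite heis \<Rightarrow> 'n heis set" where
  "levi_dist p = {fst (v + cplx_conj w) | v w. v \<in> H10 p \<and> w \<in> H10 p}"

definition J_b :: "'n::finite heis \<Rightarrow> 'n heis \<Rightarrow> 'n heis" where
  "J_b p x = (THE y. \<exists>v\<in>H10 p. (x, 0) = v + cplx_conj v \<and> (y, 0) = cplx_scale \<i> (v - cplx_conj v))"


section \<open>Pseudo-Hermitian structures\<close>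

type_synonym 'n one_form = "'n heis \<Rightarrow> ('n heis \<Rightarrow>\<^sub>L real)"

text \<open>Derivatives are taken within \<open>\<Omega>\<close>, so that nothing depends on values outside \<open>\<Omega>\<close>. They are
  unique at boundary points since \<open>\<Omega>\<close> is a domain with smooth boundary. The exterior derivative is
  normalized by \<open>d\<theta>(X, Y) = X \<theta>(Y) - Y \<theta>(X) - \<theta>([X, Y])\<close>, evaluated on constant fields.\<close>

definition ext_deriv ::
  "'n::finite heis set \<Rightarrow> 'n one_form \<Rightarrow> 'n heis \<Rightarrow> 'n heis \<Rightarrow> 'n heis \<Rightarrow> real" where
  "ext_deriv \<Omega> \<theta> p v w =
     blinfun_apply (frechet_derivative \<theta> (at p within \<Omega>) v) w -
     blinfun_apply (frechet_derivative \<theta> (at p within \<Omega>) w) v"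

definition pseudo_hermitian :: "'n::finite heis set \<Rightarrow> 'n one_form \<Rightarrow> bool" where
  "pseudo_hermitian \<Omega> \<theta> \<longleftrightarrow> smooth_on \<Omega> \<theta> \<and>
     (\<forall>p\<in>\<Omega>. \<theta> p \<noteq> 0 \<and> {v. blinfun_apply (\<theta> p) v = 0} = levi_dist p)"

definition cplx_bilinear :: "('a \<Rightarrow> 'a \<Rightarrow> real) \<Rightarrow> 'a cplxfn \<Rightarrow> 'a cplxfn \<Rightarrow> complex" where
  "cplx_bilinear B v w =
     Complex (B (fst v) (fst w) - B (snd v) (snd w)) (B (fst v) (snd w) + B (snd v) (fst w))"

text \<open>\<open>levi_form \<Omega> \<theta> p v w\<close> is \<open>L\<^sub>\<theta>(v, cnj w)\<close>.\<close>

definition levi_form ::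
  "'n::finite heis set \<Rightarrow> 'n one_form \<Rightarrow> 'n heis \<Rightarrow> 'n heis cplxfn \<Rightarrow> 'n heis cplxfn \<Rightarrow> complex" where
  "levi_form \<Omega> \<theta> p v w = - \<i> * cplx_bilinear (ext_deriv \<Omega> \<theta> p) v (cplx_conj w)"

definition levi_positive :: "'n::finite heis set \<Rightarrow> 'n one_form \<Rightarrow> bool" where
  "levi_positive \<Omega> \<theta> \<longleftrightarrow>
     (\<forall>p\<in>\<Omega>. \<forall>v\<in>H10 p. v \<noteq> 0 \<longrightarrow> levi_form \<Omega> \<theta> p v v \<in> \<real> \<and> 0 < Re (levi_form \<Omega> \<theta> p v v))"


section \<open>Webster metric and volume\<close>

definition H_proj :: "'n::finite heis set \<Rightarrow> 'n one_form \<Rightarrow> 'n heis \<Rightarrow> 'n heis \<Rightarrow> 'n heis" where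
  "H_proj \<Omega> \<theta> p v = (THE h. h \<in> levi_dist p \<and> (\<forall>w. ext_deriv \<Omega> \<theta> p (v - h) w = 0))"

definition webster_metric ::
  "'n::finite heis set \<Rightarrow> 'n one_form \<Rightarrow> 'n heis \<Rightarrow> 'n heis \<Rightarrow> 'n heis \<Rightarrow> real" where
  "webster_metric \<Omega> \<theta> p v w =
     ext_deriv \<Omega> \<theta> p (H_proj \<Omega> \<theta> p v) (J_b p (H_proj \<Omega> \<theta> p w)) +
     blinfun_apply (\<theta> p) v * blinfun_apply (\<theta> p) w"

text \<open>The value of \<open>\<theta> \<and> (d\<theta>)\<^sup>n\<close> on vectors \<open>v 0, \<dots>, v (2 n)\<close>. For forms \<open>\<alpha>\<^sub>i\<close> of degree \<open>p\<^sub>i\<close> the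
  value of \<open>\<alpha>\<^sub>1 \<and> \<dots> \<and> \<alpha>\<^sub>r\<close> is the signed sum over all permutations of the products of the \<open>\<alpha>\<^sub>i\<close>,
  divided by \<open>p\<^sub>1! \<cdots> p\<^sub>r!\<close>.\<close>

definition volume_form ::
  "'n::finite heis set \<Rightarrow> 'n one_form \<Rightarrow> 'n heis \<Rightarrow> (nat \<Rightarrow> 'n heis) \<Rightarrow> real" where
  "volume_form \<Omega> \<theta> p v =
     (\<Sum>\<sigma> | \<sigma> permutes {..2 * CARD('n)}.
        of_int (sign \<sigma>) * blinfun_apply (\<theta> p) (v (\<sigma> 0)) *
        (\<Prod>k<CARD('n). ext_deriv \<Omega> \<theta> p (v (\<sigma> (2 * k + 1))) (v (\<sigma> (2 * k + 2))))) / 2 ^ CARD('n)"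

text \<open>An ordering of the standard basis. The density below is independent of its choice.\<close>

definition std_frame :: "nat \<Rightarrow> 'n::finite heis" where
  "std_frame = (SOME b. bij_betw b {..2 * CARD('n)} Basis)"

definition vol_measure :: "'n::finite heis set \<Rightarrow> 'n one_form \<Rightarrow> 'n heis measure" where
  "vol_measure \<Omega> \<theta> = density (lebesgue_on \<Omega>) (\<lambda>p. ennreal \<bar>volume_form \<Omega> \<theta> p std_frame\<bar>)"


section \<open>Dirichlet form and counting function\<close>

definition gradient ::
  "'n::finite heis set \<Rightarrow> 'n one_form \<Rightarrow> ('n heis \<Rightarrow> real) \<Rightarrow> 'n heis \<Rightarrow> 'n heis" where
  "gradient \<Omega> \<theta> u p =
     (THE g. \<forall>w. webster_metric \<Omega> \<theta> p g w = frechet_derivative u (at p within \<Omega>) w)"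

definition sub_gradient ::
  "'n::finite heis set \<Rightarrow> 'n one_form \<Rightarrow> ('n heis \<Rightarrow> real) \<Rightarrow> 'n heis \<Rightarrow> 'n heis" where
  "sub_gradient \<Omega> \<theta> u p = H_proj \<Omega> \<theta> p (gradient \<Omega> \<theta> u p)"

definition dirichlet_form :: "'n::finite heis set \<Rightarrow> 'n one_form \<Rightarrow> ('n heis \<Rightarrow> real) \<Rightarrow> real" where
  "dirichlet_form \<Omega> \<theta> u =
     (\<integral>p. webster_metric \<Omega> \<theta> p (sub_gradient \<Omega> \<theta> u p) (sub_gradient \<Omega> \<theta> u p) \<partial>vol_measure \<Omega> \<theta>)"

definition L2_norm_sq :: "'n::finite heis set \<Rightarrow> 'n one_form \<Rightarrow> ('n heis \<Rightarrow> real) \<Rightarrow> real" where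
  "L2_norm_sq \<Omega> \<theta> u = (\<integral>p. (u p)\<^sup>2 \<partial>vol_measure \<Omega> \<theta>)"

instantiation "fun" :: (type, real_vector) real_vector
begin

definition scaleR_fun_def: "c *\<^sub>R f = (\<lambda>x. c *\<^sub>R f x)"

instance
  by standard (auto simp: scaleR_fun_def plus_fun_def fun_eq_iff scaleR_add_right scaleR_add_left)

end

text \<open>A function on \<open>\<Omega>\<close> is represented by its extension by zero, so that functions which agree on
  \<open>\<Omega>\<close> are equal; smoothness on \<open>\<Omega>\<close> does not see this extension.\<close>

definition smooth_functions :: "'a::euclidean_space set \<Rightarrow> ('a \<Rightarrow> real) set" where
  "smooth_functions \<Omega> = {u. smooth_on \<Omega> u \<and> (\<forall>p. p \<notin> \<Omega> \<longrightarrow> u p = 0)}"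

definition ext_dim :: "'a::real_vector set \<Rightarrow> enat" where
  "ext_dim V = (if \<exists>B. finite B \<and> V \<subseteq> span B then enat (dim V) else \<infinity>)"

text \<open>The number of Neumann eigenvalues less than \<open>\<lambda>\<close>, as the number of spectral values less than
  \<open>\<lambda>\<close> of the Dirichlet form on smooth functions. This is the variational form of the count: no
  regularity of eigenfunctions up to the boundary is presupposed.\<close>

definition neumann_count :: "'n::finite heis set \<Rightarrow> 'n one_form \<Rightarrow> real \<Rightarrow> enat" where
  "neumann_count \<Omega> \<theta> lam =
     (SUP V \<in> {V. subspace V \<and> V \<subseteq> smooth_functions \<Omega> \<and>
                  (\<forall>u\<in>V - {0}. dirichlet_form \<Omega> \<theta> u < lam * L2_norm_sq \<Omega> \<theta> u)}. ext_dim V)"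

end

theory Submission
  imports Defs
begin

text \<open>Write \<open>\<theta> = f \<theta>\<^sub>0\<close> with the standard contact form \<open>\<theta>\<^sub>0\<close> and \<open>f > 0\<close>. Up to constants the volume is
  \<open>f\<^sup>n\<^sup>+\<^sup>1 dx\<close> and \<open>|\<nabla>\<^sub>b u|\<^sup>2 = |\<nabla>\<^sub>0 u|\<^sup>2 / f\<close>, so the energy \<open>\<integral> |\<nabla>\<^sub>b u|\<^sup>2\<^sup>n\<^sup>+\<^sup>2\<close> does not depend on \<open>f\<close>; for cutoff
  functions of annuli of the Koranyi metric it is bounded by scale invariance. By a decomposition in the
  manner of Grigor'yan, Netrusov and Yau there are \<open>2k\<close> annuli of volume at least a constant times
  \<open>Vol / k\<close> whose doubles are disjoint, and at least \<open>k\<close> of the doubles have volume at most \<open>Vol / k\<close>.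
  Hoelder's inequality bounds the Rayleigh quotients of the \<open>k\<close> cutoff functions by a constant times
  \<open>(k / Vol)\<^sup>1\<^sup>/\<^sup>(\<^sup>n\<^sup>+\<^sup>1\<^sup>)\<close>. The boundary is a null set, so only interior points matter.

  For the annuli, pick greedily the smallest balls of volume at least \<open>m\<close>, of order \<open>Vol / k\<close>, with disjoint
  doubles. If fewer than \<open>k\<close> balls result, with set of centres \<open>F\<close>, then all balls \<open>B(y, d(y, F) / 6)\<close> have
  volume less than \<open>m\<close>. Hence the points from which \<open>F\<close> does not look like a single cluster carry little
  volume, and the remaining ones lie in nearly round regions around at most \<open>2 |F|\<close> clusters, which are
  cut radially.\<close>

section \<open>Disjoint annuli for atomless set functions\<close>

text \<open>The constant can depend on n alone because the annuli live in the whole group: the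
  packing and volume constants of the Koranyi metric know nothing of \<Omega> or \<theta>. The
  variational count imposes no boundary condition, so cutoff functions of the group may simply be
  restricted to \<Omega>, and their (2n+2)-energy only decreases. The structure \<theta> enters
  through its volume, used as a weight. The obstacle is that this weight need not be doubling. Mass
  may pile up at many scales around few points, and then k heavy balls with disjoint doubles do not
  exist. This is why annuli are used and why the case of few balls calls for an analysis of
  clusters. The weight itself contributes only qualitative properties (bounded support, uniformly
  small volume of small balls), which leave no trace in the constants. Disjoint supports turn k test
  functions into a k-dimensional test space; solving the bound for the Rayleigh quotients for k
  gives the power n+1 of \<lambda>.\<close>

lemma card_laminar_le:
  assumes "finite F" "\<A> \<subseteq> Pow F - {{}}"
    and "\<And>A B. A \<in> \<A> \<Longrightarrow> B \<in> \<A> \<Longrightarrow> A \<inter> B \<noteq> {} \<Longrightarrow> A \<subseteq> B \<or> B \<subseteq> A"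
  shows "card \<A> \<le> 2 * card F"
  using assms
proof (induction F arbitrary: \<A> rule: finite_induct)
  case empty
  then show ?case by auto
next
  case (insert z F)
  have finA: "finite \<A>" using insert.prems(1) insert.hyps(1) by (meson finite_Diff finite_Pow_iff finite_insert finite_subset)
  define \<B> where "\<B> = (\<lambda>A. A - {z}) ` \<A> - {{}}"
  \<comment> \<open>Removing \<open>z\<close> is injective on \<open>\<A>\<close> away from
    \<open>\<D>\<close>, and only \<open>{z}\<close> is lost to the empty set. Two members of
    \<open>\<D>\<close> are nested, say A inside B; then A meets B - {z} and contains
    \<open>z\<close>, so B - {z} lies in A and A = B. Each induction step therefore costs at most
    2.\<close>
  define \<D> where "\<D> = {A \<in> \<A>. z \<in> A \<and> A - {z} \<in> \<A>}"
  have lamB: "A \<subseteq> B \<or> B \<subseteq> A" if AB: "A \<in> \<B>" "B \<in> \<B>" "A \<inter> B \<noteq> {}" for A B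
  proof -
    obtain A' B' where "A' \<in> \<A>" "B' \<in> \<A>" "A = A' - {z}" "B = B' - {z}" using AB unfolding \<B>_def by auto
    with insert.prems(2)[of A' B'] AB(3) show ?thesis by blast
  qed
  have "\<B> \<subseteq> Pow F - {{}}" unfolding \<B>_def using insert.prems(1) by auto
  then have B: "card \<B> \<le> 2 * card F" using insert.IH lamB by blast
  have "card \<D> \<le> 1"
  proof -
    have "A = B" if "A \<in> \<D>" "B \<in> \<D>" for A B
    proof -
      have z: "z \<in> A" "z \<in> B" "A \<in> \<A>" "B \<in> \<A>" "A - {z} \<in> \<A>" "B - {z} \<in> \<A>" using that unfolding \<D>_def by auto
      have ne: "A - {z} \<noteq> {}" "B - {z} \<noteq> {}" using z insert.prems(1) by blast+
      have AB: "A \<subseteq> B \<or> B \<subseteq> A" using insert.prems(2)[of A B] z by blast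
      then consider "A \<subseteq> B" | "B \<subseteq> A" by blast
      then show ?thesis
      proof cases
        case 1
        then have "A \<inter> (B - {z}) \<noteq> {}" using ne by blast
        with insert.prems(2)[of A "B - {z}"] z 1 show ?thesis by blast
      next
        case 2
        then have "B \<inter> (A - {z}) \<noteq> {}" using ne by blast
        with insert.prems(2)[of B "A - {z}"] z 2 show ?thesis by blast
      qed
    qed
    moreover have "finite \<D>" unfolding \<D>_def using finA by auto
    ultimately show ?thesis by (simp add: card_le_Suc0_iff_eq)
  qed
  moreover have "card \<A> \<le> card \<B> + card (insert {z} \<D>)"
  proof -
    have "inj_on (\<lambda>A. A - {z}) (\<A> - insert {z} \<D>)"
    proof (rule inj_onI)
      fix A B assume A: "A \<in> \<A> - insert {z} \<D>" and B: "B \<in> \<A> - insert {z} \<D>" and e: "A - {z} = B - {z}"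
      show "A = B"
      proof (cases "z \<in> A \<longleftrightarrow> z \<in> B")
        case True then show ?thesis using e by auto
      next
        case False
        then consider "z \<in> A" "z \<notin> B" | "z \<notin> A" "z \<in> B" by blast
        then show ?thesis
        proof cases
          case 1 then have "A - {z} = B" using e by auto
          then show ?thesis using A B 1 unfolding \<D>_def by auto
        next
          case 2 then have "B - {z} = A" using e by auto
          then show ?thesis using A B 2 unfolding \<D>_def by auto
        qed
      qed
    qed
    moreover have "(\<lambda>A. A - {z}) ` (\<A> - insert {z} \<D>) \<subseteq> \<B>"
      unfolding \<B>_def using insert.prems(1) by blast
    moreover have "finite \<B>" unfolding \<B>_def using finA by auto
    ultimately have "card (\<A> - insert {z} \<D>) \<le> card \<B>"
      by (metis card_inj_on_le)
    moreover have "card \<A> - card (insert {z} \<D>) \<le> card (\<A> - insert {z} \<D>)"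
      by (rule diff_card_le_card_Diff) (auto simp: \<D>_def finA)
    ultimately show ?thesis by linarith
  qed
  moreover have "card (insert {z} \<D>) \<le> Suc (card \<D>)" by (rule card_insert_le_m1) auto
  ultimately show ?case using B insert.hyps by simp
qed

text \<open>The ratio 300000 in the packing condition only has to be large.\<close>

locale atomless_set_function = Metric_space UNIV d for d :: "'a \<Rightarrow> 'a \<Rightarrow> real" +
  fixes \<nu> :: "'a set \<Rightarrow> real" and N :: nat
  assumes mono: "A \<subseteq> B \<Longrightarrow> \<nu> A \<le> \<nu> B"
    and subadd: "\<nu> (A \<union> B) \<le> \<nu> A + \<nu> B"
    and empty0: "\<nu> {} = 0"
    and atomless: "0 < m \<Longrightarrow> \<exists>r>0. \<forall>x. \<nu> {y. d x y < r} < m"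
    and bounded_support: "\<exists>x r. \<nu> {y. r \<le> d x y} = 0"
    and packing: "\<lbrakk>0 < r; finite S; S \<subseteq> {y. d p y \<le> 300000 * r};
        \<forall>x\<in>S. \<forall>y\<in>S. x \<noteq> y \<longrightarrow> r \<le> d x y\<rbrakk> \<Longrightarrow> card S \<le> N"
begin

section \<open>Coverings by small balls and light regions\<close>

lemma dsym: "d x y = d y x" and dtri: "d x z \<le> d x y + d y z" and d0: "d x x = 0"
  and dpos: "x \<noteq> y \<Longrightarrow> 0 < d x y" and dnn: "0 \<le> d x y"
  using commute triangle zero nonneg mdist_pos_eq by auto

lemma UN_le: "finite I \<Longrightarrow> \<nu> (\<Union>i\<in>I. A i) \<le> (\<Sum>i\<in>I. \<nu> (A i))"
proof (induction I rule: finite_induct)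
  case (insert x I)
  then show ?case using subadd[of "A x" "\<Union>i\<in>I. A i"] by auto
qed (simp add: empty0)

lemma UN_le_bound:
  fixes c :: real
  assumes "finite I" "A \<subseteq> (\<Union>i\<in>I. B i)" "\<And>i. i \<in> I \<Longrightarrow> \<nu> (B i) \<le> c"
  shows "\<nu> A \<le> card I * c"
proof -
  have "\<nu> A \<le> \<nu> (\<Union>i\<in>I. B i)" by (rule mono) fact
  also have "\<dots> \<le> (\<Sum>i\<in>I. \<nu> (B i))" by (rule UN_le) fact
  also have "\<dots> \<le> card I * c" using sum_bounded_above[of I "\<lambda>i. \<nu> (B i)" c] assms(3) by auto
  finally show ?thesis .
qed

text \<open>Since \<open>packing\<close> bounds the size of r-separated subsets of \<open>T\<close>,
  one of greatest size exists; a point outside its r-balls could be added to it.\<close>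

lemma cover_by_balls:
  assumes r: "0 < r" and T: "T \<subseteq> {y. d p y \<le> 300000 * r}"
  obtains S where "finite S" "S \<subseteq> T" "card S \<le> N" "T \<subseteq> (\<Union>x\<in>S. {y. d x y < r})"
proof -
  define Q where "Q S \<longleftrightarrow> finite S \<and> S \<subseteq> T \<and> (\<forall>x\<in>S. \<forall>y\<in>S. x \<noteq> y \<longrightarrow> r \<le> d x y)" for S
  have b: "card S \<le> N" if "Q S" for S
    by (rule packing[OF r, of S p]) (use that T in \<open>auto simp: Q_def\<close>)
  have "Q {}" unfolding Q_def by simp
  obtain S where S: "Q S" "\<And>S'. Q S' \<Longrightarrow> card S' \<le> card S"
    using ex_has_greatest_nat[of Q "{}" card "Suc N"] b \<open>Q {}\<close> by (auto simp: less_Suc_eq_le)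
  have "T \<subseteq> (\<Union>x\<in>S. {y. d x y < r})"
  proof
    fix y assume y: "y \<in> T"
    show "y \<in> (\<Union>x\<in>S. {y. d x y < r})"
    proof (rule ccontr)
      assume c: "y \<notin> (\<Union>x\<in>S. {y. d x y < r})"
      then have far: "r \<le> d x y" if "x \<in> S" for x using that by force
      have "y \<notin> S" using far[of y] d0 r by auto
      have "Q (insert y S)" using S(1) y far dsym unfolding Q_def by auto
      then show False using S(2)[of "insert y S"] \<open>y \<notin> S\<close> S(1) unfolding Q_def by auto
    qed
  qed
  then show thesis using that[of S] S(1) b[OF S(1)] unfolding Q_def by simp
qed

text \<open>The outcome of a failed greedy selection. The factor 6 is 2 + 4: if the double of a ball
  of radius \<rho> meets the double of a selected ball of radius at most 2\<rho>, the centres are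
  less than 2\<rho> + 4\<rho> apart.\<close>

definition light :: "'a set \<Rightarrow> real \<Rightarrow> bool" where
  "light F m \<longleftrightarrow> (\<forall>y \<rho>. 0 < \<rho> \<longrightarrow> (\<forall>x\<in>F. 6 * \<rho> \<le> d y x) \<longrightarrow> \<nu> {q. d y q < \<rho>} < m)"

text \<open>At most \<open>N\<close> balls of radius r cover the region, and each is light because
  its centre stays \<open>6 * r\<close> away from \<open>F\<close>. Every exceptional set below is
  shown to be small by placing it in such regions, bounded and away from \<open>F\<close> at one
  common scale.\<close>

lemma light_region_small:
  fixes m :: real
  assumes F: "light F m" and r: "0 < r"
    and T: "T \<subseteq> {y. d p y \<le> 300000 * r \<and> (\<forall>x\<in>F. 6 * r \<le> d y x)}" and m: "0 \<le> m"
  shows "\<nu> T \<le> N * m"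
proof -
  obtain S where S: "finite S" "S \<subseteq> T" "card S \<le> N" "T \<subseteq> (\<Union>x\<in>S. {y. d x y < r})"
    using cover_by_balls[OF r, of T p] T by auto
  have "\<nu> {y. d x y < r} \<le> m" if "x \<in> S" for x
    using F r that T S(2) unfolding light_def by fastforce
  then have "\<nu> T \<le> card S * m" using UN_le_bound[OF S(1,4)] by blast
  also have "\<dots> \<le> N * m" using S(3) m by (simp add: mult_right_mono)
  finally show ?thesis .
qed

text \<open>Heavy balls are selected greedily by increasing radius, up to a factor 2. When no
  further ball fits, every heavy ball meets a selected one which is not much larger.\<close>

lemma disjoint_heavy_balls_or_light:
  assumes m: "0 < (m::real)"
  shows "(\<exists>X R. (\<forall>i<k. 0 < R i \<and> m \<le> \<nu> {y. d (X i) y < R i}) \<and>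
            (\<forall>i<k. \<forall>j<k. i \<noteq> j \<longrightarrow> {y. d (X i) y < 2 * R i} \<inter> {y. d (X j) y < 2 * R j} = {})) \<or>
         (\<exists>F. finite F \<and> card F < k \<and> light F m)"
proof -
  define heavy where "heavy y \<rho> \<longleftrightarrow> 0 < \<rho> \<and> m \<le> \<nu> {q. d y q < \<rho>}" for y \<rho>
  define D where "D y \<rho> = {q. d y q < 2 * \<rho>}" for y \<rho>
  \<comment> \<open>The last clause of \<open>G\<close> records that each choice was nearly minimal:
    a heavy ball of less than half the chosen radius was already blocked by an earlier
    choice.\<close>
  define G where "G l X R \<longleftrightarrow> (\<forall>i<l. heavy (X i) (R i)) \<and>
     (\<forall>i<l. \<forall>j<i. D (X i) (R i) \<inter> D (X j) (R j) = {}) \<and>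
     (\<forall>i<l. \<forall>y \<rho>. heavy y \<rho> \<and> \<rho> < R i / 2 \<longrightarrow> (\<exists>j<i. D y \<rho> \<inter> D (X j) (R j) \<noteq> {}))"
    for l :: nat and X :: "nat \<Rightarrow> 'a" and R :: "nat \<Rightarrow> real"
  obtain r0 where r0: "r0 > 0" "\<And>x. \<nu> {y. d x y < r0} < m" using atomless[OF m] by blast
  have hr0: "r0 \<le> \<rho>" if "heavy y \<rho>" for y \<rho>
  proof (rule ccontr)
    assume "\<not> r0 \<le> \<rho>"
    then have "\<nu> {q. d y q < \<rho>} \<le> \<nu> {q. d y q < r0}" by (intro mono) auto
    then show False using r0(2)[of y] that unfolding heavy_def by auto
  qed
  have "(\<exists>X R. G l X R) \<or> (\<exists>F. finite F \<and> card F < k \<and> light F m)" if "l \<le> k" for l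
    using that
  proof (induction l)
    case 0
    show ?case unfolding G_def by auto
  next
    case (Suc l)
    show ?case
    proof (cases "\<exists>F. finite F \<and> card F < k \<and> light F m")
      case False
      then obtain X R where G: "G l X R" using Suc by auto
      define cand where "cand y \<rho> \<longleftrightarrow> heavy y \<rho> \<and> (\<forall>j<l. D y \<rho> \<inter> D (X j) (R j) = {})" for y \<rho>
      have "\<exists>y \<rho>. cand y \<rho>"
      proof (rule ccontr)
        assume nc: "\<nexists>y \<rho>. cand y \<rho>"
        have "light (X ` {..<l}) m"
          unfolding light_def
        proof (intro allI impI, rule ccontr)
          fix y \<rho> assume \<rho>: "0 < \<rho>" "\<forall>x\<in>X ` {..<l}. 6 * \<rho> \<le> d y x" "\<not> \<nu> {q. d y q < \<rho>} < m"
          then have h: "heavy y \<rho>" unfolding heavy_def by auto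
          \<comment> \<open>For the first selected ball that blocks the given one, near-minimality
            at stage \<open>i\<close> excludes \<rho> < R i / 2, because no earlier ball
            blocks.\<close>
          define i where "i = (LEAST j. j < l \<and> D y \<rho> \<inter> D (X j) (R j) \<noteq> {})"
          have ex: "\<exists>j. j < l \<and> D y \<rho> \<inter> D (X j) (R j) \<noteq> {}" using nc h unfolding cand_def by blast
          have i: "i < l" "D y \<rho> \<inter> D (X i) (R i) \<noteq> {}" using LeastI_ex[OF ex] unfolding i_def by auto
          have "D y \<rho> \<inter> D (X j) (R j) = {}" if "j < i" for j
            using not_less_Least[of j "\<lambda>j. j < l \<and> D y \<rho> \<inter> D (X j) (R j) \<noteq> {}"] that i(1) unfolding i_def by auto
          then have "\<not> \<rho> < R i / 2" using G i(1) h unfolding G_def by blast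
          moreover obtain q where "d y q < 2 * \<rho>" "d (X i) q < 2 * R i" using i(2) unfolding D_def by auto
          ultimately have "d y (X i) < 6 * \<rho>" using dtri[of y "X i" q] dsym[of q "X i"] by linarith
          then show False using \<rho>(2) i(1) by force
        qed
        moreover have "card (X ` {..<l}) < k" using card_image_le[of "{..<l}" X] Suc.prems by auto
        ultimately show False using False by blast
      qed
      define P where "P = {\<rho>. \<exists>y. cand y \<rho>}"
      have Pne: "P \<noteq> {}" using \<open>\<exists>y \<rho>. cand y \<rho>\<close> unfolding P_def by auto
      have Plb: "r0 \<le> \<rho>" if "\<rho> \<in> P" for \<rho> using that hr0 unfolding P_def cand_def by auto
      have bdd: "bdd_below P" using Plb by (rule bdd_belowI)
      \<comment> \<open>The infimum need not be attained; as it is positive, some candidate has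
        radius below twice the infimum.\<close>
      have "r0 \<le> Inf P" using Pne Plb by (intro cInf_greatest)
      then have "Inf P < 2 * Inf P" using r0 by auto
      then obtain \<rho> where \<rho>: "\<rho> \<in> P" "\<rho> < 2 * Inf P" using cInf_lessD[OF Pne] by blast
      then obtain y where y: "cand y \<rho>" unfolding P_def by auto
      have min: "\<not> cand y' \<rho>'" if "\<rho>' < \<rho> / 2" for y' \<rho>'
      proof
        assume "cand y' \<rho>'"
        then have "Inf P \<le> \<rho>'" using cInf_lower[OF _ bdd, of \<rho>'] unfolding P_def by auto
        then show False using that \<rho>(2) by auto
      qed
      have "\<exists>j<i. D y' \<rho>' \<inter> D ((X(l := y)) j) ((R(l := \<rho>)) j) \<noteq> {}"
        if "i < Suc l" "heavy y' \<rho>'" "\<rho>' < (R(l := \<rho>)) i / 2" for i y' \<rho>'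
      proof -
        have "\<exists>j<i. D y' \<rho>' \<inter> D (X j) (R j) \<noteq> {}"
        proof (cases "i = l")
          case True
          then show ?thesis using min[of \<rho>' y'] that unfolding cand_def by auto
        next
          case False
          then have "i < l" "\<rho>' < R i / 2" using that by auto
          then show ?thesis using G that(2) unfolding G_def by blast
        qed
        then obtain j where "j < i" "D y' \<rho>' \<inter> D (X j) (R j) \<noteq> {}" by blast
        then show ?thesis using that(1) by (intro exI[of _ j]) auto
      qed
      moreover have "heavy ((X(l := y)) i) ((R(l := \<rho>)) i)" if "i < Suc l" for i
        using G y that unfolding G_def cand_def by auto
      moreover have "D ((X(l := y)) i) ((R(l := \<rho>)) i) \<inter> D ((X(l := y)) j) ((R(l := \<rho>)) j) = {}"
        if "i < Suc l" "j < i" for i j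
      proof (cases "i = l")
        case True
        then show ?thesis using y that unfolding cand_def by simp
      next
        case False
        then have "i < l" "j < l" using that by auto
        then show ?thesis using G that unfolding G_def by simp
      qed
      ultimately have "G (Suc l) (X(l := y)) (R(l := \<rho>))"
        unfolding G_def by blast
      then show ?thesis by blast
    qed blast
  qed
  from this[of k, OF le_refl] show ?thesis
  proof (elim disjE exE)
    fix X R assume G: "G k X R"
    have "D (X i) (R i) \<inter> D (X j) (R j) = {}" if "i < k" "j < k" "i \<noteq> j" for i j
      using G that unfolding G_def by (cases "i < j") (auto simp: Int_commute)
    moreover have "heavy (X i) (R i)" if "i < k" for i
      using G that unfolding G_def by simp
    ultimately show ?thesis
      unfolding heavy_def D_def by (intro disjI1 exI[of _ X] exI[of _ R]) simp
  qed auto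
qed

text \<open>Farthest point traversal: \<open>F\<close> is enumerated by always adding the point
  farthest from those already chosen, and \<delta> records that distance at the moment of insertion.
  These values do not increase along the enumeration, so at every scale s the points with \<delta> >
  s form an s-net. A single function serves all scales, which is why exceptional points can later be
  charged to card F shells, however many scales occur.\<close>

lemma farthest_point_net:
  assumes F: "finite F" "F \<noteq> {}"
  shows "\<exists>\<delta>. (\<forall>u\<in>F. 0 < \<delta> u) \<and> (\<forall>u\<in>F. \<forall>v\<in>F. u \<noteq> v \<longrightarrow> min (\<delta> u) (\<delta> v) \<le> d u v) \<and>
    (\<forall>s. 0 < s \<and> s < D \<longrightarrow> (\<forall>x\<in>F. \<exists>u\<in>F. s < \<delta> u \<and> d x u \<le> s))"
proof -
  define net where "net G \<delta> r \<longleftrightarrow> G \<subseteq> F \<and> 0 \<le> r \<and> (\<forall>x\<in>F. \<exists>u\<in>G. d x u \<le> r) \<and>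
     (\<forall>u\<in>G. r \<le> \<delta> u \<and> 0 < \<delta> u) \<and> (\<forall>u\<in>G. \<forall>v\<in>G. u \<noteq> v \<longrightarrow> min (\<delta> u) (\<delta> v) \<le> d u v) \<and>
     (\<forall>s. r \<le> s \<and> s < D \<longrightarrow> (\<forall>x\<in>F. \<exists>u\<in>G. s < \<delta> u \<and> d x u \<le> s))" for G \<delta> and r :: real
  have step: "\<exists>G \<delta> r. card G = Suc n \<and> net G \<delta> r" if "Suc n \<le> card F" for n
    using that
  proof (induction n)
    case 0
    obtain x0 where x0: "x0 \<in> F" using F by auto
    define r where "r = Max (d x0 ` F)"
    have r: "d x0 x \<le> r" if "x \<in> F" for x unfolding r_def using F that by auto
    have "0 \<le> r" using r[OF x0] d0 by auto
    have r': "d x x0 \<le> r" if "x \<in> F" for x using r[OF that] dsym by metis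
    \<comment> \<open>The first point must serve every scale between its covering radius and
      \<open>D\<close>; its value is taken above both.\<close>
    have "net {x0} (\<lambda>_. \<bar>D\<bar> + r + 1) r"
      unfolding net_def
    proof (intro conjI allI impI ballI)
      fix s x assume s: "r \<le> s \<and> s < D" and x: "x \<in> F"
      then show "\<exists>u\<in>{x0}. s < \<bar>D\<bar> + r + 1 \<and> d x u \<le> s" using r'[OF x] \<open>0 \<le> r\<close> by auto
    qed (use x0 r' \<open>0 \<le> r\<close> in auto)
    then show ?case by (intro exI[of _ "{x0}"] exI[of _ "\<lambda>_. \<bar>D\<bar> + r + 1"] exI[of _ r]) simp
  next
    case (Suc n)
    then obtain G \<delta> r where G: "card G = Suc n" "net G \<delta> r" by auto
    have GF: "G \<subseteq> F" "finite G" "G \<noteq> {}" using G F finite_subset unfolding net_def by (auto intro: finite_subset)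
    define f where "f x = Min (d x ` G)" for x
    have f_le: "f x \<le> d x u" if "u \<in> G" for x u unfolding f_def using GF that by auto
    have f_att: "\<exists>u\<in>G. f x = d x u" for x
      unfolding f_def using Min_in[of "d x ` G"] GF by (metis finite_imageI image_iff image_is_empty)
    have "Max (f ` F) \<in> f ` F" using F by (intro Max_in) auto
    then obtain z where z: "z \<in> F" "f z = Max (f ` F)" by auto
    then have z_max: "f x \<le> f z" if "x \<in> F" for x using F that by simp
    have "G \<noteq> F" using G Suc.prems by auto
    then obtain x where x: "x \<in> F" "x \<notin> G" using GF by auto
    obtain u where "u \<in> G" "f x = d x u" using f_att by blast
    then have "0 < f x" using x dpos[of x u] by auto
    then have fz: "0 < f z" using z_max[OF x(1)] by linarith
    then have zG: "z \<notin> G" using f_le[of z z] d0 by auto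
    obtain u where "u \<in> G" "d z u \<le> r" using G(2) z(1) unfolding net_def by blast
    then have fr: "f z \<le> r" using f_le[of u z] by linarith
    have near: "\<exists>u\<in>G. d x u \<le> f z" if "x \<in> F" for x using z_max[OF that] f_att[of x] by auto
    \<comment> \<open>Between the new and the old covering radius the old points still suffice: they
      cover at distance \<open>f z\<close>, and their values are at least the old radius.\<close>
    have nets: "\<exists>u\<in>G. s < \<delta> u \<and> d x u \<le> s" if s: "f z \<le> s" "s < D" "x \<in> F" for s x
    proof (cases "r \<le> s")
      case True then show ?thesis using G(2) s unfolding net_def by blast
    next
      case False
      obtain u where "u \<in> G" "d x u \<le> f z" using near[OF s(3)] by blast
      moreover have "r \<le> \<delta> u" using G(2) \<open>u \<in> G\<close> unfolding net_def by blast
      ultimately show ?thesis using s False by (intro bexI[of _ u]) auto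
    qed
    have "net (insert z G) (\<delta>(z := f z)) (f z)"
      unfolding net_def
    proof (intro conjI)
      show "insert z G \<subseteq> F" using z GF by auto
      show "0 \<le> f z" using fz by simp
      show "\<forall>x\<in>F. \<exists>u\<in>insert z G. d x u \<le> f z" using near by blast
      show "\<forall>u\<in>insert z G. f z \<le> (\<delta>(z := f z)) u \<and> 0 < (\<delta>(z := f z)) u"
        using G(2) fr fz order_trans unfolding net_def by auto
      show "\<forall>u\<in>insert z G. \<forall>v\<in>insert z G. u \<noteq> v \<longrightarrow> min ((\<delta>(z := f z)) u) ((\<delta>(z := f z)) v) \<le> d u v"
      proof (intro ballI impI)
        fix u v assume uv: "u \<in> insert z G" "v \<in> insert z G" "u \<noteq> v"
        then consider "u = z" "v \<in> G" | "v = z" "u \<in> G" | "u \<in> G" "v \<in> G" "u \<noteq> z" "v \<noteq> z" by auto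
        then show "min ((\<delta>(z := f z)) u) ((\<delta>(z := f z)) v) \<le> d u v"
        proof cases
          case 1 then show ?thesis using f_le[of v z] by (simp add: min_le_iff_disj)
        next
          case 2 then show ?thesis using f_le[of u z] dsym[of u z] by (simp add: min_le_iff_disj)
        next
          case 3 then show ?thesis using G(2) uv(3) unfolding net_def by simp
        qed
      qed
      show "\<forall>s. f z \<le> s \<and> s < D \<longrightarrow> (\<forall>x\<in>F. \<exists>u\<in>insert z G. s < (\<delta>(z := f z)) u \<and> d x u \<le> s)"
      proof (intro allI impI ballI)
        fix s x assume "f z \<le> s \<and> s < D" "x \<in> F"
        then obtain u where "u \<in> G" "s < \<delta> u" "d x u \<le> s" using nets by blast
        then show "\<exists>u\<in>insert z G. s < (\<delta>(z := f z)) u \<and> d x u \<le> s" using zG by (intro bexI[of _ u]) auto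
      qed
    qed
    moreover have "card (insert z G) = Suc (Suc n)" using zG GF G(1) by simp
    ultimately show ?case by (intro exI conjI)
  qed
  have "card F = Suc (card F - 1)" using F by (simp add: card_gt_0_iff)
  then obtain G \<delta> r where G: "card G = card F" "net G \<delta> r" using step[of "card F - 1"] by auto
  then have [simp]: "G = F" using F card_subset_eq unfolding net_def by metis
  show ?thesis
  proof (intro exI[of _ \<delta>] conjI allI impI ballI)
    fix s x assume s: "0 < s \<and> s < D" and x: "x \<in> F"
    show "\<exists>u\<in>F. s < \<delta> u \<and> d x u \<le> s"
    proof (cases "r \<le> s")
      case True then show ?thesis using G s x unfolding net_def by auto
    next
      case False
      moreover have "r \<le> \<delta> x" using G x unfolding net_def by auto
      ultimately show ?thesis using x s d0 by (intro bexI[of _ x]) auto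
    qed
  qed (use G in \<open>auto simp: net_def\<close>)
qed

section \<open>Clusters of centres and branching points\<close>

definition dist_set :: "'a set \<Rightarrow> 'a \<Rightarrow> real" where
  "dist_set F y = Min (d y ` F)"

lemma dist_set_le: "finite F \<Longrightarrow> x \<in> F \<Longrightarrow> dist_set F y \<le> d y x"
  unfolding dist_set_def by auto

lemma dist_set_attained: "finite F \<Longrightarrow> F \<noteq> {} \<Longrightarrow> \<exists>x\<in>F. dist_set F y = d y x"
  unfolding dist_set_def using Min_in[of "d y ` F"] by (metis finite_imageI image_iff image_is_empty)

text \<open>The centres that \<open>y\<close> sees at about the distance of the nearest one. The
  factor 8 leaves room for \<open>7 * 11 / 10\<close>, the estimate by which
  \<open>spans_unique\<close> recognizes members of a cluster.\<close>

definition cluster :: "'a set \<Rightarrow> 'a \<Rightarrow> 'a set" where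
  "cluster F y = {x\<in>F. d y x < 8 * dist_set F y}"

definition branching :: "'a set \<Rightarrow> 'a \<Rightarrow> bool" where
  "branching F y \<longleftrightarrow> (\<exists>u\<in>cluster F y. \<exists>v\<in>cluster F y. dist_set F y / 10 < d u v)"

text \<open>A branching point at distance \<rho> from \<open>F\<close> sees two centres a, b whose
  distance E is comparable with \<rho>. The points of the net at scale E/4 near a and near b are
  distinct, so by separation one of them, w, has \<delta> between E/4 and 3E/2. The branching point
  then lies in the shell \<open>T w\<close> at the scale of \<open>\<delta> w\<close>. There are
  card F shells, and each is covered by few light balls.\<close>

lemma branching_small:
  fixes m :: real
  assumes F: "finite F" "F \<noteq> {}" "light F m" and m: "0 \<le> m"
  shows "\<nu> {y. y \<notin> F \<and> branching F y} \<le> card F * (N * m)"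
proof -
  define D where "D = 1 + (\<Sum>x\<in>F. \<Sum>y\<in>F. d x y)"
  have D: "d x y < D" if "x \<in> F" "y \<in> F" for x y
  proof -
    have "d x y \<le> (\<Sum>y\<in>F. d x y)" using F that dnn by (intro member_le_sum) auto
    also have "\<dots> \<le> (\<Sum>x\<in>F. \<Sum>y\<in>F. d x y)" using F that dnn
      by (intro member_le_sum[where f="\<lambda>x. \<Sum>y\<in>F. d x y"]) (auto intro: sum_nonneg)
    finally show ?thesis unfolding D_def by auto
  qed
  obtain \<delta> where \<delta>: "\<And>u. u \<in> F \<Longrightarrow> 0 < \<delta> u"
     "\<And>u v. u \<in> F \<Longrightarrow> v \<in> F \<Longrightarrow> u \<noteq> v \<Longrightarrow> min (\<delta> u) (\<delta> v) \<le> d u v"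
     "\<And>s x. 0 < s \<Longrightarrow> s < D \<Longrightarrow> x \<in> F \<Longrightarrow> \<exists>u\<in>F. s < \<delta> u \<and> d x u \<le> s"
    using farthest_point_net[OF F(1,2), of D] by metis
  \<comment> \<open>The divisor 144: a branching point at distance \<rho> from \<open>F\<close> is
    charged to some w with \<rho>/40 < \<delta> w < 24\<rho> at distance at most 28\<rho>. Then 6 *
    \<delta> w / 144 is at most \<rho>, and 300000 / 144 * \<delta> w exceeds 28\<rho>.\<close>
  define T where "T u = {y. d u y \<le> 300000 * (\<delta> u / 144) \<and> (\<forall>x\<in>F. 6 * (\<delta> u / 144) \<le> d y x)}" for u
  have "{y. y \<notin> F \<and> branching F y} \<subseteq> (\<Union>u\<in>F. T u)"
  proof safe
    fix y assume y: "y \<notin> F" "branching F y"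
    define \<rho> where "\<rho> = dist_set F y"
    have \<rho>le: "\<rho> \<le> d y x" if "x \<in> F" for x unfolding \<rho>_def using F that dist_set_le by auto
    obtain x where "x \<in> F" "\<rho> = d y x" unfolding \<rho>_def using F dist_set_attained by blast
    then have \<rho>0: "0 < \<rho>" using y dpos by auto
    obtain a b where ab: "a \<in> F" "b \<in> F" "d y a < 8 * \<rho>" "d y b < 8 * \<rho>" "\<rho> / 10 < d a b"
      using y(2) unfolding branching_def cluster_def \<rho>_def by auto
    define E where "E = d a b"
    have E: "\<rho> / 10 < E" "E < 16 * \<rho>" "0 < E" "E / 4 < D"
      using ab dtri[of a b y] dsym[of a y] D[of a b] \<rho>0 unfolding E_def by linarith+
    obtain u where u: "u \<in> F" "E / 4 < \<delta> u" "d a u \<le> E / 4" using \<delta>(3)[of "E/4" a] E ab by auto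
    obtain v where v: "v \<in> F" "E / 4 < \<delta> v" "d b v \<le> E / 4" using \<delta>(3)[of "E/4" b] E ab by auto
    have tri: "E \<le> d a u + d u v + d b v" "d u v \<le> d a u + E + d b v" "d a v \<le> E + d b v"
      using dtri[of a b u] dtri[of u b v] dsym[of b v] dtri[of u v a] dtri[of a v b] dsym[of u a]
      unfolding E_def by linarith+
    have "u \<noteq> v" using tri(1) u v d0[of u] E by auto
    then have "min (\<delta> u) (\<delta> v) \<le> 3 / 2 * E" using \<delta>(2)[of u v] u v tri(2) by linarith
    then obtain w where w: "w \<in> F" "E / 4 < \<delta> w" "\<delta> w \<le> 3 / 2 * E" "d a w \<le> 5 / 4 * E"
      using u v tri(3) E by (cases "\<delta> u \<le> \<delta> v") (auto simp: min_def)
    have "d w y \<le> 28 * \<rho>" using dtri[of y w a] w(4) ab E dsym[of w y] by linarith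
    then have "y \<in> T w" unfolding T_def using w E \<rho>le by force
    then show "y \<in> (\<Union>u\<in>F. T u)" using w by auto
  qed
  moreover have "\<nu> (T u) \<le> N * m" if "u \<in> F" for u
    by (rule light_region_small[OF F(3), of "\<delta> u / 144" _ u]) (use m \<delta>(1)[OF that] in \<open>auto simp: T_def\<close>)
  ultimately show ?thesis using UN_le_bound[OF F(1)] by blast
qed

text \<open>Outer radii are \<alpha> times powers of 16, and the first one that collects
  \<open>m\<close> is taken. It overshoots by at most one shell, and a second shell is dropped as a
  gap before the next annulus, so each annulus uses up at most m + 2W \<le> 3W. The search for the
  outer radius ends because the support is bounded.\<close>

lemma radial_cut:
  fixes \<alpha> m W :: real and i :: nat
  assumes W: "\<And>\<alpha>. 0 < \<alpha> \<Longrightarrow> \<nu> (Y \<inter> {y. \<alpha> \<le> d x y \<and> d x y < 16 * \<alpha>}) \<le> W" and m: "0 < m" "m \<le> W"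
    and "0 < \<alpha>" "i * (3 * W) \<le> \<nu> (Y \<inter> {y. \<alpha> \<le> d x y})"
  shows "\<exists>S T. (\<forall>j<i. \<alpha> \<le> S j \<and> m \<le> \<nu> (Y \<inter> {y. S j \<le> d x y \<and> d x y < T j})) \<and>
     (\<forall>j<i. \<forall>j'<j. 16 * T j' \<le> S j)"
  using assms(4,5)
proof (induction i arbitrary: \<alpha>)
  case 0
  then show ?case by auto
next
  case (Suc i)
  define A where "A n = Y \<inter> {y. \<alpha> \<le> d x y \<and> d x y < 16 ^ n * \<alpha>}" for n :: nat
  have W0: "0 < W" using m by auto
  have tot: "3 * W \<le> \<nu> (Y \<inter> {y. \<alpha> \<le> d x y})"
  proof -
    have "1 * (3 * W) \<le> real (Suc i) * (3 * W)" using W0 by (intro mult_right_mono) auto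
    then show ?thesis using Suc.prems(2) by linarith
  qed
  have "\<exists>n. m \<le> \<nu> (A n)"
  proof -
    obtain x0 r0 where r0: "\<nu> {y. r0 \<le> d x0 y} = 0" using bounded_support by blast
    obtain n where "(r0 + d x0 x) / \<alpha> < 16 ^ n" using real_arch_pow[of 16] by auto
    then have n: "r0 + d x0 x < 16 ^ n * \<alpha>" using Suc.prems(1) by (simp add: divide_less_eq)
    have "Y \<inter> {y. \<alpha> \<le> d x y} \<subseteq> A n \<union> {y. r0 \<le> d x0 y}"
    proof
      fix y assume "y \<in> Y \<inter> {y. \<alpha> \<le> d x y}"
      then show "y \<in> A n \<union> {y. r0 \<le> d x0 y}" using n dtri[of x y x0] dsym[of x x0] unfolding A_def by auto
    qed
    from mono[OF this] have "\<nu> (Y \<inter> {y. \<alpha> \<le> d x y}) \<le> \<nu> (A n)"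
      using subadd[of "A n" "{y. r0 \<le> d x0 y}"] r0 by linarith
    then show ?thesis using tot m W0 by (intro exI[of _ n]) linarith
  qed
  define n where "n = (LEAST n. m \<le> \<nu> (A n))"
  have n: "m \<le> \<nu> (A n)" using LeastI_ex[OF \<open>\<exists>n. m \<le> \<nu> (A n)\<close>] unfolding n_def .
  have "A 0 = {}" unfolding A_def by auto
  then have "n \<noteq> 0" using n m empty0 by (metis linorder_not_less)
  then obtain n' where n': "n = Suc n'" by (cases n) auto
  have "\<nu> (A n') < m" using not_less_Least[of n' "\<lambda>n. m \<le> \<nu> (A n)"] n' unfolding n_def by auto
  define \<beta> where "\<beta> = 16 ^ Suc n * \<alpha>"
  have \<beta>: "0 < \<beta>" unfolding \<beta>_def using Suc.prems(1) by simp
  have a16: "\<alpha> \<le> 16 ^ k * \<alpha>" for k :: nat using Suc.prems(1) by simp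
  have sub: "Y \<inter> {y. \<alpha> \<le> d x y} \<subseteq> (A n' \<union> Y \<inter> {y. 16 ^ n' * \<alpha> \<le> d x y \<and> d x y < 16 * (16 ^ n' * \<alpha>)}) \<union>
     (Y \<inter> {y. 16 ^ n * \<alpha> \<le> d x y \<and> d x y < 16 * (16 ^ n * \<alpha>)} \<union> Y \<inter> {y. \<beta> \<le> d x y})"
    unfolding A_def \<beta>_def n' by auto
  have "\<nu> (Y \<inter> {y. \<alpha> \<le> d x y}) \<le> (\<nu> (A n') + W) + (W + \<nu> (Y \<inter> {y. \<beta> \<le> d x y}))"
    using mono[OF sub]
      subadd[of "A n' \<union> Y \<inter> {y. 16 ^ n' * \<alpha> \<le> d x y \<and> d x y < 16 * (16 ^ n' * \<alpha>)}"
        "Y \<inter> {y. 16 ^ n * \<alpha> \<le> d x y \<and> d x y < 16 * (16 ^ n * \<alpha>)} \<union> Y \<inter> {y. \<beta> \<le> d x y}"]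
      subadd[of "A n'" "Y \<inter> {y. 16 ^ n' * \<alpha> \<le> d x y \<and> d x y < 16 * (16 ^ n' * \<alpha>)}"]
      subadd[of "Y \<inter> {y. 16 ^ n * \<alpha> \<le> d x y \<and> d x y < 16 * (16 ^ n * \<alpha>)}" "Y \<inter> {y. \<beta> \<le> d x y}"]
      W[of "16 ^ n' * \<alpha>"] W[of "16 ^ n * \<alpha>"] Suc.prems(1)
    by simp
  then have "real i * (3 * W) \<le> \<nu> (Y \<inter> {y. \<beta> \<le> d x y})"
    using Suc.prems(2) \<open>\<nu> (A n') < m\<close> m(2) by (simp add: algebra_simps)
  then obtain S T where ST: "\<And>j. j < i \<Longrightarrow> \<beta> \<le> S j \<and> m \<le> \<nu> (Y \<inter> {y. S j \<le> d x y \<and> d x y < T j})"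
      "\<And>j j'. j < i \<Longrightarrow> j' < j \<Longrightarrow> 16 * T j' \<le> S j"
    using Suc.IH[OF \<beta>] by blast
  define S' where "S' = case_nat \<alpha> S"
  define T' where "T' = case_nat (16 ^ n * \<alpha>) T"
  have "\<alpha> \<le> \<beta>" unfolding \<beta>_def by (rule a16)
  have 1: "\<alpha> \<le> S' j \<and> m \<le> \<nu> (Y \<inter> {y. S' j \<le> d x y \<and> d x y < T' j})" if "j < Suc i" for j
    using that n ST(1)[of "j - 1"] \<open>\<alpha> \<le> \<beta>\<close> unfolding S'_def T'_def A_def by (cases j) auto
  have 2: "16 * T' j' \<le> S' j" if "j < Suc i" "j' < j" for j j'
    using that ST(1)[of "j - 1"] ST(2)[of "j - 1" "j' - 1"] unfolding S'_def T'_def \<beta>_def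
    by (cases j; cases j') auto
  show ?case using 1 2 by blast
qed

section \<open>Regions around single clusters\<close>

context
  fixes F :: "'a set"
  assumes F: "finite F" "F \<noteq> {}"
begin

definition nonbranching :: "'a set" where
  "nonbranching = {y. y \<notin> F \<and> \<not> branching F y}"

lemma dist_set_pos: "y \<notin> F \<Longrightarrow> 0 < dist_set F y"
  using dist_set_attained[OF F, of y] dpos by force

lemma cluster_ne: "y \<notin> F \<Longrightarrow> \<exists>x\<in>cluster F y. dist_set F y = d y x"
  using dist_set_attained[OF F, of y] dist_set_pos[of y] unfolding cluster_def by force

lemma cluster_diam:
  "y \<in> nonbranching \<Longrightarrow> u \<in> cluster F y \<Longrightarrow> v \<in> cluster F y \<Longrightarrow> d u v \<le> dist_set F y / 10"
  unfolding nonbranching_def branching_def by force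

lemma cluster_dist:
  assumes y: "y \<in> nonbranching" and u: "u \<in> cluster F y"
  shows "dist_set F y \<le> d y u" "d y u \<le> 11 / 10 * dist_set F y"
proof -
  show "dist_set F y \<le> d y u" using u dist_set_le[OF F(1)] unfolding cluster_def by auto
  obtain x where "x \<in> cluster F y" "dist_set F y = d y x"
    using cluster_ne y unfolding nonbranching_def by blast
  then show "d y u \<le> 11 / 10 * dist_set F y"
    using cluster_diam[OF y _ u, of x] dtri[of y u x] by linarith
qed

text \<open>A common member is at most 11/10 of \<open>dist_set F y'\<close> away from
  \<open>y'\<close>, and the cluster of the nearer observer has diameter at most 1/10 of that
  distance. All its members therefore stay far below the threshold 8. This makes the clusters a
  laminar family, of at most 2 card F members.\<close>

lemma cluster_nested:
  assumes y: "y \<in> nonbranching" "y' \<in> nonbranching" and le: "dist_set F y \<le> dist_set F y'"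
    and ne: "cluster F y \<inter> cluster F y' \<noteq> {}"
  shows "cluster F y \<subseteq> cluster F y'"
proof
  fix v assume v: "v \<in> cluster F y"
  obtain w where w: "w \<in> cluster F y" "w \<in> cluster F y'" using ne by auto
  have "0 < dist_set F y'" using y dist_set_pos unfolding nonbranching_def by auto
  moreover have "d y' v \<le> d y' w + d w v" by (rule dtri)
  ultimately show "v \<in> cluster F y'"
    using cluster_diam[OF y(1) w(1) v] cluster_dist(2)[OF y(2) w(2)] le v
    unfolding cluster_def by auto
qed

lemma card_clusters: "card (cluster F ` nonbranching) \<le> 2 * card F"
proof (rule card_laminar_le[OF F(1)])
  show "cluster F ` nonbranching \<subseteq> Pow F - {{}}"
    using cluster_ne unfolding nonbranching_def by (auto simp: cluster_def)
  fix A B assume "A \<in> cluster F ` nonbranching" "B \<in> cluster F ` nonbranching" "A \<inter> B \<noteq> {}"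
  then obtain y y' where "y \<in> nonbranching" "y' \<in> nonbranching" "A = cluster F y" "B = cluster F y'"
    by auto
  then show "A \<subseteq> B \<or> B \<subseteq> A"
    using cluster_nested[of y y'] cluster_nested[of y' y] \<open>A \<inter> B \<noteq> {}\<close>
    by (cases "dist_set F y \<le> dist_set F y'") (auto simp: Int_commute)
qed

definition region :: "'a set \<Rightarrow> 'a set" where
  "region K = {y \<in> nonbranching. cluster F y = K}"

text \<open>On the region of \<open>K\<close> the distance to \<open>x\<close> is at most 11/10 of
  the distance to \<open>F\<close>, so a shell around \<open>x\<close> keeps away from all of
  \<open>F\<close> at its own scale. With r = \<alpha>/12 the required \<open>6 * r\<close> is
  \<alpha>/2, below 10/11 of \<alpha>.\<close>

lemma cluster_shell:
  fixes m :: real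
  assumes L: "light F m" "0 \<le> m" and x: "x \<in> K" and \<alpha>: "0 < \<alpha>"
  shows "\<nu> (region K \<inter> {y. \<alpha> \<le> d x y \<and> d x y < 16 * \<alpha>}) \<le> N * m"
proof (rule light_region_small[OF L(1), of "\<alpha> / 12" _ x])
  show "region K \<inter> {y. \<alpha> \<le> d x y \<and> d x y < 16 * \<alpha>}
    \<subseteq> {y. d x y \<le> 300000 * (\<alpha> / 12) \<and> (\<forall>x\<in>F. 6 * (\<alpha> / 12) \<le> d y x)}"
    unfolding region_def
  proof safe
    fix y z assume y: "y \<in> nonbranching" "K = cluster F y" "\<alpha> \<le> d x y" "d x y < 16 * \<alpha>" and z: "z \<in> F"
    have "dist_set F y \<le> d y z" by (rule dist_set_le[OF F(1) z])
    then show "6 * (\<alpha> / 12) \<le> d y z"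
      using cluster_dist(2)[OF y(1), of x] x y(2,3) dsym[of x y] \<alpha> by auto
  qed (use \<alpha> in auto)
qed (use \<alpha> L in auto)

text \<open>If \<open>q\<close> lies in the doubled annulus around \<open>x\<close> spanned by the points \<open>y, y'\<close> of a cluster
  region, then the points of \<open>F\<close> within \<open>2 d(q, x)\<close> of \<open>q\<close> are exactly the cluster. Hence doubled
  annuli of different clusters are disjoint.\<close>

definition spans :: "'a set \<Rightarrow> 'a \<Rightarrow> 'a \<Rightarrow> bool" where
  "spans K x q \<longleftrightarrow> x \<in> K \<and> (\<exists>y\<in>nonbranching. \<exists>y'\<in>nonbranching. cluster F y = K \<and> cluster F y' = K \<and>
      d x y < 5 / 2 * d x q \<and> d x q < 2 * d x y')"

lemma spans_unique:
  assumes "spans K x q" "spans K' x' q" "d x q \<le> d x' q"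
  shows "K = K'"
proof -
  have props: "K \<subseteq> F \<and> (\<forall>u\<in>K. \<forall>v\<in>K. d u v \<le> d x q / 4) \<and> (\<forall>z\<in>F. d q z < 2 * d x q \<longrightarrow> z \<in> K) \<and> x \<in> K"
    if s: "spans K x q" for K x
  proof -
    obtain y y' where y: "y \<in> nonbranching" "cluster F y = K" "d x y < 5 / 2 * d x q"
      and y': "y' \<in> nonbranching" "cluster F y' = K" "d x q < 2 * d x y'" and x: "x \<in> K"
      using s unfolding spans_def by auto
    have "dist_set F y \<le> d y x" using cluster_dist(1)[OF y(1)] y x by auto
    then have "d u v \<le> d x q / 4" if "u \<in> K" "v \<in> K" for u v
      using cluster_diam[OF y(1), of u v] y that dsym[of x y] by auto
    moreover have "z \<in> K" if z: "z \<in> F" "d q z < 2 * d x q" for z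
    proof -
      have "d y' z \<le> d y' x + d x q + d q z" using dtri[of y' z x] dtri[of x z q] by linarith
      also have "\<dots> < 7 * d y' x" using z y'(3) dsym[of x y'] by linarith
      also have "\<dots> \<le> 7 * (11 / 10 * dist_set F y')" using cluster_dist(2)[OF y'(1), of x] y'(2) x by auto
      also have "\<dots> \<le> 8 * dist_set F y'" using dist_set_pos y'(1) unfolding nonbranching_def by auto
      finally show ?thesis using z y'(2) unfolding cluster_def by auto
    qed
    moreover have "K \<subseteq> F" using y(2) unfolding cluster_def by auto
    ultimately show ?thesis using x by blast
  qed
  note p = props[OF assms(1)] and p' = props[OF assms(2)]

  have pos: "0 < d x q"
  proof -
    obtain y where "d x y < 5 / 2 * d x q" using assms(1) unfolding spans_def by blast
    then show ?thesis using dnn[of x y] by linarith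
  qed
  \<comment> \<open>Seen from \<open>q\<close>, members of the cluster with the smaller radius lie
    within 5/4 of that radius, hence belong to the other cluster. Then \<open>x\<close> is in K',
    the radii differ by a factor of at most 4/3, and 5/4 * 4/3 < 2 gives the converse
    inclusion.\<close>
  have KK': "K \<subseteq> K'"
  proof
    fix u assume u: "u \<in> K"
    have "d q u \<le> d x q + d x u" using dtri[of q u x] dsym[of q x] by linarith
    also have "\<dots> \<le> 5 / 4 * d x q" using p u by force
    also have "\<dots> < 2 * d x' q" using assms(3) pos by linarith
    finally show "u \<in> K'" using p p' u by blast
  qed
  then have "d x' x \<le> d x' q / 4" using p p' by blast
  then have r': "d x' q \<le> 4 / 3 * d x q" using dtri[of x' q x] by linarith
  have "K' \<subseteq> K"
  proof
    fix u assume u: "u \<in> K'"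
    have "d q u \<le> d x' q + d x' u" using dtri[of q u x'] dsym[of q x'] by linarith
    also have "\<dots> \<le> 5 / 4 * d x' q" using p' u by force
    also have "\<dots> < 2 * d x q" using r' pos by linarith
    finally show "u \<in> K" using p p' u by blast
  qed
  with KK' show ?thesis by blast
qed

text \<open>The gap factor 4 keeps doubled annuli with the same centre apart; those of different
  clusters are kept apart by \<open>spans\<close>.\<close>

definition cluster_annuli :: "'a set \<Rightarrow> real \<Rightarrow> nat \<Rightarrow> 'a \<Rightarrow> (nat \<Rightarrow> real) \<Rightarrow> (nat \<Rightarrow> real) \<Rightarrow> bool" where
  "cluster_annuli K m i x s t \<longleftrightarrow> x \<in> K \<and>
     (\<forall>j<i. 0 < s j \<and> s j \<le> t j \<and> m \<le> \<nu> {q. s j \<le> d x q \<and> d x q \<le> t j} \<and>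
        (\<forall>q. s j \<le> 2 * d x q \<and> d x q < 2 * t j \<longrightarrow> spans K x q)) \<and>
     (\<forall>j<i. \<forall>j'<j. 4 * t j' < s j)"

lemma cluster_annuli_exist:
  fixes m :: real
  assumes L: "light F m" "0 < m" and N: "1 \<le> N" and x: "x \<in> K"
    and i: "real i * (3 * (N * m)) + m \<le> \<nu> (region K)"
  shows "\<exists>s t. cluster_annuli K m i x s t"
proof -
  define Y where "Y = region K"
  obtain \<alpha> where \<alpha>: "0 < \<alpha>" "\<And>x. \<nu> {y. d x y < \<alpha>} < m" using atomless[OF L(2)] by blast
  have "\<nu> Y \<le> \<nu> (Y \<inter> {y. \<alpha> \<le> d x y}) + \<nu> {y. d x y < \<alpha>}"
    by (rule order_trans[OF mono[of Y "Y \<inter> {y. \<alpha> \<le> d x y} \<union> {y. d x y < \<alpha>}"] subadd]) auto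
  then have i': "real i * (3 * (N * m)) \<le> \<nu> (Y \<inter> {y. \<alpha> \<le> d x y})"
    using i \<alpha>(2)[of x] unfolding Y_def by linarith
  have W: "m \<le> N * m" using N L(2) by simp
  have shell: "\<nu> (Y \<inter> {y. \<beta> \<le> d x y \<and> d x y < 16 * \<beta>}) \<le> N * m" if "0 < \<beta>" for \<beta>
    unfolding Y_def by (rule cluster_shell[OF L(1) less_imp_le[OF L(2)] x that])
  have "\<exists>S T. (\<forall>j<i. \<alpha> \<le> S j \<and> m \<le> \<nu> (Y \<inter> {y. S j \<le> d x y \<and> d x y < T j})) \<and>
     (\<forall>j<i. \<forall>j'<j. 16 * T j' \<le> S j)"
    by (rule radial_cut[OF _ L(2) W \<alpha>(1) i']) (rule shell)
  then obtain S T where "\<forall>j<i. \<alpha> \<le> S j \<and> m \<le> \<nu> (Y \<inter> {y. S j \<le> d x y \<and> d x y < T j})"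
     "\<forall>j<i. \<forall>j'<j. 16 * T j' \<le> S j"
    by (elim exE conjE)
  then have ST: "\<And>j. j < i \<Longrightarrow> \<alpha> \<le> S j \<and> m \<le> \<nu> (Y \<inter> {y. S j \<le> d x y \<and> d x y < T j})"
     "\<And>j j'. j < i \<Longrightarrow> j' < j \<Longrightarrow> 16 * T j' \<le> S j"
    by simp_all
  define P where "P j = Y \<inter> {y. S j \<le> d x y \<and> d x y < T j}" for j
  \<comment> \<open>The radii are tightened to distances approached within the region itself. Points
    of the doubled annulus then have points of the region at comparable radii on both sides, which
    is what \<open>spans\<close> asks for.\<close>
  define s where "s j = Inf (d x ` P j)" for j
  define t where "t j = Sup (d x ` P j)" for j
  have P: "P j \<noteq> {}" "\<alpha> \<le> s j" "S j \<le> s j" "s j \<le> t j" "t j \<le> T j"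
    "bdd_below (d x ` P j)" "bdd_above (d x ` P j)" if "j < i" for j
  proof -
    show ne: "P j \<noteq> {}" using ST(1)[OF that] empty0 L(2) unfolding P_def by force
    show b: "bdd_below (d x ` P j)" by (intro bdd_belowI[of _ 0]) (auto intro: dnn)
    show a: "bdd_above (d x ` P j)" by (intro bdd_aboveI[of _ "T j"]) (auto simp: P_def)
    show S: "S j \<le> s j" unfolding s_def using ne by (intro cInf_greatest) (auto simp: P_def)
    then show "\<alpha> \<le> s j" using ST(1)[OF that] by linarith
    show "t j \<le> T j" unfolding t_def using ne by (intro cSup_least) (auto simp: P_def)
    show "s j \<le> t j" unfolding s_def t_def using ne a b by (intro cInf_le_cSup) auto
  qed
  have 1: "m \<le> \<nu> {q. s j \<le> d x q \<and> d x q \<le> t j}" if j: "j < i" for j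
  proof -
    have "P j \<subseteq> {q. s j \<le> d x q \<and> d x q \<le> t j}"
      unfolding s_def t_def using P(6,7)[OF j] by (auto intro: cInf_lower cSup_upper)
    from mono[OF this] show ?thesis using ST(1)[OF j] unfolding P_def by linarith
  qed
  have 2: "spans K x q" if j: "j < i" and q: "s j \<le> 2 * d x q" "d x q < 2 * t j" for j q
  proof -
    have "0 < s j" using P(2)[OF j] \<alpha>(1) by linarith
    \<comment> \<open>The infimum may not be attained, so the factor 2 is enlarged to 5/2 to obtain
      a strict inequality.\<close>
    then have "Inf (d x ` P j) < 5 / 2 * d x q" using q(1) unfolding s_def by linarith
    then obtain y where y: "y \<in> P j" "d x y < 5 / 2 * d x q"
      using cInf_lessD[of "d x ` P j"] P(1)[OF j] by blast
    have "d x q / 2 < Sup (d x ` P j)" using q(2) unfolding t_def by linarith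
    then obtain y' where y': "y' \<in> P j" "d x q / 2 < d x y'"
      using less_cSupE[of "d x q / 2" "d x ` P j"] P(1)[OF j] by blast
    have "y \<in> nonbranching" "cluster F y = K" "y' \<in> nonbranching" "cluster F y' = K"
      using y(1) y'(1) unfolding P_def Y_def region_def by auto
    moreover have "d x q < 2 * d x y'" using y'(2) by linarith
    ultimately show ?thesis unfolding spans_def using x y(2) by blast
  qed
  have 3: "4 * t j' < s j" if "j < i" "j' < j" for j j'
    using ST(2)[OF that] P(3)[OF that(1)] P(5)[of j'] P(2,4)[of j'] \<alpha>(1) that by auto
  have 4: "0 < s j \<and> s j \<le> t j" if "j < i" for j using P[OF that] \<alpha>(1) by linarith
  show ?thesis unfolding cluster_annuli_def using x 1 2 3 4 by blast
qed

end

text \<open>The constant 18 comes from the count in the light case. \<open>F\<close> and the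
  branching points absorb at most \<open>2 * card F * (N * m)\<close>, annuli cost
  \<open>3 * (N * m)\<close> each, and rounding loses at most 2 for each of at most 2k clusters.
  With total mass 18Nkm this leaves 6k - 2k/3 - 4k, which is at least k.\<close>

theorem disjoint_annuli:
  assumes k: "0 < k" and N: "1 \<le> N" and M: "0 < \<nu> UNIV"
  shows "\<exists>X s t. (\<forall>i<k. 0 \<le> s i \<and> s i \<le> t i \<and> 0 < t i \<and>
        \<nu> UNIV / (18 * N * k) \<le> \<nu> {q. s i \<le> d (X i) q \<and> d (X i) q \<le> t i}) \<and>
      (\<forall>i<k. \<forall>j<k. i \<noteq> j \<longrightarrow> {q. s i \<le> 2 * d (X i) q \<and> d (X i) q < 2 * t i} \<inter>
         {q. s j \<le> 2 * d (X j) q \<and> d (X j) q < 2 * t j} = {})"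
proof -
  define m where "m = \<nu> UNIV / (18 * N * k)"
  have Nk: "0 < real N" "0 < real k" using N k by auto
  have m: "0 < m" unfolding m_def using M Nk by simp
  have mM: "\<nu> UNIV = 18 * N * k * m" unfolding m_def using Nk by simp
  have mleM: "m \<le> \<nu> UNIV"
  proof -
    have "1 * 1 \<le> real N * real k" using N k by (intro mult_mono) auto
    then have "1 * m \<le> (18 * N * k) * m" using m by (intro mult_right_mono) auto
    then show ?thesis using mM by simp
  qed
  from disjoint_heavy_balls_or_light[OF m, of k] show ?thesis
  proof (elim disjE exE conjE)
    fix X R assume XR: "\<forall>i<k. 0 < R i \<and> m \<le> \<nu> {y. d (X i) y < R i}"
      and disj: "\<forall>i<k. \<forall>j<k. i \<noteq> j \<longrightarrow> {y. d (X i) y < 2 * R i} \<inter> {y. d (X j) y < 2 * R j} = {}"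
    have "m \<le> \<nu> {q. 0 \<le> d (X i) q \<and> d (X i) q \<le> R i}" if "i < k" for i
    proof -
      have "{y. d (X i) y < R i} \<subseteq> {q. 0 \<le> d (X i) q \<and> d (X i) q \<le> R i}" by auto
      from mono[OF this] show ?thesis using XR that by force
    qed
    then show ?thesis
      using XR disj dnn unfolding m_def
      by (intro exI[of _ X] exI[of _ "\<lambda>_. 0"] exI[of _ R]) auto
  next
    fix F assume F: "finite F" "card F < k" "light F m"
    \<comment> \<open>For empty \<open>F\<close> every ball is light, even one that carries the
      whole mass.\<close>
    have ne: "F \<noteq> {}"
    proof
      assume "F = {}"
      obtain x r where r: "\<nu> {y. r \<le> d x y} = 0" using bounded_support by blast
      have "\<nu> UNIV \<le> \<nu> ({y. d x y < \<bar>r\<bar> + 1} \<union> {y. r \<le> d x y})" by (rule mono) auto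
      also have "\<dots> \<le> \<nu> {y. d x y < \<bar>r\<bar> + 1}"
        using subadd[of "{y. d x y < \<bar>r\<bar> + 1}" "{y. r \<le> d x y}"] r by linarith
      also have "\<dots> < m"
        by (rule F(3)[unfolded light_def \<open>F = {}\<close>, rule_format]) auto
      finally show False using mleM by simp
    qed
    define C where "C = cluster F ` nonbranching F"
    define Y where "Y = region F"
    note Y_iff = Y_def region_def[OF F(1) ne]
    \<comment> \<open>Regions of mass below \<open>m\<close> get no annulus, since
      \<open>nat\<close> truncates negative values; the lower bound for \<open>i K\<close> used in
      the count survives this.\<close>
    define i where "i K = nat \<lfloor>(\<nu> (Y K) - m) / (3 * (N * m))\<rfloor>" for K
    have finC: "finite C"
      unfolding C_def by (rule finite_subset[of _ "Pow F"]) (use F(1) in \<open>auto simp: cluster_def\<close>)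
    have Nm: "0 < N * m" using Nk m by simp
    have "\<exists>z. cluster_annuli F K m (i K) (fst z) (fst (snd z)) (snd (snd z))" if K: "K \<in> C" for K
    proof -
      obtain x where x: "x \<in> K"
        using K cluster_ne[OF F(1) ne] unfolding C_def nonbranching_def[OF F(1) ne] by blast
      show ?thesis
      proof (cases "i K = 0")
        case True
        then show ?thesis using x
          by (intro exI[of _ "(x, \<lambda>_. 0, \<lambda>_. 0)"]) (simp add: cluster_annuli_def[OF F(1) ne])
      next
        case False
        then have "real (i K) \<le> (\<nu> (Y K) - m) / (3 * (N * m))" unfolding i_def
          by (simp add: of_nat_floor)
        then have "real (i K) * (3 * (N * m)) + m \<le> \<nu> (Y K)" using Nm by (simp add: pos_le_divide_eq)
        from cluster_annuli_exist[OF F(1) ne F(3) m N x this[unfolded Y_def]]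
        obtain s t where "cluster_annuli F K m (i K) x s t" by blast
        then show ?thesis by (intro exI[of _ "(x, s, t)"]) simp
      qed
    qed
    then have "\<forall>K\<in>C. \<exists>z. cluster_annuli F K m (i K) (fst z) (fst (snd z)) (snd (snd z))" by blast
    from bchoice[OF this]
    obtain h where h: "\<forall>K\<in>C. cluster_annuli F K m (i K) (fst (h K)) (fst (snd (h K))) (snd (snd (h K)))" ..
    define x where "x K = fst (h K)" for K
    define s where "s K = fst (snd (h K))" for K
    define t where "t K = snd (snd (h K))" for K
    have h': "cluster_annuli F K m (i K) (x K) (s K) (t K)" if "K \<in> C" for K
      using bspec[OF h that] unfolding x_def s_def t_def .
    have A: "0 < s K j" "s K j \<le> t K j" "m \<le> \<nu> {q. s K j \<le> d (x K) q \<and> d (x K) q \<le> t K j}"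
      if "K \<in> C" "j < i K" for K j
      using h'[OF that(1)] that(2) unfolding cluster_annuli_def[OF F(1) ne] by simp_all
    have sp: "spans F K (x K) q" if "K \<in> C" "j < i K" "s K j \<le> 2 * d (x K) q" "d (x K) q < 2 * t K j" for K j q
      using h'[OF that(1)] that(2-) unfolding cluster_annuli_def[OF F(1) ne] by simp
    have sep: "4 * t K j' < s K j" if "K \<in> C" "j < i K" "j' < j" for K j j'
      using h'[OF that(1)] that(2-) unfolding cluster_annuli_def[OF F(1) ne] by simp
    define I where "I = (SIGMA K:C. {..<i K})"
    have finI: "finite I" unfolding I_def using finC by auto
    have count: "real k \<le> real (card I)"
    proof -
      \<comment> \<open>Points of \<open>F\<close> are excluded from both the branching and the
        nonbranching points. Each lies in a ball of mass less than \<open>m\<close>.\<close>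
      have nuF: "\<nu> F \<le> card F * m"
      proof -
        obtain r where "0 < r" "\<And>x. \<nu> {y. d x y < r} < m" using atomless[OF m] by blast
        then show ?thesis
          by (intro UN_le_bound[OF F(1), of F "\<lambda>x. {y. d x y < r}"]) (auto intro: less_imp_le simp: d0)
      qed
      have "\<nu> UNIV \<le> \<nu> ((F \<union> {y. y \<notin> F \<and> branching F y}) \<union> (\<Union>K\<in>C. Y K))"
        by (rule mono) (auto simp: C_def Y_iff nonbranching_def[OF F(1) ne])
      also have "\<dots> \<le> (card F * m + card F * (N * m)) + (\<Sum>K\<in>C. \<nu> (Y K))"
        using subadd[of "F \<union> {y. y \<notin> F \<and> branching F y}" "\<Union>K\<in>C. Y K"]
          subadd[of F "{y. y \<notin> F \<and> branching F y}"] nuF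
          branching_small[OF F(1) ne F(3) less_imp_le[OF m]] UN_le[OF finC, of Y] by linarith
      finally have tot: "18 * N * k * m - (card F * m + card F * (N * m)) \<le> (\<Sum>K\<in>C. \<nu> (Y K))"
        using mM by linarith
      have "\<nu> (Y K) / (3 * (N * m)) - 2 \<le> real (i K)" for K
      proof -
        have "(\<nu> (Y K) - m) / (3 * (N * m)) - 1 \<le> real (i K)" unfolding i_def by linarith
        moreover have "m / (3 * (N * m)) \<le> 1" using Nm N m by (simp add: divide_le_eq)
        ultimately show ?thesis by (simp add: diff_divide_distrib)
      qed
      then have "(\<Sum>K\<in>C. \<nu> (Y K) / (3 * (N * m)) - 2) \<le> (\<Sum>K\<in>C. real (i K))" by (rule sum_mono)
      also have "(\<Sum>K\<in>C. \<nu> (Y K) / (3 * (N * m)) - 2) = (\<Sum>K\<in>C. \<nu> (Y K)) / (3 * (N * m)) - 2 * card C"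
        by (simp add: sum_subtractf sum_divide_distrib)
      also have "(\<Sum>K\<in>C. real (i K)) = card I" unfolding I_def using finC by (simp add: card_SigmaI)
      finally have 1: "(\<Sum>K\<in>C. \<nu> (Y K)) / (3 * (N * m)) - 2 * card C \<le> card I" .
      have "card F * m \<le> card F * (N * m)" using N m by (intro mult_left_mono) auto
      then have "18 * N * k * m - 2 * card F * (N * m) \<le> (\<Sum>K\<in>C. \<nu> (Y K))" using tot by linarith
      then have "(18 * N * k * m - 2 * card F * (N * m)) / (3 * (N * m)) \<le> (\<Sum>K\<in>C. \<nu> (Y K)) / (3 * (N * m))"
        using Nm by (intro divide_right_mono) auto
      moreover have "(18 * N * k * m - 2 * card F * (N * m)) / (3 * (N * m)) = 6 * real k - 2 * card F / 3"
        using Nk m by (simp add: field_simps)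
      moreover have "real (card C) \<le> 2 * card F" using card_clusters[OF F(1) ne] unfolding C_def by linarith
      moreover have "real (card F) \<le> real k" using F(2) by simp
      ultimately show ?thesis using 1 by linarith
    qed
    obtain g where g: "bij_betw g {0..<card I} I" using ex_bij_betw_nat_finite[OF finI] by blast
    define K where "K n = fst (g n)" for n
    define j where "j n = snd (g n)" for n
    have gI: "K n \<in> C" "j n < i (K n)" if "n < k" for n
    proof -
      have "g n \<in> I" using g that count by (auto simp: bij_betw_def)
      then show "K n \<in> C" "j n < i (K n)" unfolding I_def K_def j_def by auto
    qed
    have inj: "K n \<noteq> K n' \<or> j n \<noteq> j n'" if "n < k" "n' < k" "n \<noteq> n'" for n n'
    proof -
      have "g n \<noteq> g n'" using g that count unfolding bij_betw_def by (auto dest!: inj_onD)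
      then show ?thesis unfolding K_def j_def by (auto simp: prod_eq_iff)
    qed
    have disj: False if n: "n < k" "n' < k" "n \<noteq> n'"
      and q: "s (K n) (j n) \<le> 2 * d (x (K n)) q" "d (x (K n)) q < 2 * t (K n) (j n)"
      and q': "s (K n') (j n') \<le> 2 * d (x (K n')) q" "d (x (K n')) q < 2 * t (K n') (j n')" for n n' q
    proof -
      have "spans F (K n) (x (K n)) q" "spans F (K n') (x (K n')) q"
        using sp gI n q q' by blast+
      then have KK: "K n = K n'"
        using spans_unique[OF F(1) ne] by (cases "d (x (K n)) q \<le> d (x (K n')) q") (metis linear)+
      then have "j n < j n' \<or> j n' < j n" using inj[OF n] by auto
      then show False
      proof
        assume "j n < j n'"
        then have "4 * t (K n') (j n) < s (K n') (j n')" using sep[of "K n'" "j n'" "j n"] gI[OF n(2)] by blast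
        then show False using q(2) q'(1) KK by simp
      next
        assume "j n' < j n"
        then have "4 * t (K n) (j n') < s (K n) (j n)" using sep[of "K n" "j n" "j n'"] gI[OF n(1)] by blast
        then show False using q'(2) q(1) KK by simp
      qed
    qed
    show ?thesis
    proof (rule exI[of _ "\<lambda>n. x (K n)"], rule exI[of _ "\<lambda>n. s (K n) (j n)"],
        rule exI[of _ "\<lambda>n. t (K n) (j n)"], intro conjI allI impI)
      fix n assume n: "n < k"
      show "0 \<le> s (K n) (j n)" "s (K n) (j n) \<le> t (K n) (j n)" "0 < t (K n) (j n)"
        using A(1,2)[OF gI[OF n]] by linarith+
      show "\<nu> UNIV / (18 * N * k) \<le>
          \<nu> {q. s (K n) (j n) \<le> d (x (K n)) q \<and> d (x (K n)) q \<le> t (K n) (j n)}"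
        using A(3)[OF gI[OF n]] unfolding m_def .
    next
      fix n n' assume "n < k" "n' < k" "n \<noteq> n'"
      from disj[OF this]
      show "{q. s (K n) (j n) \<le> 2 * d (x (K n)) q \<and> d (x (K n)) q < 2 * t (K n) (j n)} \<inter>
         {q. s (K n') (j n') \<le> 2 * d (x (K n')) q \<and> d (x (K n')) q < 2 * t (K n') (j n')} = {}"
        by (intro equals0I) (elim IntE CollectE conjE)
    qed
  qed
qed

end

section \<open>The Koranyi metric\<close>

text \<open>In the real inner product \<open>z \<bullet> vi w\<close> is the imaginary part of the
  Hermitian product of z and w, so that product is
  \<open>Complex (z \<bullet> w) (z \<bullet> vi w)\<close>.\<close>

definition vi :: "complex ^ 'n \<Rightarrow> complex ^ 'n" where
  "vi z = (\<chi> j. \<i> * z $ j)"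

lemma vi_linear: "linear vi"
  by (rule linearI) (auto simp: vi_def vec_eq_iff algebra_simps)

lemmas vi_simps [simp] = linear_add[OF vi_linear] linear_diff[OF vi_linear] linear_cmul[OF vi_linear]
  linear_neg[OF vi_linear] linear_0[OF vi_linear]

lemma vi_vi [simp]: "vi (vi z) = - z"
  by (auto simp: vi_def vec_eq_iff mult.assoc[symmetric])

lemma inner_vi_vi [simp]: "vi z \<bullet> vi w = z \<bullet> w"
  by (simp add: vi_def inner_vec_def inner_complex_def algebra_simps)

lemma inner_vi_left: "vi z \<bullet> w = - (z \<bullet> vi w)"
  by (simp add: vi_def inner_vec_def inner_complex_def flip: sum_negf)

lemma inner_vi_self [simp]: "z \<bullet> vi z = 0"
  using inner_vi_left[of z z] by (simp add: inner_commute)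

lemma inner_vi_skew: "w \<bullet> vi z = - (z \<bullet> vi w)"
  using inner_vi_left[of z w] by (simp add: inner_commute)

text \<open>Cauchy-Schwarz for the Hermitian product, from the real inequality applied to z and the
  vector \<open>v\<close>, which is up to scale the projection of z to the complex line through
  w.\<close>

lemma norm_Complex_inner_le:
  "norm (Complex (z \<bullet> w) (z \<bullet> vi w)) \<le> norm z * norm w"
proof -
  define a where "a = z \<bullet> w"
  define b where "b = z \<bullet> vi w"
  define v where "v = a *\<^sub>R w + b *\<^sub>R vi w"
  have "v \<bullet> v = (a\<^sup>2 + b\<^sup>2) * (w \<bullet> w)"
    unfolding v_def by (simp add: inner_add_left inner_add_right inner_vi_left algebra_simps power2_eq_square)
  then have nv: "norm v = sqrt (a\<^sup>2 + b\<^sup>2) * norm w"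
    by (simp add: norm_eq_sqrt_inner real_sqrt_mult)
  have "z \<bullet> v = a\<^sup>2 + b\<^sup>2"
    unfolding v_def by (simp add: inner_add_right a_def[symmetric] b_def[symmetric] power2_eq_square)
  then have "a\<^sup>2 + b\<^sup>2 \<le> norm z * (sqrt (a\<^sup>2 + b\<^sup>2) * norm w)"
    using norm_cauchy_schwarz[of z v] nv by simp
  then have "sqrt (a\<^sup>2 + b\<^sup>2) * sqrt (a\<^sup>2 + b\<^sup>2) \<le> sqrt (a\<^sup>2 + b\<^sup>2) * (norm z * norm w)"
    by (simp add: ac_simps)
  then have "sqrt (a\<^sup>2 + b\<^sup>2) \<le> norm z * norm w"
  proof (cases "sqrt (a\<^sup>2 + b\<^sup>2) = 0")
    case False
    then have "0 < sqrt (a\<^sup>2 + b\<^sup>2)" by (metis real_sqrt_ge_zero sum_power2_ge_zero order_less_le)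
    then show ?thesis using \<open>sqrt (a\<^sup>2 + b\<^sup>2) * sqrt (a\<^sup>2 + b\<^sup>2) \<le> sqrt (a\<^sup>2 + b\<^sup>2) * (norm z * norm w)\<close>
      by (simp only: mult_le_cancel_left_pos)
  qed auto
  then show ?thesis by (simp add: cmod_def a_def b_def)
qed

text \<open>\<open>(horiz p q, vert p q)\<close> is the group element \<open>p\<inverse> q\<close>.\<close>

definition horiz :: "'n::finite heis \<Rightarrow> 'n heis \<Rightarrow> complex ^ 'n" where
  "horiz p q = fst q - fst p"

definition vert :: "'n::finite heis \<Rightarrow> 'n heis \<Rightarrow> real" where
  "vert p q = snd q - snd p - 2 * (fst p \<bullet> vi (fst q))"

definition gauge4 :: "'n::finite heis \<Rightarrow> 'n heis \<Rightarrow> real" where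
  "gauge4 p q = (horiz p q \<bullet> horiz p q)\<^sup>2 + (vert p q)\<^sup>2"

definition koranyi :: "'n::finite heis \<Rightarrow> 'n heis \<Rightarrow> real" where
  "koranyi p q = sqrt (sqrt (gauge4 p q))"

lemma gauge4_nonneg: "0 \<le> gauge4 p q"
  by (simp add: gauge4_def)

lemma koranyi_nonneg: "0 \<le> koranyi p q"
  by (simp add: koranyi_def gauge4_nonneg)

lemma koranyi_pow4: "koranyi p q ^ 4 = gauge4 p q"
proof -
  have "koranyi p q ^ 4 = ((koranyi p q)\<^sup>2)\<^sup>2" by simp
  also have "\<dots> = gauge4 p q" by (simp add: koranyi_def gauge4_nonneg)
  finally show ?thesis .
qed

lemma koranyi_sq: "(koranyi p q)\<^sup>2 = norm (Complex (horiz p q \<bullet> horiz p q) (vert p q))"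
  by (simp add: koranyi_def gauge4_nonneg cmod_def gauge4_def)

lemma koranyi_less_iff: "0 \<le> r \<Longrightarrow> koranyi p q < r \<longleftrightarrow> gauge4 p q < r ^ 4"
  unfolding koranyi_pow4[symmetric] using koranyi_nonneg[of p q]
  by (auto intro: power_strict_mono dest: power_less_imp_less_base)

lemma koranyi_le_iff: "0 \<le> r \<Longrightarrow> koranyi p q \<le> r \<longleftrightarrow> gauge4 p q \<le> r ^ 4"
  unfolding koranyi_pow4[symmetric] using koranyi_nonneg[of p q]
  by (simp add: power_mono_iff)

lemma norm_horiz_le: "norm (horiz p q) \<le> koranyi p q"
proof -
  have "(norm (horiz p q))\<^sup>2 \<le> (koranyi p q)\<^sup>2"
    unfolding koranyi_sq using abs_Re_le_cmod[of "Complex (horiz p q \<bullet> horiz p q) (vert p q)"]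
    by (simp add: power2_norm_eq_inner)
  then show ?thesis using koranyi_nonneg by (rule power2_le_imp_le)
qed

lemma abs_vert_le: "\<bar>vert p q\<bar> \<le> (koranyi p q)\<^sup>2"
  unfolding koranyi_sq using abs_Im_le_cmod[of "Complex (horiz p q \<bullet> horiz p q) (vert p q)"] by simp

text \<open>The squared gauge is the modulus of the complex number |z|^2 + i t. Under the group
  product these numbers add, up to twice the Hermitian product of the horizontal parts, and
  Cauchy-Schwarz completes the square.\<close>

lemma koranyi_triangle: "koranyi p r \<le> koranyi p q + koranyi q r"
proof -
  define u v where "u = horiz p q" and "v = horiz q r"
  have h: "horiz p r = u + v" unfolding u_def v_def horiz_def by simp
  have t: "vert p r = vert p q + vert q r + 2 * (u \<bullet> vi v)"
    unfolding u_def v_def horiz_def vert_def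
    by (simp add: inner_diff_left inner_diff_right inner_commute algebra_simps)
  have "Complex (horiz p r \<bullet> horiz p r) (vert p r) =
      (Complex (u \<bullet> u) (vert p q) + Complex (v \<bullet> v) (vert q r)) + 2 * Complex (u \<bullet> v) (u \<bullet> vi v)"
    unfolding h t by (simp add: complex_eq_iff inner_add_left inner_add_right inner_commute)
  then have "(koranyi p r)\<^sup>2 \<le> norm (Complex (u \<bullet> u) (vert p q)) + norm (Complex (v \<bullet> v) (vert q r)) +
      norm (2 * Complex (u \<bullet> v) (u \<bullet> vi v))"
    unfolding koranyi_sq by (smt (verit) norm_triangle_ineq)
  also have "\<dots> \<le> (koranyi p q)\<^sup>2 + (koranyi q r)\<^sup>2 + 2 * (koranyi p q * koranyi q r)"
  proof -
    have "norm (Complex (u \<bullet> v) (u \<bullet> vi v)) \<le> koranyi p q * koranyi q r"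
      by (rule order_trans[OF norm_Complex_inner_le])
        (auto simp: u_def v_def koranyi_nonneg intro!: mult_mono norm_horiz_le)
    then show ?thesis unfolding koranyi_sq u_def v_def by (simp add: norm_mult)
  qed
  also have "\<dots> = (koranyi p q + koranyi q r)\<^sup>2" by (simp add: power2_sum)
  finally show ?thesis by (rule power2_le_imp_le) (simp add: koranyi_nonneg)
qed

lemma koranyi_metric: "Metric_space UNIV (koranyi :: 'n::finite heis \<Rightarrow> 'n heis \<Rightarrow> real)"
proof
  fix p q r :: "'n heis"
  show "0 \<le> koranyi p q" by (rule koranyi_nonneg)
  show "koranyi p q = koranyi q p"
  proof -
    have "vert p q = - vert q p" using inner_vi_skew[of "fst p" "fst q"] by (simp add: vert_def)
    moreover have "horiz p q = - horiz q p" by (simp add: horiz_def)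
    ultimately show ?thesis by (simp add: koranyi_def gauge4_def)
  qed
  show "koranyi p q = 0 \<longleftrightarrow> p = q"
    by (auto simp: koranyi_def gauge4_def add_nonneg_eq_0_iff horiz_def vert_def prod_eq_iff)
  show "koranyi p r \<le> koranyi p q + koranyi q r" by (rule koranyi_triangle)
qed

text \<open>Comparable with gauge balls when h is of order r^2, but with a volume given by a product
  formula.\<close>

definition cyl :: "'n::finite heis \<Rightarrow> real \<Rightarrow> real \<Rightarrow> 'n heis set" where
  "cyl p r h = {q. norm (horiz p q) < r \<and> \<bar>vert p q\<bar> < h}"

lemma continuous_vi [continuous_intros]: "continuous_on A f \<Longrightarrow> continuous_on A (\<lambda>x. vi (f x))"
  unfolding vi_def by (intro continuous_intros)

lemma continuous_horiz [continuous_intros]: "continuous_on A (\<lambda>q. horiz p q)"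
  unfolding horiz_def by (intro continuous_intros)

lemma continuous_vert [continuous_intros]: "continuous_on A (\<lambda>q. vert p q)"
  unfolding vert_def by (intro continuous_intros)

lemma continuous_gauge4 [continuous_intros]: "continuous_on A (\<lambda>q. gauge4 p q)"
  unfolding gauge4_def by (intro continuous_intros)

lemma continuous_koranyi [continuous_intros]: "continuous_on A (\<lambda>q. koranyi p q)"
  unfolding koranyi_def by (intro continuous_intros)

lemma open_cyl: "open (cyl p r h)"
  unfolding cyl_def by (intro open_Collect_conj open_Collect_less continuous_intros)

lemma borel_cyl [measurable]: "cyl p r h \<in> sets borel"
  by (rule borel_open[OF open_cyl])

text \<open>Over each fixed w the condition on \<open>vert\<close> cuts out an interval of length
  2h; the twist of the group law only moves its centre.\<close>

lemma emeasure_cyl: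
  fixes p :: "'n::finite heis"
  assumes "0 \<le> h"
  shows "emeasure lborel (cyl p r h) = ennreal (2 * h) * emeasure lborel (ball (fst p) r)"
proof -
  have "emeasure lborel (cyl p r h) = emeasure (lborel \<Otimes>\<^sub>M lborel) (cyl p r h)"
    by (simp add: lborel_prod)
  also have "\<dots> = (\<integral>\<^sup>+ w. emeasure lborel (Pair w -` cyl p r h) \<partial>lborel)"
    by (rule lborel.emeasure_pair_measure_alt)
      (subst lborel_prod, simp add: borel_cyl)
  also have "\<dots> = (\<integral>\<^sup>+ w. ennreal (2 * h) * indicator (ball (fst p) r) w \<partial>lborel)"
  proof (intro nn_integral_cong)
    fix w :: "complex ^ 'n"
    define c where "c = snd p + 2 * (fst p \<bullet> vi w)"
    have "Pair w -` cyl p r h = (if w \<in> ball (fst p) r then {c - h <..< c + h} else {})"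
      by (auto simp: cyl_def horiz_def vert_def c_def dist_norm norm_minus_commute)
    then show "emeasure lborel (Pair w -` cyl p r h) = ennreal (2 * h) * indicator (ball (fst p) r) w"
      using assms by auto
  qed
  also have "\<dots> = ennreal (2 * h) * emeasure lborel (ball (fst p) r)"
    by (simp add: nn_integral_cmult_indicator)
  finally show ?thesis .
qed

lemma measure_cyl:
  fixes p :: "'n::finite heis"
  assumes "0 \<le> h" "0 \<le> r"
  shows "measure lborel (cyl p r h) = 2 * h * r ^ (2 * CARD('n)) * measure lborel (ball (0 :: complex ^ 'n) 1)"
    "emeasure lborel (cyl p r h) < \<infinity>"
proof -
  have "measure lborel (cyl p r h) = 2 * h * measure lborel (ball (fst p) r)"
    using assms by (simp add: measure_def emeasure_cyl enn2real_mult)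
  then show "measure lborel (cyl p r h) = 2 * h * r ^ (2 * CARD('n)) * measure lborel (ball (0 :: complex ^ 'n) 1)"
    using content_ball_conv_unit_ball[OF assms(2), of "fst p"] by (simp add: mult.commute)
  show "emeasure lborel (cyl p r h) < \<infinity>"
    using assms emeasure_lborel_ball_finite[of "fst p" r] by (simp add: emeasure_cyl ennreal_mult_less_top)
qed

lemma koranyi_ball_subset_cyl: "{q. koranyi p q < r} \<subseteq> cyl p r (r\<^sup>2)"
proof
  fix q assume "q \<in> {q. koranyi p q < r}"
  then have k: "koranyi p q < r" by simp
  then have "(koranyi p q)\<^sup>2 < r\<^sup>2" by (intro power_strict_mono) (auto simp: koranyi_nonneg)
  then show "q \<in> cyl p r (r\<^sup>2)"
    using k norm_horiz_le[of p q] abs_vert_le[of p q] unfolding cyl_def by simp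
qed

lemma cyl_subset_koranyi_ball:
  assumes "0 < r"
  shows "cyl p (r / 2) (r\<^sup>2 / 2) \<subseteq> {q. koranyi p q < r}"
proof
  fix q assume "q \<in> cyl p (r / 2) (r\<^sup>2 / 2)"
  then have q: "norm (horiz p q) < r / 2" "\<bar>vert p q\<bar> < r\<^sup>2 / 2" unfolding cyl_def by auto
  have "(norm (horiz p q))\<^sup>2 < (r / 2)\<^sup>2" using q(1) by (rule power_strict_mono) auto
  then have "((norm (horiz p q))\<^sup>2)\<^sup>2 < ((r / 2)\<^sup>2)\<^sup>2" by (rule power_strict_mono) auto
  moreover have "\<bar>vert p q\<bar>\<^sup>2 < (r\<^sup>2 / 2)\<^sup>2" using q(2) by (intro power_strict_mono) auto
  ultimately have "((norm (horiz p q))\<^sup>2)\<^sup>2 < r ^ 4 / 16" "(vert p q)\<^sup>2 < r ^ 4 / 4"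
    by (simp_all add: power_divide)
  then have "gauge4 p q < r ^ 4"
    unfolding gauge4_def power2_norm_eq_inner[symmetric] using zero_less_power[OF assms, of 4] by linarith
  then show "q \<in> {q. koranyi p q < r}" using koranyi_less_iff[of r p q] assms by simp
qed

text \<open>The volume of \<open>cyl\<close> with radius 300001 r and height its square, divided by
  that with radius r/4 and height r^2/8. Cylinders of the second kind around r-separated points lie
  in disjoint balls of radius r/2.\<close>

definition packing_const :: "'n itself \<Rightarrow> nat" where
  "packing_const _ = 8 * 4 ^ (2 * CARD('n)) * 300001 ^ (2 * CARD('n) + 2)"

lemma koranyi_packing:
  fixes p :: "'n::finite heis"
  assumes r: "0 < r" and S: "finite S" "S \<subseteq> {y. koranyi p y \<le> 300000 * r}"
    and sep: "\<forall>x\<in>S. \<forall>y\<in>S. x \<noteq> y \<longrightarrow> r \<le> koranyi x y"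
  shows "card S \<le> packing_const TYPE('n)"
proof -
  interpret Metric_space UNIV "koranyi :: 'n heis \<Rightarrow> 'n heis \<Rightarrow> real" by (rule koranyi_metric)
  define B where "B x = cyl x (r / 4) (r\<^sup>2 / 8)" for x :: "'n heis"
  define v where "v = measure lborel (ball (0 :: complex ^ 'n) 1)"
  have v: "0 < v" unfolding v_def by (simp add: content_ball_pos)
  define R where "R = 300001 * r"
  have Bk: "koranyi x y < r / 2" if "y \<in> B x" for x y
    using cyl_subset_koranyi_ball[of "r/2" x] r that unfolding B_def by (auto simp: power_divide)
  have sets: "B x \<in> fmeasurable lborel" for x
    unfolding B_def using measure_cyl(2)[of "r\<^sup>2/8" "r/4" x] r
    by (intro fmeasurableI) (simp_all add: borel_cyl)
  have "card S * (2 * (r\<^sup>2 / 8) * (r / 4) ^ (2 * CARD('n)) * v) = (\<Sum>x\<in>S. measure lborel (B x))"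
    using r unfolding B_def v_def by (simp add: measure_cyl)
  also have "\<dots> = measure lborel (\<Union>x\<in>S. B x)"
  proof (rule measure_finite_Union[symmetric])
    show "disjoint_family_on B S"
      unfolding disjoint_family_on_def
    proof (intro ballI impI)
      fix x y assume "x \<in> S" "y \<in> S" "x \<noteq> y"
      then have "r \<le> koranyi x y" using sep by blast
      then show "B x \<inter> B y = {}" using Bk[of _ x] Bk[of _ y] triangle[of x _ y] commute
        by (smt (verit, best) disjoint_iff field_sum_of_halves iso_tuple_UNIV_I)
    qed
    show "emeasure lborel (B x) \<noteq> \<infinity>" for x using sets[of x] by (auto simp: fmeasurable_def)
  qed (use S open_cyl in \<open>auto simp: B_def borel_open\<close>)
  also have "\<dots> \<le> measure lborel (cyl p R (R\<^sup>2))"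
  proof (rule measure_mono_fmeasurable)
    show "(\<Union>x\<in>S. B x) \<subseteq> cyl p R (R\<^sup>2)"
    proof safe
      fix x y assume xy: "x \<in> S" "y \<in> B x"
      have "koranyi p y < R" using Bk[OF xy(2)] S(2) xy(1) koranyi_triangle[of p y x] r unfolding R_def by fastforce
      then show "y \<in> cyl p R (R\<^sup>2)" using koranyi_ball_subset_cyl by blast
    qed
    show "cyl p R (R\<^sup>2) \<in> fmeasurable lborel"
      using measure_cyl(2)[of "R\<^sup>2" R p] r unfolding R_def
      by (intro fmeasurableI) (simp_all add: borel_cyl)
  qed (use S sets in \<open>auto intro!: sets.finite_UN simp: fmeasurable_def\<close>)
  also have "\<dots> = 2 * R\<^sup>2 * R ^ (2 * CARD('n)) * v"
    using r unfolding R_def v_def by (simp add: measure_cyl)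
  finally have "card S * (r\<^sup>2 / 4 * (r / 4) ^ (2 * CARD('n))) \<le> 2 * R\<^sup>2 * R ^ (2 * CARD('n))"
    using v by (simp add: mult.assoc[symmetric])
  also have "card S * (r\<^sup>2 / 4 * (r / 4) ^ (2 * CARD('n))) = card S / (4 * 4 ^ (2 * CARD('n))) * r ^ (2 * CARD('n) + 2)"
    by (simp add: power_divide power_add mult_ac power2_eq_square)
  also have "2 * R\<^sup>2 * R ^ (2 * CARD('n)) = 2 * 300001 ^ (2 * CARD('n) + 2) * r ^ (2 * CARD('n) + 2)"
    unfolding R_def power_mult_distrib power_add by simp
  finally have "card S / (4 * 4 ^ (2 * CARD('n))) \<le> 2 * 300001 ^ (2 * CARD('n) + 2)"
    by (rule mult_right_le_imp_le) (use r in simp)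
  then have "real (card S) \<le> 2 * 300001 ^ (2 * CARD('n) + 2) * (4 * 4 ^ (2 * CARD('n)))"
    by (simp add: divide_le_eq)
  also have "\<dots> = real (packing_const TYPE('n))" unfolding packing_const_def by simp
  finally show ?thesis by simp
qed

lemma packing_const_pos: "1 \<le> packing_const TYPE('n::finite)"
  by (simp add: packing_const_def Suc_le_eq)

section \<open>Pseudo-Hermitian structures at a point\<close>

text \<open>In the coordinate \<open>a\<close> on the Levi distribution, \<open>J_b\<close> is multiplication by \<open>\<i>\<close>.\<close>

definition hlift :: "'n::finite heis \<Rightarrow> complex ^ 'n \<Rightarrow> 'n heis" where
  "hlift p a = (a, 2 * (fst p \<bullet> vi a))"

definition std_theta :: "'n::finite heis \<Rightarrow> 'n heis \<Rightarrow> real" where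
  "std_theta p w = snd w - 2 * (fst p \<bullet> vi (fst w))"

lemma hlift_linear: "linear (hlift p)"
  by (rule linearI) (auto simp: hlift_def inner_add_right algebra_simps)

lemmas hlift_simps = linear_add[OF hlift_linear] linear_diff[OF hlift_linear]
  linear_cmul[OF hlift_linear] linear_neg[OF hlift_linear] linear_0[OF hlift_linear]

lemma fst_hlift [simp]: "fst (hlift p a) = a"
  by (simp add: hlift_def)

lemma std_theta_hlift [simp]: "std_theta p (hlift p a) = 0"
  by (simp add: hlift_def std_theta_def)

lemma std_theta_e [simp]: "std_theta p (0, t) = t"
  by (simp add: std_theta_def)

lemma std_theta_linear: "linear (std_theta p)"
  by (rule linearI) (auto simp: std_theta_def inner_add_right algebra_simps)

lemma hlift_decomp: "v = hlift p (fst v) + std_theta p v *\<^sub>R (0, 1)"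
  by (cases v) (simp add: hlift_def std_theta_def)

text \<open>The (1,0)-vector (X - i J X)/2 of the horizontal vector X =
  \<open>hlift p c\<close>.\<close>

definition H10_vec :: "'n::finite heis \<Rightarrow> complex ^ 'n \<Rightarrow> 'n heis cplxfn" where
  "H10_vec p c = ((1/2) *\<^sub>R hlift p c, - ((1/2) *\<^sub>R hlift p (vi c)))"

lemma H10_sum:
  fixes p :: "'n::finite heis" and c :: "'n \<Rightarrow> complex"
  shows "(\<Sum>j\<in>UNIV. cplx_scale (c j) (T_field j p)) = H10_vec p (\<chi> j. c j)"
proof -
  have 1: "fst (fst (cplx_scale (c j) (T_field j p))) = (1/2) *\<^sub>R axis j (c j)" for j
    by (auto simp: cplx_scale_def T_field_def d_dz_def d_dt_def vec_eq_iff axis_def complex_eq_iff)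
  have 2: "fst (snd (cplx_scale (c j) (T_field j p))) = - ((1/2) *\<^sub>R axis j (\<i> * c j))" for j
    by (auto simp: cplx_scale_def T_field_def d_dz_def d_dt_def vec_eq_iff axis_def complex_eq_iff)
  have 3: "snd (fst (cplx_scale (c j) (T_field j p))) = fst p $ j \<bullet> (\<i> * c j)" for j
    by (auto simp: cplx_scale_def T_field_def d_dz_def d_dt_def inner_complex_def algebra_simps)
  have 4: "snd (snd (cplx_scale (c j) (T_field j p))) = fst p $ j \<bullet> c j" for j
    by (auto simp: cplx_scale_def T_field_def d_dz_def d_dt_def inner_complex_def algebra_simps)
  have ax: "(\<Sum>j\<in>UNIV. axis j (f j)) = (\<chi> j. f j)" for f :: "'n \<Rightarrow> complex"
    by (auto simp: vec_eq_iff axis_def sum.delta)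
  show ?thesis
  proof (intro prod_eqI)
    show "fst (fst (\<Sum>j\<in>UNIV. cplx_scale (c j) (T_field j p))) = fst (fst (H10_vec p (\<chi> j. c j)))"
      by (simp add: fst_sum 1 scaleR_sum_right[symmetric] ax H10_vec_def)
    show "fst (snd (\<Sum>j\<in>UNIV. cplx_scale (c j) (T_field j p))) = fst (snd (H10_vec p (\<chi> j. c j)))"
      by (simp add: fst_sum snd_sum 2 scaleR_sum_right[symmetric] sum_negf ax H10_vec_def vi_def)
    show "snd (fst (\<Sum>j\<in>UNIV. cplx_scale (c j) (T_field j p))) = snd (fst (H10_vec p (\<chi> j. c j)))"
      by (simp add: fst_sum snd_sum 3 H10_vec_def hlift_def inner_vec_def vi_def)
    show "snd (snd (\<Sum>j\<in>UNIV. cplx_scale (c j) (T_field j p))) = snd (snd (H10_vec p (\<chi> j. c j)))"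
      by (simp add: fst_sum snd_sum 4 H10_vec_def hlift_def inner_vec_def vi_def mult.assoc[symmetric] sum_negf)
  qed
qed

lemma H10_eq: "H10 p = range (H10_vec p)"
proof -
  have "H10_vec p c = (\<Sum>j\<in>UNIV. cplx_scale (c $ j) (T_field j p))" for c
    using H10_sum[of "\<lambda>j. c $ j" p] by simp
  then show ?thesis unfolding H10_def using H10_sum[of _ p] by blast
qed

lemma levi_dist_eq: "levi_dist p = range (hlift p)"
proof -
  have 1: "fst (H10_vec p c + cplx_conj (H10_vec p c')) = hlift p ((1/2) *\<^sub>R (c + c'))" for c c'
    by (simp add: H10_vec_def cplx_conj_def hlift_simps scaleR_add_right)
  show ?thesis
  proof (rule set_eqI, rule iffI)
    fix x assume "x \<in> levi_dist p"
    then obtain v w where "x = fst (v + cplx_conj w)" "v \<in> H10 p" "w \<in> H10 p"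
      unfolding levi_dist_def by blast
    moreover obtain c c' where "v = H10_vec p c" "w = H10_vec p c'"
      using calculation(2,3) unfolding H10_eq by blast
    ultimately show "x \<in> range (hlift p)" using 1 by blast
  next
    fix x assume "x \<in> range (hlift p)"
    then obtain a where "x = hlift p a" by blast
    also have "\<dots> = fst (H10_vec p a + cplx_conj (H10_vec p a))"
      unfolding 1 by (simp add: scaleR_add_right flip: scaleR_add_left)
    finally show "x \<in> levi_dist p" unfolding levi_dist_def H10_eq by blast
  qed
qed

lemma levi_dist_iff: "v \<in> levi_dist p \<longleftrightarrow> std_theta p v = 0"
proof
  assume 0: "std_theta p v = 0"
  have "v = hlift p (fst v) + std_theta p v *\<^sub>R (0, 1)" by (rule hlift_decomp)
  also have "\<dots> = hlift p (fst v)" unfolding 0 scale_zero_left by (rule add_0_right)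
  finally show "v \<in> levi_dist p" unfolding levi_dist_eq by (rule range_eqI)
qed (auto simp: levi_dist_eq)

lemma J_b_hlift: "J_b p (hlift p a) = hlift p (vi a)"
  unfolding J_b_def
proof (rule the_equality)
  show "\<exists>v\<in>H10 p. (hlift p a, 0) = v + cplx_conj v \<and> (hlift p (vi a), 0) = cplx_scale \<i> (v - cplx_conj v)"
    by (intro bexI[of _ "H10_vec p a"])
      (auto simp: H10_eq H10_vec_def cplx_conj_def cplx_scale_def prod_eq_iff)
next
  fix y assume "\<exists>v\<in>H10 p. (hlift p a, 0) = v + cplx_conj v \<and> (y, 0) = cplx_scale \<i> (v - cplx_conj v)"
  then obtain c where c: "(hlift p a, 0) = H10_vec p c + cplx_conj (H10_vec p c)"
     "(y, 0) = cplx_scale \<i> (H10_vec p c - cplx_conj (H10_vec p c))" unfolding H10_eq by auto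
  from c(1) have "hlift p a = hlift p c" by (simp add: H10_vec_def cplx_conj_def flip: scaleR_add_left)
  then have "a = c" by (metis fst_hlift)
  have "y = fst (cplx_scale \<i> (H10_vec p c - cplx_conj (H10_vec p c)))" unfolding c(2)[symmetric] by simp
  also have "\<dots> = (1/2) *\<^sub>R hlift p (vi c) + (1/2) *\<^sub>R hlift p (vi c)"
    by (simp add: H10_vec_def cplx_conj_def cplx_scale_def)
  also have "\<dots> = hlift p (vi a)" unfolding \<open>a = c\<close> by (simp flip: scaleR_add_left)
  finally show "y = hlift p (vi a)" .
qed

text \<open>\<open>\<theta> = f \<theta>\<^sub>0\<close> and \<open>d\<theta> = df \<and> \<theta>\<^sub>0 + f d\<theta>\<^sub>0\<close> with \<open>\<beta> = df\<close>, for the standard contact form \<open>\<theta>\<^sub>0\<close>.\<close>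

definition conformal_at ::
  "'n::finite heis set \<Rightarrow> 'n one_form \<Rightarrow> 'n heis \<Rightarrow> real \<Rightarrow> ('n heis \<Rightarrow> real) \<Rightarrow> bool" where
  "conformal_at \<Omega> \<theta> p f \<beta> \<longleftrightarrow> linear \<beta> \<and> (\<forall>w. blinfun_apply (\<theta> p) w = f * std_theta p w) \<and>
     (\<forall>v w. ext_deriv \<Omega> \<theta> p v w =
        \<beta> v * std_theta p w - \<beta> w * std_theta p v - 4 * f * (fst v \<bullet> vi (fst w)))"

lemma theta_eq:
  assumes "pseudo_hermitian \<Omega> \<theta>" "p \<in> \<Omega>"
  shows "blinfun_apply (\<theta> p) w = blinfun_apply (\<theta> p) (0, 1) * std_theta p w"
proof -
  have "hlift p (fst w) \<in> levi_dist p" by (simp add: levi_dist_eq)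
  then have "blinfun_apply (\<theta> p) (hlift p (fst w)) = 0" using assms unfolding pseudo_hermitian_def by blast
  then have "blinfun_apply (\<theta> p) (hlift p (fst w) + std_theta p w *\<^sub>R (0, 1)) =
      blinfun_apply (\<theta> p) (0, 1) * std_theta p w"
    by (simp only: blinfun.add_right blinfun.scaleR_right) simp
  then show ?thesis by (simp only: hlift_decomp[of w p, symmetric])
qed

lemma smooth_onE:
  assumes "smooth_on S f" "p \<in> S"
  obtains U g where "open U" "p \<in> U" "\<And>k. Ck_on k U g" "\<And>x. x \<in> U \<Longrightarrow> x \<in> S \<Longrightarrow> g x = f x"
proof -
  have "\<exists>U g. open U \<and> p \<in> U \<and> (\<forall>k. Ck_on k U g) \<and> (\<forall>x\<in>U \<inter> S. g x = f x)"
    using assms unfolding smooth_on_def by (rule bspec)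
  then show thesis by (elim exE conjE) (rule that, assumption, assumption, erule spec, simp)
qed

lemma smooth_on_differentiable:
  assumes "smooth_on S f" "p \<in> interior S"
  shows "f differentiable (at p)"
proof -
  have "p \<in> S" using assms(2) interior_subset by auto
  then obtain U g where U: "open U" "p \<in> U" "\<And>k. Ck_on k U g" "\<And>x. x \<in> U \<Longrightarrow> x \<in> S \<Longrightarrow> g x = f x"
    using smooth_onE[OF assms(1)] by metis
  have "g differentiable (at p)" using U(2) U(3)[of "Suc 0"] by simp
  then obtain D where D: "(g has_derivative D) (at p)" unfolding differentiable_def by auto
  have "(f has_derivative D) (at p)"
    by (rule has_derivative_transform_within_open[OF D, of "U \<inter> interior S"])
      (use U assms interior_subset in auto)
  then show ?thesis unfolding differentiable_def by blast
qed

lemma smooth_on_continuous_on: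
  assumes "smooth_on S f" shows "continuous_on S f"
proof (rule continuous_on_eq_continuous_within[THEN iffD2], rule ballI)
  fix p assume p: "p \<in> S"
  obtain U g where U: "open U" "p \<in> U" "\<And>k. Ck_on k U g" "\<And>x. x \<in> U \<Longrightarrow> x \<in> S \<Longrightarrow> g x = f x"
    using smooth_onE[OF assms p] by metis
  have "continuous (at p) g" using U(1,2) U(3)[of 0] by (simp add: continuous_on_eq_continuous_at)
  then have g: "continuous (at p within S) g" by (rule continuous_at_imp_continuous_at_within)
  obtain e where "0 < e" "ball p e \<subseteq> U" using U(1,2) openE by blast
  then show "continuous (at p within S) f"
    using U(4) p by (intro continuous_transform_within[OF g, of e]) (auto simp: dist_commute mem_ball subset_iff)
qed

lemma conformal_at_interior:
  assumes ph: "pseudo_hermitian \<Omega> \<theta>" and p: "p \<in> interior \<Omega>"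
  shows "\<exists>\<beta>. conformal_at \<Omega> \<theta> p (blinfun_apply (\<theta> p) (0, 1)) \<beta>"
proof -
  define f where "f q = blinfun_apply (\<theta> q) (0, 1)" for q
  define D where "D = frechet_derivative \<theta> (at p)"
  define \<beta> where "\<beta> v = blinfun_apply (D v) (0, 1)" for v
  have "\<theta> differentiable (at p)"
    using ph p smooth_on_differentiable unfolding pseudo_hermitian_def by blast
  then have D: "(\<theta> has_derivative D) (at p)" unfolding D_def by (simp add: frechet_derivative_works)
  then have linD: "linear D" by (rule has_derivative_linear)
  have Dw: "((\<lambda>q. blinfun_apply (\<theta> q) w) has_derivative (\<lambda>v. blinfun_apply (D v) w)) (at p)" for w
    by (rule has_derivative_eq_rhs, rule blinfun.FDERIV[OF D has_derivative_const]) simp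
  have "((\<lambda>q. std_theta q w) has_derivative (\<lambda>v. - (2 * (fst v \<bullet> vi (fst w))))) (at p)" for w
    unfolding std_theta_def by (auto intro!: derivative_eq_intros)
  then have "((\<lambda>q. f q * std_theta q w) has_derivative
      (\<lambda>v. f p * - (2 * (fst v \<bullet> vi (fst w))) + \<beta> v * std_theta p w)) (at p)" for w
    using Dw[of "(0, 1)"] unfolding f_def \<beta>_def by (intro has_derivative_mult)
  then have Dw2: "((\<lambda>q. blinfun_apply (\<theta> q) w) has_derivative
      (\<lambda>v. f p * - (2 * (fst v \<bullet> vi (fst w))) + \<beta> v * std_theta p w)) (at p)" for w
  proof (rule has_derivative_transform_within_open[of _ _ _ _ "interior \<Omega>"])
    fix q assume "q \<in> interior \<Omega>"
    then have "q \<in> \<Omega>" using interior_subset by blast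
    from theta_eq[OF ph this] show "f q * std_theta q w = blinfun_apply (\<theta> q) w" unfolding f_def ..
  qed (use p in simp_all)
  have Deq: "blinfun_apply (D v) w = \<beta> v * std_theta p w - 2 * f p * (fst v \<bullet> vi (fst w))" for v w
    using fun_cong[OF has_derivative_unique[OF Dw[of w] Dw2[of w]], of v] by simp
  have "at p within \<Omega> = at p" by (rule at_within_interior[OF p])
  then have "ext_deriv \<Omega> \<theta> p v w =
      \<beta> v * std_theta p w - \<beta> w * std_theta p v - 4 * f p * (fst v \<bullet> vi (fst w))" for v w
    unfolding ext_deriv_def D_def[symmetric] using inner_vi_skew[of "fst w" "fst v"]
    by (simp add: D_def[symmetric] Deq)
  moreover have "linear \<beta>"
    by (rule linearI) (simp_all add: \<beta>_def linear_add[OF linD] linear_cmul[OF linD] blinfun.add_left blinfun.scaleR_left)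
  moreover have "blinfun_apply (\<theta> p) w = f p * std_theta p w" for w
    unfolding f_def by (rule theta_eq[OF ph]) (use p interior_subset in blast)
  ultimately have "conformal_at \<Omega> \<theta> p (f p) \<beta>"
    unfolding conformal_at_def by blast
  then show ?thesis unfolding f_def by (rule exI[of _ \<beta>])
qed

text \<open>The Levi form of \<open>H10_vec p a\<close> with itself is 2 f |a|^2, so a single
  nonzero a decides the sign.\<close>

lemma conformal_factor_pos:
  fixes \<theta> :: "'n::finite one_form"
  assumes lp: "levi_positive \<Omega> \<theta>" and p: "p \<in> \<Omega>" and c: "conformal_at \<Omega> \<theta> p f \<beta>"
  shows "0 < f"
proof -
  obtain j :: 'n where True by blast
  define a :: "complex ^ 'n" where "a = axis j 1"
  have a: "a \<noteq> 0" unfolding a_def by (simp add: axis_eq_0_iff)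
  have "H10_vec p a \<noteq> 0"
  proof
    assume "H10_vec p a = 0"
    then have "fst (H10_vec p a) = 0" by simp
    then have "hlift p a = 0" unfolding H10_vec_def by simp
    then show False using a by (metis fst_hlift fst_zero)
  qed
  then have "0 < Re (levi_form \<Omega> \<theta> p (H10_vec p a) (H10_vec p a))"
    using lp p unfolding levi_positive_def H10_eq by blast
  moreover have E: "ext_deriv \<Omega> \<theta> p v w =
        \<beta> v * std_theta p w - \<beta> w * std_theta p v - 4 * f * (fst v \<bullet> vi (fst w))" for v w
    using c unfolding conformal_at_def by blast
  have "levi_form \<Omega> \<theta> p (H10_vec p a) (H10_vec p a) = 2 * f * (a \<bullet> a)"
    unfolding levi_form_def cplx_bilinear_def cplx_conj_def H10_vec_def
    by (simp add: E complex_eq_iff linear_cmul[OF std_theta_linear] linear_neg[OF std_theta_linear]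
        inner_vi_left)
  ultimately have "0 < f * (a \<bullet> a)" by simp
  then show ?thesis using a by (simp add: zero_less_mult_iff) (meson inner_ge_zero not_less)
qed

lemma riesz_linear:
  fixes \<gamma> :: "'a::euclidean_space \<Rightarrow> real"
  assumes "linear \<gamma>" shows "\<exists>g. \<forall>w. \<gamma> w = g \<bullet> w"
  using adjoint_works[OF assms, of _ 1] by (metis inner_commute inner_real_def mult_1)

text \<open>In the coordinates \<open>h v\<close> and \<open>std_theta p v\<close> the Webster
  metric is diagonal, with coefficients 4f and f^2, so the gradient can be written down. Its
  projection sees only the derivative \<open>G\<close> along the Levi distribution and has squared
  length |G|^2 / (4f). Positivity of f supplies the uniqueness that the definite descriptions
  demand.\<close>

lemma sub_gradient_energy_le:
  fixes p :: "'n::finite heis"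
  assumes c: "conformal_at \<Omega> \<theta> p f \<beta>" and f: "0 < f"
    and L: "frechet_derivative u (at p within \<Omega>) = L" "linear L"
    and le: "\<And>y. \<bar>L (hlift p y)\<bar> \<le> C * norm y"
  shows "webster_metric \<Omega> \<theta> p (sub_gradient \<Omega> \<theta> u p) (sub_gradient \<Omega> \<theta> u p) \<le> C\<^sup>2 / (4 * f)"
proof -
  have E: "ext_deriv \<Omega> \<theta> p v w =
        \<beta> v * std_theta p w - \<beta> w * std_theta p v - 4 * f * (fst v \<bullet> vi (fst w))" for v w
    using c unfolding conformal_at_def by blast
  have \<theta>: "blinfun_apply (\<theta> p) w = f * std_theta p w" for w
    using c unfolding conformal_at_def by blast
  have \<beta>: "linear \<beta>" using c unfolding conformal_at_def by blast
  have "linear (\<lambda>y. \<beta> (hlift p y))" using linear_compose[OF hlift_linear \<beta>] by (simp add: o_def)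
  then obtain g where g: "\<And>w. \<beta> (hlift p w) = g \<bullet> w" using riesz_linear by blast
  define r where "r = (- 1 / (4 * f)) *\<^sub>R vi g"
  have r: "\<beta> (hlift p w) = - 4 * f * (r \<bullet> vi w)" for w
    unfolding r_def using f by (simp add: g)
  text \<open>The kernel of \<open>d\<theta>\<close> is spanned by \<open>hlift p r + \<partial>/\<partial>t\<close>, and \<open>h\<close> is the projection along it.\<close>
  define h where "h v = fst v - std_theta p v *\<^sub>R r" for v
  note lin_std = linear_add[OF std_theta_linear, of p] linear_diff[OF std_theta_linear, of p]
     linear_cmul[OF std_theta_linear, of p]
  have h_lift [simp]: "h (hlift p a) = a" for a by (simp add: h_def)
  have h_diff: "h (v - w) = h v - h w" for v w
    unfolding h_def lin_std by (simp add: algebra_simps)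
  have Eh: "ext_deriv \<Omega> \<theta> p v w = - 4 * f * (h v \<bullet> vi (h w))" for v w
  proof -
    have \<beta>v: "\<beta> v = \<beta> (hlift p (fst v)) + std_theta p v * \<beta> (0, 1)" for v
      by (subst (1) hlift_decomp[of v p]) (simp only: linear_add[OF \<beta>] linear_cmul[OF \<beta>] real_scaleR_def)
    show ?thesis unfolding E h_def \<beta>v[of v] \<beta>v[of w] r
      by (simp add: inner_diff_left inner_diff_right inner_vi_skew[of "fst v" r] algebra_simps)
  qed
  have pos: "x = 0" if "f * (x \<bullet> x) = 0" for x :: "complex ^ 'n" using that f by simp
  have proj: "H_proj \<Omega> \<theta> p v = hlift p (h v)" for v
    unfolding H_proj_def
  proof (rule the_equality)
    show "hlift p (h v) \<in> levi_dist p \<and> (\<forall>w. ext_deriv \<Omega> \<theta> p (v - hlift p (h v)) w = 0)"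
      by (simp add: levi_dist_iff Eh h_diff)
  next
    fix a assume a: "a \<in> levi_dist p \<and> (\<forall>w. ext_deriv \<Omega> \<theta> p (v - a) w = 0)"
    then obtain b where b: "a = hlift p b" unfolding levi_dist_eq by blast
    define x where "x = h v - b"
    have "h (v - a) = x" by (simp add: h_diff b x_def)
    then have "ext_deriv \<Omega> \<theta> p (v - a) (hlift p (vi x)) = 4 * (f * (x \<bullet> x))" by (simp add: Eh)
    then have "x = 0" using a pos[of x] by simp
    then show "a = hlift p (h v)" using b unfolding x_def by simp
  qed
  have W: "webster_metric \<Omega> \<theta> p v w = 4 * f * (h v \<bullet> h w) + f\<^sup>2 * (std_theta p v * std_theta p w)" for v w
    unfolding webster_metric_def proj J_b_hlift Eh \<theta> by (simp add: power2_eq_square)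
  have "linear (\<lambda>y. L (hlift p y))" using linear_compose[OF hlift_linear L(2)] by (simp add: o_def)
  then obtain G where G: "\<And>w. L (hlift p w) = G \<bullet> w" using riesz_linear by blast
  \<comment> \<open>Horizontal test vectors force \<open>h a\<close> to be G / (4f); the test vector
    (0, 1) then forces this vertical component.\<close>
  define \<tau> where "\<tau> = (L (0, 1) + G \<bullet> r) / f\<^sup>2"
  define a where "a = hlift p ((1 / (4 * f)) *\<^sub>R G + \<tau> *\<^sub>R r) + \<tau> *\<^sub>R (0, 1)"
  have sa: "std_theta p a = \<tau>" unfolding a_def lin_std by simp
  have ha: "h a = (1 / (4 * f)) *\<^sub>R G" unfolding h_def sa by (simp add: a_def)
  have Wa: "webster_metric \<Omega> \<theta> p a w = L w" for w
  proof -
    have "L w = L (hlift p (fst w)) + std_theta p w * L (0, 1)"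
      by (subst (1) hlift_decomp[of w p]) (simp only: linear_add[OF L(2)] linear_cmul[OF L(2)] real_scaleR_def)
    moreover have "f\<^sup>2 * (\<tau> * std_theta p w) = (L (0, 1) + G \<bullet> r) * std_theta p w"
      unfolding \<tau>_def using f by simp
    moreover have "4 * f * (h a \<bullet> h w) = G \<bullet> fst w - std_theta p w * (G \<bullet> r)"
      unfolding ha using f by (simp add: h_def inner_diff_right right_diff_distrib)
    ultimately show ?thesis unfolding W sa G by (simp add: algebra_simps)
  qed
  have "gradient \<Omega> \<theta> u p = a"
    unfolding gradient_def L(1)
  proof (rule the_equality)
    fix b assume b: "\<forall>w. webster_metric \<Omega> \<theta> p b w = L w"
    have "webster_metric \<Omega> \<theta> p (b - a) (b - a) = webster_metric \<Omega> \<theta> p b (b - a) - webster_metric \<Omega> \<theta> p a (b - a)"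
      unfolding W h_diff lin_std by (simp add: inner_diff_left algebra_simps)
    also have "\<dots> = 0" using b[rule_format, of "b - a"] Wa by simp
    finally have z: "4 * f * (h (b - a) \<bullet> h (b - a)) + f\<^sup>2 * (std_theta p (b - a) * std_theta p (b - a)) = 0"
      unfolding W .
    have "0 \<le> 4 * f * (h (b - a) \<bullet> h (b - a))" "0 \<le> f\<^sup>2 * (std_theta p (b - a) * std_theta p (b - a))"
      using f by simp_all
    then have "f * (h (b - a) \<bullet> h (b - a)) = 0" "f\<^sup>2 * (std_theta p (b - a) * std_theta p (b - a)) = 0"
      using z by linarith+
    then have 0: "h (b - a) = 0" "std_theta p (b - a) = 0" using f pos by auto
    then have "fst (b - a) = 0" unfolding h_def by simp
    then have "b - a = hlift p 0 + 0 *\<^sub>R (0, 1)" using hlift_decomp[of "b - a" p] 0 by metis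
    then have "b - a = 0" unfolding hlift_simps scale_zero_left by (simp only: add_0_right)
    then show "b = a" by (simp only: right_minus_eq)
  qed (use Wa in blast)
  then have sub: "sub_gradient \<Omega> \<theta> u p = hlift p ((1 / (4 * f)) *\<^sub>R G)"
    unfolding sub_gradient_def proj by (simp add: ha)
  have "webster_metric \<Omega> \<theta> p (sub_gradient \<Omega> \<theta> u p) (sub_gradient \<Omega> \<theta> u p) = (G \<bullet> G) / (4 * f)"
    unfolding sub W h_lift using f by (simp add: field_simps)
  also have "\<dots> \<le> C\<^sup>2 / (4 * f)"
  proof (intro divide_right_mono)
    have "norm G * norm G \<le> C * norm G" using le[of G] unfolding G by (simp flip: norm_eq_sqrt_inner power2_eq_square power2_norm_eq_inner)
    then have "norm G \<le> C \<or> norm G = 0" by (auto simp: mult_le_cancel_right)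
    moreover have "0 \<le> C"
    proof -
      obtain y :: "complex ^ 'n" where "norm y = 1" using vector_choose_size[of 1] by auto
      then show ?thesis using le[of y] by simp
    qed
    ultimately have "(norm G)\<^sup>2 \<le> C\<^sup>2" by (intro power_mono) auto
    then show "G \<bullet> G \<le> C\<^sup>2" by (simp add: power2_norm_eq_inner)
  qed (use f in simp)
  finally show ?thesis .
qed

section \<open>The volume form\<close>

text \<open>The value of \<alpha> \<and> E^n on vectors without the normalizing factor, for general
  \<alpha> and E, so that multilinearity and alternation can be treated apart from \<theta>.\<close>

definition wedge_sum :: "nat \<Rightarrow> ('a \<Rightarrow> real) \<Rightarrow> ('a \<Rightarrow> 'a \<Rightarrow> real) \<Rightarrow> (nat \<Rightarrow> 'a) \<Rightarrow> real" where
  "wedge_sum n \<alpha> E v = (\<Sum>\<sigma> | \<sigma> permutes {..2 * n}. of_int (sign \<sigma>) * \<alpha> (v (\<sigma> 0)) *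
     (\<Prod>k<n. E (v (\<sigma> (2 * k + 1))) (v (\<sigma> (2 * k + 2)))))"

text \<open>Composition with the transposition of i and j leaves every product unchanged and
  reverses every sign.\<close>

lemma wedge_sum_repeated:
  assumes "i \<noteq> j" "i \<le> 2 * n" "j \<le> 2 * n" "v i = v j"
  shows "wedge_sum n \<alpha> E v = 0"
proof -
  define t where "t = Transposition.transpose i j"
  have t: "t permutes {..2 * n}" unfolding t_def using assms by (intro permutes_swap_id) auto
  have vt: "v (t k) = v k" for k unfolding t_def using assms(4) by (auto simp: Transposition.transpose_def)
  have "wedge_sum n \<alpha> E v = (\<Sum>\<sigma> | \<sigma> permutes {..2 * n}. of_int (sign (t \<circ> \<sigma>)) * \<alpha> (v ((t \<circ> \<sigma>) 0)) *
     (\<Prod>k<n. E (v ((t \<circ> \<sigma>) (2 * k + 1))) (v ((t \<circ> \<sigma>) (2 * k + 2)))))"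
    unfolding wedge_sum_def by (rule setum_permutations_compose_left[OF t])
  also have "\<dots> = (\<Sum>\<sigma> | \<sigma> permutes {..2 * n}. - (of_int (sign \<sigma>) * \<alpha> (v (\<sigma> 0)) *
     (\<Prod>k<n. E (v (\<sigma> (2 * k + 1))) (v (\<sigma> (2 * k + 2))))))"
  proof (rule sum.cong)
    fix \<sigma> assume "\<sigma> \<in> {\<sigma>. \<sigma> permutes {..2 * n}}"
    then have "permutation \<sigma>" by (auto intro: permutes_imp_permutation[of "{..2*n}"])
    moreover have "permutation t" using t by (auto intro: permutes_imp_permutation[of "{..2*n}"])
    ultimately have "sign (t \<circ> \<sigma>) = - sign \<sigma>"
      using assms(1) by (simp add: sign_compose t_def sign_swap_id)
    then show "of_int (sign (t \<circ> \<sigma>)) * \<alpha> (v ((t \<circ> \<sigma>) 0)) *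
       (\<Prod>k<n. E (v ((t \<circ> \<sigma>) (2 * k + 1))) (v ((t \<circ> \<sigma>) (2 * k + 2)))) =
       - (of_int (sign \<sigma>) * \<alpha> (v (\<sigma> 0)) * (\<Prod>k<n. E (v (\<sigma> (2 * k + 1))) (v (\<sigma> (2 * k + 2)))))"
      by (simp add: vt)
  qed simp
  also have "\<dots> = - wedge_sum n \<alpha> E v" unfolding wedge_sum_def by (simp add: sum_negf)
  finally show ?thesis by simp
qed

text \<open>Each summand is linear in the i-th vector, and the extra terms form a wedge sum in which
  \<open>v j\<close> occurs twice.\<close>

lemma wedge_sum_shear:
  fixes \<alpha> :: "'a::real_vector \<Rightarrow> real"
  assumes \<alpha>: "linear \<alpha>" and E: "\<And>x. linear (E x)" "\<And>y. linear (\<lambda>x. E x y)"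
    and ij: "i \<noteq> j" "i \<le> 2 * n" "j \<le> 2 * n"
  shows "wedge_sum n \<alpha> E (v(i := v i + c *\<^sub>R v j)) = wedge_sum n \<alpha> E v"
proof -
  define T where "T \<sigma> w = of_int (sign \<sigma>) * \<alpha> (w (\<sigma> 0)) *
     (\<Prod>k<n. E (w (\<sigma> (2 * k + 1))) (w (\<sigma> (2 * k + 2))))" for \<sigma> and w :: "nat \<Rightarrow> 'a"
  have split: "T \<sigma> (v(i := x + c *\<^sub>R y)) = T \<sigma> (v(i := x)) + c * T \<sigma> (v(i := y))"
    if \<sigma>: "\<sigma> permutes {..2 * n}" for \<sigma> x y
  proof -
    define m where "m = inv \<sigma> i"
    have m: "\<sigma> m = i" "m \<le> 2 * n"
      using \<sigma> ij(2) permutes_inverses(1)[OF \<sigma>, of i] permutes_in_image[OF permutes_inv[OF \<sigma>], of i]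
      unfolding m_def by auto
    have other: "(v(i := z)) (\<sigma> l) = v (\<sigma> l)" if "l \<noteq> m" for l z
      using that m(1) permutes_inj[OF \<sigma>] by (auto dest: injD)
    have here: "(v(i := z)) (\<sigma> m) = z" for z using m by simp
    show ?thesis
    proof (cases "m = 0")
      case True
      have "T \<sigma> (v(i := z)) = of_int (sign \<sigma>) * \<alpha> z * (\<Prod>k<n. E (v (\<sigma> (2 * k + 1))) (v (\<sigma> (2 * k + 2))))" for z
        unfolding T_def using here[of z] other[of _ z] True by simp
      then show ?thesis by (simp add: linear_add[OF \<alpha>] linear_cmul[OF \<alpha>] algebra_simps)
    next
      case False
      \<comment> \<open>Position 0 belongs to \<alpha>; a position m > 0 belongs to the factor with
        index \<open>k0\<close>, as first argument if m is odd and as second if it is even.\<close>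
      define k0 where "k0 = (m - 1) div 2"
      have k0: "k0 < n" using m(2) False unfolding k0_def by auto
      define R where "R = of_int (sign \<sigma>) * \<alpha> (v (\<sigma> 0)) *
         (\<Prod>k\<in>{..<n} - {k0}. E (v (\<sigma> (2 * k + 1))) (v (\<sigma> (2 * k + 2))))"
      have T: "T \<sigma> (v(i := z)) = R * E ((v(i := z)) (\<sigma> (2 * k0 + 1))) ((v(i := z)) (\<sigma> (2 * k0 + 2)))" for z
      proof -
        have "(\<Prod>k\<in>{..<n} - {k0}. E ((v(i := z)) (\<sigma> (2 * k + 1))) ((v(i := z)) (\<sigma> (2 * k + 2)))) =
          (\<Prod>k\<in>{..<n} - {k0}. E (v (\<sigma> (2 * k + 1))) (v (\<sigma> (2 * k + 2))))"
        proof (rule prod.cong)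
          fix k assume "k \<in> {..<n} - {k0}"
          then have "2 * k + 1 \<noteq> m" "2 * k + 2 \<noteq> m" unfolding k0_def by auto
          then show "E ((v(i := z)) (\<sigma> (2 * k + 1))) ((v(i := z)) (\<sigma> (2 * k + 2))) =
             E (v (\<sigma> (2 * k + 1))) (v (\<sigma> (2 * k + 2)))" using other by metis
        qed simp
        then show ?thesis unfolding T_def R_def using other[of 0 z] False k0
          by (simp add: prod.remove[of "{..<n}" k0])
      qed
      have "m = 2 * k0 + 1 \<or> m = 2 * k0 + 2" using False unfolding k0_def by presburger
      then show ?thesis
      proof
        assume mk: "m = 2 * k0 + 1"
        have "T \<sigma> (v(i := z)) = R * E z (v (\<sigma> (2 * k0 + 2)))" for z
          unfolding T using here[of z] other[of "2 * k0 + 2" z] mk by simp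
        then show ?thesis by (simp add: linear_add[OF E(2)] linear_cmul[OF E(2)] algebra_simps)
      next
        assume mk: "m = 2 * k0 + 2"
        have "T \<sigma> (v(i := z)) = R * E (v (\<sigma> (2 * k0 + 1))) z" for z
          unfolding T using here[of z] other[of "2 * k0 + 1" z] mk by simp
        then show ?thesis by (simp add: linear_add[OF E(1)] linear_cmul[OF E(1)] algebra_simps)
      qed
    qed
  qed
  have ws: "wedge_sum n \<alpha> E w = (\<Sum>\<sigma> | \<sigma> permutes {..2 * n}. T \<sigma> w)" for w
    unfolding wedge_sum_def T_def ..
  have "wedge_sum n \<alpha> E (v(i := v i + c *\<^sub>R v j)) = wedge_sum n \<alpha> E (v(i := v i)) + c * wedge_sum n \<alpha> E (v(i := v j))"
    unfolding ws using split[of _ "v i" "v j"] by (simp add: sum.distrib sum_distrib_left)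
  moreover have "wedge_sum n \<alpha> E (v(i := v j)) = 0"
    by (rule wedge_sum_repeated[OF ij]) (use ij in auto)
  ultimately show ?thesis by simp
qed

lemma wedge_sum_shears:
  fixes \<alpha> :: "'a::real_vector \<Rightarrow> real"
  assumes \<alpha>: "linear \<alpha>" and E: "\<And>x. linear (E x)" "\<And>y. linear (\<lambda>x. E x y)"
    and A: "finite A" "A \<subseteq> {..2 * n} - {j}" and j: "j \<le> 2 * n"
  shows "wedge_sum n \<alpha> E (\<lambda>i. if i \<in> A then v i + c i *\<^sub>R v j else v i) = wedge_sum n \<alpha> E v"
  using A
proof (induction A rule: finite_induct)
  case (insert i A)
  define w where "w = (\<lambda>i. if i \<in> A then v i + c i *\<^sub>R v j else v i)"
  have "(\<lambda>k. if k \<in> insert i A then v k + c k *\<^sub>R v j else v k) = w(i := w i + c i *\<^sub>R w j)"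
    using insert.hyps insert.prems unfolding w_def by (auto simp: fun_eq_iff)
  then show ?case
    using wedge_sum_shear[OF \<alpha> E, of i j n w "c i"] insert j unfolding w_def by simp
qed simp

lemma bij_std_frame: "bij_betw (std_frame :: nat \<Rightarrow> 'n::finite heis) {..2 * CARD('n)} Basis"
proof -
  have "card {..2 * CARD('n)} = card (Basis :: 'n heis set)" by simp
  then have "\<exists>b :: nat \<Rightarrow> 'n heis. bij_betw b {..2 * CARD('n)} Basis"
    by (intro finite_same_card_bij) auto
  then show ?thesis unfolding std_frame_def by (rule someI_ex)
qed

text \<open>Shearing the frame by multiples of \<open>\<partial>/\<partial>t\<close> makes all other frame vectors horizontal, so that
  \<open>df\<close> drops out of \<open>\<theta> \<and> (d\<theta>)\<^sup>n\<close>.\<close>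

lemma volume_form_conformal:
  "\<exists>C. \<forall>\<Omega> (\<theta> :: 'n::finite one_form) p f \<beta>. conformal_at \<Omega> \<theta> p f \<beta> \<longrightarrow>
     volume_form \<Omega> \<theta> p std_frame = C * f ^ (CARD('n) + 1)"
proof -
  define b where "b = (std_frame :: nat \<Rightarrow> 'n heis)"
  have "(0, 1) \<in> (Basis :: 'n heis set)" by (simp add: Basis_prod_def)
  then obtain j where j: "j \<le> 2 * CARD('n)" "b j = (0, 1)"
    using bij_std_frame[where 'n='n] unfolding b_def bij_betw_def by (metis atMost_iff imageE)
  \<comment> \<open>After the shear \<theta> vanishes on all frame vectors except the one with index
    \<open>j\<close>, so only permutations with \<sigma> 0 = j survive. In these \<theta>
    contributes one factor f and the n copies of its derivative one each.\<close>
  define C where "C = (\<Sum>\<sigma> | \<sigma> permutes {..2 * CARD('n)}. of_int (sign \<sigma>) * (if \<sigma> 0 = j then 1 else 0) *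
      (\<Prod>k<CARD('n). - 4 * (fst (b (\<sigma> (2 * k + 1))) \<bullet> vi (fst (b (\<sigma> (2 * k + 2)))))))"
  have "volume_form \<Omega> \<theta> p std_frame = C / 2 ^ CARD('n) * f ^ (CARD('n) + 1)"
    if c: "conformal_at \<Omega> \<theta> p f \<beta>" for \<Omega> and \<theta> :: "'n one_form" and p f \<beta>
  proof -
    have E: "ext_deriv \<Omega> \<theta> p v w =
        \<beta> v * std_theta p w - \<beta> w * std_theta p v - 4 * f * (fst v \<bullet> vi (fst w))" for v w
      using c unfolding conformal_at_def by blast
    have \<theta>: "blinfun_apply (\<theta> p) w = f * std_theta p w" for w
      using c unfolding conformal_at_def by blast
    have \<beta>: "linear \<beta>" using c unfolding conformal_at_def by blast
    note lin = linear_add[OF std_theta_linear] linear_cmul[OF std_theta_linear] linear_add[OF \<beta>] linear_cmul[OF \<beta>]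
    have E1: "linear (ext_deriv \<Omega> \<theta> p v)" for v
      by (rule linearI) (simp_all only: E lin fst_add fst_scaleR vi_simps inner_add_right
          inner_scaleR_right real_scaleR_def, simp_all add: algebra_simps)
    have E2: "linear (\<lambda>v. ext_deriv \<Omega> \<theta> p v w)" for w
      by (rule linearI) (simp_all only: E lin fst_add fst_scaleR inner_add_left
          inner_scaleR_left real_scaleR_def, simp_all add: algebra_simps)
    define V where "V i = (if i \<in> {..2 * CARD('n)} - {j} then b i + (- std_theta p (b i)) *\<^sub>R b j else b i)" for i
    have Vj: "V j = (0, 1)" unfolding V_def using j by simp
    have sV: "std_theta p (V i) = (if i = j then 1 else 0)" if "i \<le> 2 * CARD('n)" for i
      using that j(2) unfolding V_def by (simp add: lin)
    have fV: "fst (V i) = fst (b i)" for i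
      using j(2) unfolding V_def by simp
    have "wedge_sum (CARD('n)) (blinfun_apply (\<theta> p)) (ext_deriv \<Omega> \<theta> p) V =
        wedge_sum (CARD('n)) (blinfun_apply (\<theta> p)) (ext_deriv \<Omega> \<theta> p) b"
      unfolding V_def
      by (rule wedge_sum_shears[OF _ E1 E2 _ _ j(1)]) (auto intro: bounded_linear.linear blinfun.bounded_linear_right)
    moreover have "wedge_sum (CARD('n)) (blinfun_apply (\<theta> p)) (ext_deriv \<Omega> \<theta> p) V = f ^ (CARD('n) + 1) * C"
      unfolding wedge_sum_def C_def sum_distrib_left
    proof (rule sum.cong)
      fix \<sigma> assume "\<sigma> \<in> {\<sigma>. \<sigma> permutes {..2 * CARD('n)}}"
      then have \<sigma>: "\<sigma> permutes {..2 * CARD('n)}" by simp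
      have in\<sigma>: "\<sigma> l \<le> 2 * CARD('n)" if "l \<le> 2 * CARD('n)" for l
        using permutes_in_image[OF \<sigma>, of l] that by simp
      show "of_int (sign \<sigma>) * blinfun_apply (\<theta> p) (V (\<sigma> 0)) *
          (\<Prod>k<CARD('n). ext_deriv \<Omega> \<theta> p (V (\<sigma> (2 * k + 1))) (V (\<sigma> (2 * k + 2)))) =
        f ^ (CARD('n) + 1) * (of_int (sign \<sigma>) * (if \<sigma> 0 = j then 1 else 0) *
          (\<Prod>k<CARD('n). - 4 * (fst (b (\<sigma> (2 * k + 1))) \<bullet> vi (fst (b (\<sigma> (2 * k + 2)))))))"
      proof (cases "\<sigma> 0 = j")
        case True
        have ne: "\<sigma> l \<noteq> j" if "l \<noteq> 0" for l using True that permutes_inj[OF \<sigma>] by (metis injD)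
        have "(\<Prod>k<CARD('n). ext_deriv \<Omega> \<theta> p (V (\<sigma> (2 * k + 1))) (V (\<sigma> (2 * k + 2)))) =
          (\<Prod>k<CARD('n). f * (- 4 * (fst (b (\<sigma> (2 * k + 1))) \<bullet> vi (fst (b (\<sigma> (2 * k + 2)))))))"
        proof (rule prod.cong)
          fix k assume "k \<in> {..<CARD('n)}"
          then have "2 * k + 1 \<le> 2 * CARD('n)" "2 * k + 2 \<le> 2 * CARD('n)" by auto
          then show "ext_deriv \<Omega> \<theta> p (V (\<sigma> (2 * k + 1))) (V (\<sigma> (2 * k + 2))) =
             f * (- 4 * (fst (b (\<sigma> (2 * k + 1))) \<bullet> vi (fst (b (\<sigma> (2 * k + 2))))))"
            using sV[OF in\<sigma>] ne[of "2*k+1"] ne[of "2*k+2"] by (simp add: E fV)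
        qed simp
        then show ?thesis using True Vj sV[OF j(1)] by (simp only: \<theta> prod.distrib) simp
      next
        case False
        then show ?thesis using sV[OF in\<sigma>[of 0]] by (simp add: \<theta>)
      qed
    qed simp
    ultimately show ?thesis
      unfolding volume_form_def b_def[symmetric] wedge_sum_def by simp
  qed
  then show ?thesis by blast
qed

section \<open>Smooth cutoff functions\<close>

abbreviation smooth :: "('a::real_normed_vector \<Rightarrow> 'b::real_normed_vector) \<Rightarrow> bool" where
  "smooth f \<equiv> \<forall>k. Ck_on k UNIV f"

lemma Ck_on_SucI:
  assumes "\<And>x. (f has_derivative D x) (at x)" "\<And>v. Ck_on k UNIV (\<lambda>x. D x v)"
  shows "Ck_on (Suc k) UNIV f"
proof -
  have "frechet_derivative f (at x) = D x" for x
    using frechet_derivative_at[OF assms(1)] by simp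
  then show ?thesis using assms unfolding Ck_on.simps differentiable_def by auto
qed

lemma Ck_on_SucD:
  assumes "Ck_on (Suc k) UNIV f"
  shows "(f has_derivative frechet_derivative f (at x)) (at x)"
    "Ck_on k UNIV (\<lambda>x. frechet_derivative f (at x) v)"
  using assms by (auto simp: frechet_derivative_works)

lemma Ck_on_Suc_imp: "Ck_on (Suc k) UNIV f \<Longrightarrow> Ck_on k UNIV f"
proof (induction k arbitrary: f)
  case 0
  then show ?case
    by (auto simp: continuous_on_eq_continuous_at intro: differentiable_imp_continuous_within)
next
  case (Suc k)
  show ?case
    by (rule Ck_on_SucI[of f "\<lambda>x. frechet_derivative f (at x)"])
      (use Ck_on_SucD[OF Suc.prems] Suc.IH in blast)+
qed

lemma Ck_on_const: "Ck_on k UNIV (\<lambda>x. c)"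
proof (induction k arbitrary: c)
  case (Suc k)
  show ?case by (rule Ck_on_SucI[of _ "\<lambda>_ _. 0"]) (auto intro: Suc)
qed simp

lemma Ck_on_add: "Ck_on k UNIV f \<Longrightarrow> Ck_on k UNIV g \<Longrightarrow> Ck_on k UNIV (\<lambda>x. f x + g x)"
proof (induction k arbitrary: f g)
  case 0
  then show ?case by (auto intro: continuous_intros)
next
  case (Suc k)
  show ?case
    by (rule Ck_on_SucI[OF has_derivative_add[OF Ck_on_SucD(1)[OF Suc.prems(1)] Ck_on_SucD(1)[OF Suc.prems(2)]]])
      (rule Suc.IH[OF Ck_on_SucD(2)[OF Suc.prems(1)] Ck_on_SucD(2)[OF Suc.prems(2)]])
qed

lemma Ck_on_mult:
  fixes f g :: "'a::real_normed_vector \<Rightarrow> real"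
  shows "Ck_on k UNIV f \<Longrightarrow> Ck_on k UNIV g \<Longrightarrow> Ck_on k UNIV (\<lambda>x. f x * g x)"
proof (induction k arbitrary: f g)
  case 0
  then show ?case by (auto intro: continuous_intros)
next
  case (Suc k)
  show ?case
  proof (rule Ck_on_SucI[OF has_derivative_mult[OF Ck_on_SucD(1)[OF Suc.prems(1)] Ck_on_SucD(1)[OF Suc.prems(2)]]])
    fix v
    show "Ck_on k UNIV (\<lambda>x. f x * frechet_derivative g (at x) v + frechet_derivative f (at x) v * g x)"
      by (rule Ck_on_add[OF Suc.IH[OF Ck_on_Suc_imp[OF Suc.prems(1)] Ck_on_SucD(2)[OF Suc.prems(2)]]
            Suc.IH[OF Ck_on_SucD(2)[OF Suc.prems(1)] Ck_on_Suc_imp[OF Suc.prems(2)]]])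
  qed
qed

lemma Ck_on_linear:
  fixes f :: "'a::euclidean_space \<Rightarrow> real"
  assumes "linear f" shows "Ck_on k UNIV f"
proof (cases k)
  case 0
  then show ?thesis using assms by (simp add: linear_continuous_on linear_conv_bounded_linear)
next
  case (Suc k')
  show ?thesis
    unfolding Suc by (rule Ck_on_SucI[of f "\<lambda>_. f"]) (auto intro: Ck_on_const linear_imp_has_derivative assms)
qed

text \<open>Taking the whole sequence of derivatives of the outer function keeps the induction
  inside one family: differentiation only replaces j by its successor and multiplies by a smooth
  factor.\<close>

lemma Ck_on_compose:
  assumes h: "\<And>j x. (h j has_real_derivative h (Suc j) x) (at x)" and P: "smooth P"
  shows "Ck_on k UNIV (\<lambda>x. h j (P x))"
proof (induction k arbitrary: j)
  case 0
  have "continuous_on UNIV (h j)" using h by (intro DERIV_continuous_on) (auto intro: DERIV_subset)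
  moreover have "continuous_on UNIV P" using P[rule_format, of 0] by simp
  ultimately show ?case by (auto intro: continuous_on_compose2)
next
  case (Suc k)
  have D: "(P has_derivative frechet_derivative P (at x)) (at x)" for x
    by (rule Ck_on_SucD(1)[OF P[rule_format, of "Suc 0"]])
  show ?case
  proof (rule Ck_on_SucI[of _ "\<lambda>x v. frechet_derivative P (at x) v * h (Suc j) (P x)"])
    show "((\<lambda>x. h j (P x)) has_derivative (\<lambda>v. frechet_derivative P (at x) v * h (Suc j) (P x))) (at x)" for x
      using has_derivative_compose[OF D, of "h j" "(*) (h (Suc j) (P x))" x] h[of j "P x"]
      unfolding has_field_derivative_def by (simp add: mult.commute)
    show "Ck_on k UNIV (\<lambda>x. frechet_derivative P (at x) v * h (Suc j) (P x))" for v
      by (rule Ck_on_mult[OF Ck_on_SucD(2)[OF P[rule_format]] Suc.IH])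
  qed
qed

section \<open>The bump function and its derivatives\<close>

lemma tendsto_poly_exp: "((\<lambda>y. poly Q y * exp (- y)) \<longlongrightarrow> (0::real)) at_top"
proof -
  have "((\<lambda>y. \<Sum>i\<le>degree Q. coeff Q i * (y ^ i / exp y)) \<longlongrightarrow> (\<Sum>i\<le>degree Q. coeff Q i * 0)) at_top"
    by (intro tendsto_intros tendsto_power_div_exp_0)
  then show ?thesis
    by (simp add: poly_altdef exp_minus sum_distrib_right divide_inverse mult.assoc)
qed

text \<open>A class closed under differentiation: with y = 1/x, the derivative replaces P by y^2 (P
  - P').\<close>

definition poly_bump :: "real poly \<Rightarrow> real \<Rightarrow> real" where
  "poly_bump P x = (if 0 < x then poly P (1 / x) * exp (- (1 / x)) else 0)"

lemma poly_bump_deriv: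
  "(poly_bump P has_real_derivative poly_bump ([:0, 0, 1:] * (P - pderiv P)) x) (at x)"
proof -
  consider "0 < x" | "x < 0" | "x = 0" by linarith
  then show ?thesis
  proof cases
    case 1
    have "((\<lambda>x. poly P (1 / x) * exp (- (1 / x))) has_real_derivative
        poly ([:0, 0, 1:] * (P - pderiv P)) (1 / x) * exp (- (1 / x))) (at x)"
      using 1 by (auto intro!: derivative_eq_intros simp: field_simps power2_eq_square)
    then have "((\<lambda>x. poly P (1 / x) * exp (- (1 / x))) has_real_derivative
        poly_bump ([:0, 0, 1:] * (P - pderiv P)) x) (at x)"
      using 1 unfolding poly_bump_def by simp
    then show ?thesis
      by (rule has_field_derivative_transform_within_open[of _ _ _ "{0<..}"])
        (use 1 in \<open>auto simp: poly_bump_def\<close>)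
  next
    case 2
    have "((\<lambda>x. 0) has_real_derivative poly_bump ([:0, 0, 1:] * (P - pderiv P)) x) (at x)"
      using 2 by (simp add: poly_bump_def)
    then show ?thesis
      by (rule has_field_derivative_transform_within_open[of _ _ _ "{..<0}"])
        (use 2 in \<open>auto simp: poly_bump_def\<close>)
  next
    case 3
    \<comment> \<open>With h = 1/y the difference quotient at 0 becomes y P(y) exp(-y), which tends
      to 0 at infinity.\<close>
    have "((\<lambda>h. poly_bump P h / h) \<longlongrightarrow> 0) (at_right 0)"
      unfolding filterlim_at_right_to_top
    proof (rule Lim_transform_eventually[OF tendsto_poly_exp[of "[:0, 1:] * P"]])
      show "eventually (\<lambda>y. poly ([:0, 1:] * P) y * exp (- y) = poly_bump P (inverse y) / inverse y) at_top"
        using eventually_gt_at_top[of 0]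
        by eventually_elim (simp add: poly_bump_def divide_inverse)
    qed
    moreover have "((\<lambda>h. poly_bump P h / h) \<longlongrightarrow> 0) (at_left 0)"
      by (rule tendsto_eventually) (auto simp: eventually_at_filter poly_bump_def)
    ultimately have "((\<lambda>h. poly_bump P h / h) \<longlongrightarrow> 0) (at 0)"
      by (rule filterlim_split_at[rotated])
    then show ?thesis using 3 by (simp add: has_field_derivative_iff poly_bump_def)
  qed
qed

definition bump :: "real \<Rightarrow> real" where
  "bump x = (if 0 < x then exp (- (1 / x)) else 0)"

definition bump' :: "real \<Rightarrow> real" where
  "bump' x = (if 0 < x then (1 / x)\<^sup>2 * exp (- (1 / x)) else 0)"

lemma bump_deriv: "(bump has_real_derivative bump' x) (at x)"
proof -
  have "bump = poly_bump 1" by (auto simp: fun_eq_iff bump_def poly_bump_def)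
  moreover have "bump' x = poly_bump ([:0, 0, 1:] * (1 - pderiv 1)) x"
    by (auto simp: bump'_def poly_bump_def power2_eq_square)
  ultimately show ?thesis using poly_bump_deriv[of 1 x] by simp
qed

lemma smooth_bump_compose:
  assumes "smooth P" shows "smooth (\<lambda>x. bump (P x))"
proof
  fix k
  define h where "h j = poly_bump (((\<lambda>P. [:0, 0, 1:] * (P - pderiv P)) ^^ j) 1)" for j
  have "(h j has_real_derivative h (Suc j) x) (at x)" for j x
    unfolding h_def using poly_bump_deriv by simp
  then have "Ck_on k UNIV (\<lambda>x. h 0 (P x))" by (rule Ck_on_compose[OF _ assms])
  moreover have "h 0 = bump" by (auto simp: fun_eq_iff h_def poly_bump_def bump_def)
  ultimately show "Ck_on k UNIV (\<lambda>x. bump (P x))" by simp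
qed

lemma bump_bounds: "0 \<le> bump x" "bump x \<le> 1" "\<bar>bump' x\<bar> \<le> 2"
proof -
  show "0 \<le> bump x" "bump x \<le> 1" by (auto simp: bump_def)
  show "\<bar>bump' x\<bar> \<le> 2"
  proof (cases "0 < x")
    case True
    define y where "y = 1 / x"
    have y: "0 < y" using True by (simp add: y_def)
    have "y\<^sup>2 \<le> 2 * exp y" using exp_lower_Taylor_quadratic[of y] y by simp
    then have "y\<^sup>2 * exp (- y) \<le> 2" by (simp add: exp_minus field_simps)
    then show ?thesis using True by (simp add: bump'_def y_def abs_mult)
  qed (simp add: bump'_def)
qed

lemma bump_mono: "x \<le> y \<Longrightarrow> bump x \<le> bump y"
  by (auto simp: bump_def frac_le)

lemma bump_nonpos: "x \<le> 0 \<Longrightarrow> bump x = 0" "x \<le> 0 \<Longrightarrow> bump' x = 0"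
  by (auto simp: bump_def bump'_def)

lemma bump_pos: "0 < x \<Longrightarrow> 0 < bump x"
  by (auto simp: bump_def)

section \<open>The gauge along the Levi distribution\<close>

lemma smooth_gauge4: "smooth (gauge4 p)" for p :: "'n::finite heis"
proof
  fix k
  define S where "S q = horiz p q \<bullet> horiz p q" for q :: "'n heis"
  have S: "Ck_on k UNIV S" for k
  proof (cases k)
    case 0
    then show ?thesis unfolding S_def by (simp add: continuous_intros)
  next
    case (Suc k')
    have "(S has_derivative (\<lambda>v. 2 * (horiz p q \<bullet> fst v))) (at q)" for q
      unfolding S_def horiz_def
      by (rule derivative_eq_intros | simp add: inner_commute)+
    moreover have "Ck_on k' UNIV (\<lambda>q. 2 * (horiz p q \<bullet> fst v))" for v
    proof -
      have "linear (\<lambda>q. 2 * (fst q \<bullet> fst v))"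
        by (rule linearI) (simp_all add: inner_add_left algebra_simps)
      from Ck_on_add[OF Ck_on_linear[OF this] Ck_on_const[of k' "- 2 * (fst p \<bullet> fst v)"]]
      show ?thesis by (simp add: horiz_def inner_diff_left algebra_simps)
    qed
    ultimately show ?thesis unfolding Suc by (rule Ck_on_SucI)
  qed
  have "linear (\<lambda>q :: 'n heis. snd q - 2 * (fst p \<bullet> vi (fst q)))"
    by (rule linearI) (simp_all add: inner_add_right algebra_simps)
  from Ck_on_add[OF Ck_on_linear[OF this] Ck_on_const[of _ "- snd p"]]
  have "Ck_on k UNIV (\<lambda>q. snd q - 2 * (fst p \<bullet> vi (fst q)) + - snd p)" for k .
  moreover have "vert p = (\<lambda>q. snd q - 2 * (fst p \<bullet> vi (fst q)) + - snd p)"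
    by (simp add: vert_def fun_eq_iff)
  ultimately have "Ck_on k UNIV (vert p)" for k by simp
  then show "Ck_on k UNIV (gauge4 p)"
    unfolding gauge4_def power2_eq_square S_def[symmetric] by (intro Ck_on_add Ck_on_mult S)
qed

definition gauge4_deriv :: "'n::finite heis \<Rightarrow> 'n heis \<Rightarrow> 'n heis \<Rightarrow> real" where
  "gauge4_deriv p q v = 4 * (horiz p q \<bullet> horiz p q) * (horiz p q \<bullet> fst v) +
     2 * vert p q * (snd v - 2 * (fst p \<bullet> vi (fst v)))"

lemma has_derivative_gauge4: "(gauge4 p has_derivative gauge4_deriv p q) (at q)"
proof -
  have vi: "((\<lambda>q. fst p \<bullet> vi (fst q)) has_derivative (\<lambda>v. fst p \<bullet> vi (fst v))) (at q)"
    by (intro linear_imp_has_derivative linearI) (simp_all add: inner_add_right)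
  have "(vert p has_derivative (\<lambda>v. snd v - 2 * (fst p \<bullet> vi (fst v)))) (at q)"
    unfolding vert_def by (rule derivative_eq_intros vi refl | simp)+
  note V = this
  have S: "((\<lambda>q. horiz p q \<bullet> horiz p q) has_derivative (\<lambda>v. 2 * (horiz p q \<bullet> fst v))) (at q)"
    unfolding horiz_def by (rule derivative_eq_intros | simp add: inner_commute)+
  show ?thesis
    unfolding gauge4_def power2_eq_square
    by (rule has_derivative_eq_rhs[OF has_derivative_add[OF has_derivative_mult[OF S S] has_derivative_mult[OF V V]]])
      (simp add: fun_eq_iff gauge4_deriv_def algebra_simps)
qed

text \<open>Along the Levi distribution the derivative is 4 times the real part of (|z|^2 + i t)
  times the conjugate of a Hermitian product with y. The bound expresses that the gauge has
  horizontal slope at most 1. The lift is taken at \<open>q\<close>, which turns the twist relative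
  to \<open>p\<close> into \<open>horiz p q \<bullet> vi y\<close>.\<close>

lemma gauge4_deriv_hlift:
  "\<bar>gauge4_deriv p q (hlift q y)\<bar> \<le> 4 * koranyi p q ^ 3 * norm y"
proof -
  define a b where "a = horiz p q \<bullet> horiz p q" and "b = vert p q"
  define A B where "A = horiz p q \<bullet> y" and "B = horiz p q \<bullet> vi y"
  have "gauge4_deriv p q (hlift q y) = 4 * (a * A + b * B)"
    unfolding gauge4_deriv_def a_def b_def A_def B_def
    by (simp add: hlift_def horiz_def inner_diff_left algebra_simps)
  moreover have "\<bar>a * A + b * B\<bar> \<le> koranyi p q ^ 3 * norm y"
  proof -
    have "a * A + b * B = Re (Complex a b * cnj (Complex A B))" by simp
    then have "\<bar>a * A + b * B\<bar> \<le> norm (Complex a b) * norm (Complex A B)"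
      using abs_Re_le_cmod[of "Complex a b * cnj (Complex A B)"] by (simp only: norm_mult complex_mod_cnj)
    also have "norm (Complex a b) = (koranyi p q)\<^sup>2" unfolding a_def b_def koranyi_sq ..
    also have "(koranyi p q)\<^sup>2 * norm (Complex A B) \<le> (koranyi p q)\<^sup>2 * (koranyi p q * norm y)"
      unfolding A_def B_def
      by (intro mult_left_mono order_trans[OF norm_Complex_inner_le mult_right_mono[OF norm_horiz_le]]) simp_all
    finally show ?thesis by (simp add: power3_eq_cube power2_eq_square mult.assoc)
  qed
  ultimately show ?thesis by simp
qed

text \<open>The inner cutoff \<open>bump (1/e - bump (2 - x))\<close> vanishes for \<open>x \<le> 1\<close> and is constant for \<open>x \<ge> 2\<close>;
  this replaces a quotient of bump functions.\<close>

definition outer_cut :: "'n::finite heis \<Rightarrow> real \<Rightarrow> 'n heis \<Rightarrow> real" where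
  "outer_cut p t q = bump (2 - gauge4 p q / t ^ 4)"

definition inner_cut :: "'n::finite heis \<Rightarrow> real \<Rightarrow> 'n heis \<Rightarrow> real" where
  "inner_cut p s q = bump (bump 1 - bump (2 - 2 / s ^ 4 * gauge4 p q))"

lemma smooth_outer_cut: "smooth (outer_cut p t)"
proof -
  have "smooth (\<lambda>q. 2 + (- 1 / t ^ 4) * gauge4 p q)"
    by (intro allI Ck_on_add Ck_on_mult Ck_on_const smooth_gauge4[rule_format])
  from smooth_bump_compose[OF this] show ?thesis unfolding outer_cut_def by simp
qed

lemma smooth_inner_cut: "smooth (inner_cut p s)"
proof -
  have "smooth (\<lambda>q. 2 + (- 2 / s ^ 4) * gauge4 p q)"
    by (intro allI Ck_on_add Ck_on_mult Ck_on_const smooth_gauge4[rule_format])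
  note 1 = smooth_bump_compose[OF this]
  have "smooth (\<lambda>q. bump 1 + (- 1) * bump (2 + (- 2 / s ^ 4) * gauge4 p q))"
    by (intro allI Ck_on_add Ck_on_mult Ck_on_const 1[rule_format])
  from smooth_bump_compose[OF this] show ?thesis unfolding inner_cut_def by simp
qed

definition outer_deriv :: "'n::finite heis \<Rightarrow> real \<Rightarrow> 'n heis \<Rightarrow> 'n heis \<Rightarrow> real" where
  "outer_deriv p t q v = bump' (2 - gauge4 p q / t ^ 4) * (- (gauge4_deriv p q v / t ^ 4))"

definition inner_deriv :: "'n::finite heis \<Rightarrow> real \<Rightarrow> 'n heis \<Rightarrow> 'n heis \<Rightarrow> real" where
  "inner_deriv p s q v = bump' (bump 1 - bump (2 - 2 / s ^ 4 * gauge4 p q)) *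
     (bump' (2 - 2 / s ^ 4 * gauge4 p q) * (2 / s ^ 4 * gauge4_deriv p q v))"

lemma bump_chain:
  assumes "(P has_derivative D) (at q)"
  shows "((\<lambda>q. bump (P q)) has_derivative (\<lambda>v. bump' (P q) * D v)) (at q)"
  using has_derivative_compose[OF assms, of bump "(*) (bump' (P q))"] bump_deriv
  unfolding has_field_derivative_def by blast

lemma has_derivative_outer_cut: "(outer_cut p t has_derivative outer_deriv p t q) (at q)"
  unfolding outer_cut_def outer_deriv_def
proof (rule bump_chain)
  show "((\<lambda>q. 2 - gauge4 p q / t ^ 4) has_derivative (\<lambda>v. - (gauge4_deriv p q v / t ^ 4))) (at q)"
    by (rule has_derivative_eq_rhs[OF has_derivative_diff[OF has_derivative_const
          bounded_linear.has_derivative[OF bounded_linear_divide has_derivative_gauge4]]]) simp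
qed

lemma has_derivative_inner_cut: "(inner_cut p s has_derivative inner_deriv p s q) (at q)"
proof -
  have "((\<lambda>q. 2 - 2 / s ^ 4 * gauge4 p q) has_derivative (\<lambda>v. - (2 / s ^ 4 * gauge4_deriv p q v))) (at q)"
    by (rule has_derivative_eq_rhs[OF has_derivative_diff[OF has_derivative_const
          has_derivative_mult_right[OF has_derivative_gauge4]]]) simp
  from bump_chain[OF this]
  have "((\<lambda>q. bump 1 - bump (2 - 2 / s ^ 4 * gauge4 p q)) has_derivative
     (\<lambda>v. bump' (2 - 2 / s ^ 4 * gauge4 p q) * (2 / s ^ 4 * gauge4_deriv p q v))) (at q)"
    by (rule has_derivative_eq_rhs[OF has_derivative_diff[OF has_derivative_const]]) simp
  from bump_chain[OF this] show ?thesis unfolding inner_cut_def inner_deriv_def .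
qed

lemma outer_cut_bounds: "0 \<le> outer_cut p t q" "outer_cut p t q \<le> 1"
  unfolding outer_cut_def by (rule bump_bounds)+

lemma inner_cut_bounds: "0 \<le> inner_cut p s q" "inner_cut p s q \<le> 1"
  unfolding inner_cut_def by (rule bump_bounds)+

lemma outer_cut_ge:
  assumes "0 < t" "koranyi p q \<le> t" shows "bump 1 \<le> outer_cut p t q"
  unfolding outer_cut_def
  by (rule bump_mono) (use assms koranyi_le_iff[of t p q] in \<open>simp add: field_simps\<close>)

lemma outer_cut_zero:
  assumes "0 < t" "2 * t \<le> koranyi p q" shows "outer_cut p t q = 0" "outer_deriv p t q v = 0"
proof -
  have "(2 * t) ^ 4 \<le> gauge4 p q"
    unfolding koranyi_pow4[symmetric] using assms by (intro power_mono) auto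
  then have "16 * t ^ 4 \<le> gauge4 p q" by (simp add: power_mult_distrib)
  then have "2 * t ^ 4 \<le> gauge4 p q" using zero_less_power[OF assms(1), of 4] by linarith
  then have "2 - gauge4 p q / t ^ 4 \<le> 0" using assms(1) by (simp add: field_simps)
  then show "outer_cut p t q = 0" "outer_deriv p t q v = 0"
    unfolding outer_cut_def outer_deriv_def by (simp_all add: bump_nonpos)
qed

lemma inner_cut_eq:
  assumes "0 < s" "s \<le> koranyi p q" shows "inner_cut p s q = bump (bump 1)" "inner_deriv p s q v = 0"
proof -
  have "s ^ 4 \<le> gauge4 p q"
    unfolding koranyi_pow4[symmetric] using assms by (intro power_mono) auto
  then have "2 - 2 / s ^ 4 * gauge4 p q \<le> 0" using assms(1) by (simp add: field_simps)
  then show "inner_cut p s q = bump (bump 1)" "inner_deriv p s q v = 0"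
    unfolding inner_cut_def inner_deriv_def by (simp_all add: bump_nonpos)
qed

lemma inner_cut_zero:
  assumes "0 < s" "2 * koranyi p q \<le> s" shows "inner_cut p s q = 0" "inner_deriv p s q v = 0"
proof -
  have "gauge4 p q \<le> (s / 2) ^ 4" using koranyi_le_iff[of "s/2" p q] assms by simp
  then have "gauge4 p q \<le> s ^ 4 / 16" by (simp add: power_divide)
  then have "2 * gauge4 p q \<le> s ^ 4" using zero_less_power[OF assms(1), of 4] by linarith
  then have "1 \<le> 2 - 2 / s ^ 4 * gauge4 p q" using assms(1) by (simp add: field_simps)
  then have "bump 1 - bump (2 - 2 / s ^ 4 * gauge4 p q) \<le> 0" using bump_mono by simp
  then show "inner_cut p s q = 0" "inner_deriv p s q v = 0"
    unfolding inner_cut_def inner_deriv_def by (simp_all add: bump_nonpos)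
qed

lemma outer_deriv_le:
  assumes t: "0 < t"
  shows "\<bar>outer_deriv p t q (hlift q y)\<bar> \<le> (if koranyi p q < 2 * t then 64 / t else 0) * norm y"
proof (cases "koranyi p q < 2 * t")
  case True
  have "\<bar>gauge4_deriv p q (hlift q y)\<bar> \<le> 4 * (2 * t) ^ 3 * norm y"
    by (rule order_trans[OF gauge4_deriv_hlift])
      (use True koranyi_nonneg in \<open>intro mult_right_mono mult_left_mono power_mono; simp add: less_imp_le\<close>)
  then have "\<bar>gauge4_deriv p q (hlift q y)\<bar> / t ^ 4 \<le> 4 * (2 * t) ^ 3 * norm y / t ^ 4"
    using t by (intro divide_right_mono) auto
  also have "\<dots> = 32 / t * norm y" using t by (simp add: field_simps power3_eq_cube power4_eq_xxxx)
  finally have "\<bar>outer_deriv p t q (hlift q y)\<bar> \<le> 2 * (32 / t * norm y)"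
    unfolding outer_deriv_def abs_mult using t bump_bounds(3) by (intro mult_mono) auto
  then show ?thesis using True by simp
next
  case False
  then show ?thesis using outer_cut_zero(2)[OF t, of p q] by simp
qed

lemma inner_deriv_le:
  assumes s: "0 < s"
  shows "\<bar>inner_deriv p s q (hlift q y)\<bar> \<le> (if koranyi p q < s then 32 / s else 0) * norm y"
proof (cases "koranyi p q < s")
  case True
  have "\<bar>gauge4_deriv p q (hlift q y)\<bar> \<le> 4 * s ^ 3 * norm y"
    by (rule order_trans[OF gauge4_deriv_hlift])
      (use True koranyi_nonneg in \<open>intro mult_right_mono mult_left_mono power_mono; simp add: less_imp_le\<close>)
  then have "\<bar>2 / s ^ 4 * gauge4_deriv p q (hlift q y)\<bar> \<le> 2 / s ^ 4 * (4 * s ^ 3 * norm y)"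
    unfolding abs_mult using s by (intro mult_mono) auto
  also have "\<dots> = 8 / s * norm y" using s by (simp add: field_simps power3_eq_cube power4_eq_xxxx)
  finally have "\<bar>inner_deriv p s q (hlift q y)\<bar> \<le> 2 * (2 * (8 / s * norm y))"
    unfolding inner_deriv_def abs_mult[of "bump' _"] using s bump_bounds(3) by (intro mult_mono) auto
  then show ?thesis using True by simp
next
  case False
  then show ?thesis using inner_cut_eq(2)[OF s, of p q] by simp
qed

definition annulus_const :: real where
  "annulus_const = bump 1 * bump (bump 1)"

definition doubled_annulus :: "'n::finite heis \<Rightarrow> real \<Rightarrow> real \<Rightarrow> 'n heis set" where
  "doubled_annulus p s t = {q. s \<le> 2 * koranyi p q \<and> koranyi p q < 2 * t}"

text \<open>Bounds the horizontal derivative of a product of cutoffs. From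
  \<open>\<bar>bump' x\<bar> \<le> 2\<close> and the derivative 4 r^3 of the fourth power, 64 is 2 *
  4 * 2^3 at radius 2t, and 32 is 2 * 2 * 2 * 4, with two bump functions and the coefficient 2
  inside. The case s = 0 is a ball and has no inner cutoff.\<close>

definition slope :: "'n::finite heis \<Rightarrow> real \<Rightarrow> real \<Rightarrow> 'n heis \<Rightarrow> real" where
  "slope p s t q = (if q \<in> doubled_annulus p s t then
     64 / t + (if 0 < s \<and> koranyi p q < s then 32 / s else 0) else 0)"

lemma annulus_const_pos: "0 < annulus_const"
  unfolding annulus_const_def by (intro mult_pos_pos bump_pos) simp_all

definition annulus_test ::
  "'n::finite heis \<Rightarrow> real \<Rightarrow> real \<Rightarrow> ('n heis \<Rightarrow> real) \<Rightarrow> ('n heis \<Rightarrow> 'n heis \<Rightarrow> real) \<Rightarrow> bool" where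
  "annulus_test p s t u D \<longleftrightarrow> smooth u \<and> (\<forall>q. (u has_derivative D q) (at q)) \<and>
     (\<forall>q. s \<le> koranyi p q \<longrightarrow> koranyi p q \<le> t \<longrightarrow> annulus_const \<le> u q) \<and>
     (\<forall>q. q \<notin> doubled_annulus p s t \<longrightarrow> u q = 0) \<and>
     (\<forall>q y. \<bar>D q (hlift q y)\<bar> \<le> slope p s t q * norm y)"

lemma annulus_test_exists:
  fixes p :: "'n::finite heis"
  assumes st: "0 \<le> s" "s \<le> t" "0 < t"
  shows "\<exists>u D. annulus_test p s t u D"
proof (cases "s = 0")
  case True
  have "annulus_const \<le> bump 1 * 1"
    unfolding annulus_const_def by (intro mult_left_mono bump_bounds)
  then have "annulus_const \<le> outer_cut p t q" if "koranyi p q \<le> t" for q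
    using outer_cut_ge[OF st(3) that] by simp
  moreover have "outer_cut p t q = 0" if "q \<notin> doubled_annulus p s t" for q
    using that outer_cut_zero(1)[OF st(3), of p q] koranyi_nonneg[of p q] True unfolding doubled_annulus_def by auto
  moreover have "\<bar>outer_deriv p t q (hlift q y)\<bar> \<le> slope p s t q * norm y" for q y
    using outer_deriv_le[OF st(3), of p q y] koranyi_nonneg[of p q] True
    unfolding slope_def doubled_annulus_def by (cases "koranyi p q < 2 * t") auto
  ultimately show ?thesis
    unfolding annulus_test_def using smooth_outer_cut[of p t] has_derivative_outer_cut[of p t] by blast
next
  case False
  then have s: "0 < s" using st by simp
  define u where "u q = outer_cut p t q * inner_cut p s q" for q
  define D where "D q v = outer_cut p t q * inner_deriv p s q v + outer_deriv p t q v * inner_cut p s q" for q v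
  have sm: "smooth u" unfolding u_def
    by (intro allI Ck_on_mult smooth_outer_cut[rule_format] smooth_inner_cut[rule_format])
  have "(u has_derivative D q) (at q)" for q
    unfolding u_def D_def by (rule has_derivative_mult[OF has_derivative_outer_cut has_derivative_inner_cut])
  moreover have "annulus_const \<le> u q" if "s \<le> koranyi p q" "koranyi p q \<le> t" for q
    unfolding u_def annulus_const_def inner_cut_eq(1)[OF s that(1)]
    by (intro mult_right_mono outer_cut_ge[OF st(3) that(2)] bump_bounds)
  moreover have zero: "u q = 0 \<and> D q v = 0" if "q \<notin> doubled_annulus p s t" for q v
  proof -
    have "2 * koranyi p q \<le> s \<or> 2 * t \<le> koranyi p q" using that unfolding doubled_annulus_def by auto
    then show ?thesis
      using outer_cut_zero[OF st(3), of p q] inner_cut_zero[OF s, of p q] unfolding u_def D_def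
      by (elim disjE) simp_all
  qed
  moreover have "\<bar>D q (hlift q y)\<bar> \<le> slope p s t q * norm y" for q y
  proof (cases "q \<in> doubled_annulus p s t")
    case True
    have "\<bar>D q (hlift q y)\<bar> \<le> \<bar>outer_cut p t q * inner_deriv p s q (hlift q y)\<bar> + \<bar>outer_deriv p t q (hlift q y) * inner_cut p s q\<bar>"
      unfolding D_def by (rule abs_triangle_ineq)
    also have "\<dots> \<le> 1 * \<bar>inner_deriv p s q (hlift q y)\<bar> + \<bar>outer_deriv p t q (hlift q y)\<bar> * 1"
      unfolding abs_mult using outer_cut_bounds[of p t q] inner_cut_bounds[of p s q]
      by (intro add_mono mult_left_mono mult_right_mono) auto
    also have "\<dots> \<le> (if koranyi p q < s then 32 / s else 0) * norm y + (if koranyi p q < 2 * t then 64 / t else 0) * norm y"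
      using inner_deriv_le[OF s, of p q y] outer_deriv_le[OF st(3), of p q y] by simp
    also have "\<dots> = slope p s t q * norm y"
      using True s unfolding slope_def doubled_annulus_def by (simp add: algebra_simps)
    finally show ?thesis .
  qed (use zero in \<open>simp add: slope_def\<close>)
  ultimately show ?thesis unfolding annulus_test_def using sm by blast
qed

section \<open>The volume measure\<close>

lemma smooth_on_open_differentiable_on:
  assumes "open S" "smooth_on S f" shows "f differentiable_on S"
  unfolding differentiable_on_def
proof
  fix x assume "x \<in> S"
  then have "x \<in> interior S" using assms(1) by (simp add: interior_open)
  then have "f differentiable (at x)" by (rule smooth_on_differentiable[OF assms(2)])
  then show "f differentiable (at x within S)" by (rule differentiable_at_withinI)
qed

text \<open>A point that a chart sends to the open half-space is interior, so locally the boundary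
  is contained in the image of a hyperplane piece under the inverse chart, which is differentiable
  and preserves null sets.\<close>

lemma smooth_domain_boundary_negligible:
  fixes M :: "'a::euclidean_space set"
  assumes "smooth_domain M"
  shows "negligible (M - interior M)"
proof (rule locally_negligible_alt[THEN iffD2], rule ballI)
  fix p assume p: "p \<in> M - interior M"
  obtain U V and \<phi> :: "'a \<Rightarrow> 'a" and \<psi> b where b: "b \<in> Basis" and U: "open U" "open V" "p \<in> U"
    and hom: "homeomorphism U V \<phi> \<psi>" and \<psi>: "smooth_on V \<psi>"
    and im: "\<phi> ` (M \<inter> U) = V \<inter> {y. 0 \<le> y \<bullet> b}"
    using bspec[OF assms[unfolded smooth_domain_def], of p] p by (elim DiffE bexE exE conjE) auto
  have inv: "\<psi> (\<phi> x) = x" "\<phi> x \<in> V" if "x \<in> U" for x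
    using hom that unfolding homeomorphism_def by auto
  have sub: "(M - interior M) \<inter> U \<subseteq> \<psi> ` (V \<inter> {y. b \<bullet> y = 0})"
  proof
    fix q assume q: "q \<in> (M - interior M) \<inter> U"
    have "\<phi> q \<in> V \<inter> {y. 0 \<le> y \<bullet> b}" using q im by blast
    moreover have "\<not> 0 < \<phi> q \<bullet> b"
    proof
      assume pos: "0 < \<phi> q \<bullet> b"
      define W where "W = U \<inter> \<phi> -` {y. 0 < y \<bullet> b}"
      have "open W" unfolding W_def
      proof (rule continuous_open_preimage)
        show "continuous_on U \<phi>" using hom unfolding homeomorphism_def by blast
        show "open {y. 0 < y \<bullet> b}" by (intro open_Collect_less continuous_intros)
      qed (rule U)
      moreover have "q \<in> W" using q pos unfolding W_def by auto
      moreover have "W \<subseteq> M"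
      proof
        fix x assume x: "x \<in> W"
        then have "\<phi> x \<in> V \<inter> {y. 0 \<le> y \<bullet> b}" using inv unfolding W_def by auto
        then obtain x' where x': "x' \<in> M \<inter> U" "\<phi> x = \<phi> x'" unfolding im[symmetric] by blast
        then have "x = x'" using inv(1)[of x] inv(1)[of x'] x unfolding W_def by auto
        then show "x \<in> M" using x' by auto
      qed
      ultimately have "q \<in> interior M" by (rule interiorI)
      then show False using q by auto
    qed
    ultimately have "\<phi> q \<in> V \<inter> {y. b \<bullet> y = 0}" by (auto simp: inner_commute)
    then show "q \<in> \<psi> ` (V \<inter> {y. b \<bullet> y = 0})" using inv(1)[of q] q by (metis IntD2 imageI)
  qed
  have "b \<noteq> 0" using b by auto
  then have "negligible (V \<inter> {y. b \<bullet> y = 0})" by (intro negligible_Int negligible_hyperplane disjI1 disjI2)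
  moreover have "\<psi> differentiable_on V \<inter> {y. b \<bullet> y = 0}"
    using smooth_on_open_differentiable_on[OF U(2) \<psi>] by (rule differentiable_on_subset) auto
  ultimately have "negligible (\<psi> ` (V \<inter> {y. b \<bullet> y = 0}))"
    by (intro negligible_differentiable_image_negligible) auto
  then have "negligible ((M - interior M) \<inter> U)" using sub by (rule negligible_subset)
  moreover have "openin (top_of_set (M - interior M)) ((M - interior M) \<inter> U)" using U(1) by (rule openin_open_Int)
  ultimately show "\<exists>N. openin (top_of_set (M - interior M)) N \<and> p \<in> N \<and> negligible N"
    using p U(3) by blast
qed

lemma AE_interior:
  assumes "compact \<Omega>" "smooth_domain \<Omega>"
  shows "AE p in lebesgue_on \<Omega>. p \<in> interior \<Omega>"
proof -
  have "\<Omega> \<in> sets lebesgue" using assms(1) by (simp add: borel_compact)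
  moreover have "\<Omega> - interior \<Omega> \<in> null_sets lebesgue"
    using smooth_domain_boundary_negligible[OF assms(2)] by (simp add: negligible_iff_null_sets)
  then have "AE p in lebesgue. p \<in> \<Omega> \<longrightarrow> p \<in> interior \<Omega>"
    by (rule AE_I') auto
  ultimately show ?thesis by (simp add: AE_restrict_space_iff)
qed

lemma density_cong_AE: "(AE x in M. f x = g x) \<Longrightarrow> density M f = density M g"
  unfolding density_def by (auto intro!: measure_of_eq nn_integral_cong_AE sets.space_closed)

text \<open>Almost every point is interior, where the conformal formula applies. The resulting
  density is continuous on \<Omega>, hence measurable and bounded, and \<open>c\<close> is fixed
  before \<Omega> and \<theta>.\<close>

lemma vol_measure_eq_density:
  "\<exists>c\<ge>0. \<forall>\<Omega> (\<theta> :: 'n::finite one_form). compact_subdomain \<Omega> \<longrightarrow> pseudo_hermitian \<Omega> \<theta> \<longrightarrow>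
     vol_measure \<Omega> \<theta> =
       density (lebesgue_on \<Omega>) (\<lambda>p. ennreal (c * \<bar>blinfun_apply (\<theta> p) (0, 1)\<bar> ^ (CARD('n) + 1)))"
proof -
  obtain C where C: "\<And>\<Omega> (\<theta> :: 'n one_form) p f \<beta>. conformal_at \<Omega> \<theta> p f \<beta> \<Longrightarrow>
     volume_form \<Omega> \<theta> p std_frame = C * f ^ (CARD('n) + 1)"
    using volume_form_conformal[where 'n='n] by blast
  have "vol_measure \<Omega> \<theta> =
       density (lebesgue_on \<Omega>) (\<lambda>p. ennreal (\<bar>C\<bar> * \<bar>blinfun_apply (\<theta> p) (0, 1)\<bar> ^ (CARD('n) + 1)))"
    if \<Omega>: "compact_subdomain \<Omega>" "pseudo_hermitian \<Omega> \<theta>" for \<Omega> and \<theta> :: "'n one_form"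
    unfolding vol_measure_def
  proof (rule density_cong_AE)
    have "AE p in lebesgue_on \<Omega>. p \<in> interior \<Omega>"
      using \<Omega>(1) AE_interior unfolding compact_subdomain_def by blast
    then show "AE p in lebesgue_on \<Omega>. ennreal \<bar>volume_form \<Omega> \<theta> p std_frame\<bar> =
       ennreal (\<bar>C\<bar> * \<bar>blinfun_apply (\<theta> p) (0, 1)\<bar> ^ (CARD('n) + 1))"
    proof eventually_elim
      case (elim p)
      obtain \<beta> where "conformal_at \<Omega> \<theta> p (blinfun_apply (\<theta> p) (0, 1)) \<beta>"
        using conformal_at_interior[OF \<Omega>(2) elim] by blast
      from C[OF this] show ?case by (simp add: abs_mult power_abs)
    qed
  qed
  then show ?thesis by (intro exI[of _ "\<bar>C\<bar>"]) simp
qed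

lemma continuous_on_theta_e:
  assumes "pseudo_hermitian \<Omega> \<theta>"
  shows "continuous_on \<Omega> (\<lambda>p. blinfun_apply (\<theta> p) (0, 1))"
proof -
  have "continuous_on \<Omega> \<theta>"
    using assms smooth_on_continuous_on unfolding pseudo_hermitian_def by blast
  then show ?thesis by (intro continuous_intros)
qed

lemma compact_lebesgue: "compact \<Omega> \<Longrightarrow> \<Omega> \<in> sets lebesgue" "compact \<Omega> \<Longrightarrow> emeasure lebesgue \<Omega> < \<infinity>"
  for \<Omega> :: "'a::euclidean_space set"
  using fmeasurable_compact[of \<Omega>] by (auto simp: fmeasurable_def borel_compact)

lemma annulus_borel: "{q. s \<le> koranyi p q \<and> koranyi p q \<le> t} \<in> sets borel"
  "doubled_annulus p s t \<in> sets borel"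
proof -
  have [measurable]: "koranyi p \<in> borel_measurable borel"
    by (intro borel_measurable_continuous_onI continuous_koranyi)
  show "{q. s \<le> koranyi p q \<and> koranyi p q \<le> t} \<in> sets borel" by measurable
  show "doubled_annulus p s t \<in> sets borel" unfolding doubled_annulus_def by measurable
qed

lemma borel_imp_sets_lebesgue_on: "A \<in> sets borel \<Longrightarrow> \<Omega> \<inter> A \<in> sets (lebesgue_on \<Omega>)"
  by (auto simp: sets_restrict_space)

lemma outer_measure_of_Un:
  assumes "A \<subseteq> space M" "B \<subseteq> space M"
  shows "outer_measure_of M (A \<union> B) \<le> outer_measure_of M A + outer_measure_of M B"
proof -
  obtain E F where E: "E \<in> sets M" "A \<subseteq> E" "outer_measure_of M A = emeasure M E"
    and F: "F \<in> sets M" "B \<subseteq> F" "outer_measure_of M B = emeasure M F"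
    using outer_measure_of_attain[OF assms(1)] outer_measure_of_attain[OF assms(2)] by blast
  have "outer_measure_of M (A \<union> B) \<le> outer_measure_of M (E \<union> F)"
    using E F by (intro outer_measure_of_mono) auto
  also have "\<dots> = emeasure M (E \<union> F)" using E F by simp
  also have "\<dots> \<le> emeasure M E + emeasure M F" by (rule emeasure_subadditive) fact+
  finally show ?thesis using E F by simp
qed

text \<open>The set function is an outer measure so that the sets of the decomposition need not be measurable.\<close>

lemma weighted_annuli:
  fixes \<Omega> :: "'n::finite heis set" and w :: "'n heis \<Rightarrow> real"
  defines "M \<equiv> density (lebesgue_on \<Omega>) (\<lambda>p. ennreal (w p))"
  assumes \<Omega>: "compact \<Omega>" and w: "w \<in> borel_measurable (lebesgue_on \<Omega>)" "\<And>p. p \<in> \<Omega> \<Longrightarrow> 0 \<le> w p"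
      "\<And>p. p \<in> \<Omega> \<Longrightarrow> w p \<le> K"
    and k: "0 < k" and pos: "0 < measure M \<Omega>"
  shows "\<exists>X s t. (\<forall>i<k. 0 \<le> s i \<and> s i \<le> t i \<and> 0 < t i \<and>
        measure M \<Omega> / (18 * packing_const TYPE('n) * k) \<le>
          measure M (\<Omega> \<inter> {q. s i \<le> koranyi (X i) q \<and> koranyi (X i) q \<le> t i})) \<and>
      (\<forall>i<k. \<forall>j<k. i \<noteq> j \<longrightarrow> doubled_annulus (X i) (s i) (t i) \<inter> doubled_annulus (X j) (s j) (t j) = {})"
proof -
  have sp: "space M = \<Omega>" and setsM: "sets M = sets (lebesgue_on \<Omega>)" unfolding M_def by simp_all
  define K' where "K' = max K 0"
  have le: "emeasure M (\<Omega> \<inter> A) \<le> ennreal K' * emeasure lborel A" if A: "A \<in> sets borel" for A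
  proof -
    have "emeasure M (\<Omega> \<inter> A) = (\<integral>\<^sup>+ p. ennreal (w p) * indicator (\<Omega> \<inter> A) p \<partial>lebesgue_on \<Omega>)"
      unfolding M_def using w(1) borel_imp_sets_lebesgue_on[OF A] by (intro emeasure_density) auto
    also have "\<dots> \<le> (\<integral>\<^sup>+ p. ennreal K' * indicator (\<Omega> \<inter> A) p \<partial>lebesgue_on \<Omega>)"
      by (intro nn_integral_mono mult_right_mono) (auto simp: K'_def max_def intro!: ennreal_leI order_trans[OF w(3)])
    also have "\<dots> = ennreal K' * emeasure (lebesgue_on \<Omega>) (\<Omega> \<inter> A)"
      using borel_imp_sets_lebesgue_on[OF A] by (rule nn_integral_cmult_indicator)
    also have "emeasure (lebesgue_on \<Omega>) (\<Omega> \<inter> A) = emeasure lebesgue (\<Omega> \<inter> A)"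
      using compact_lebesgue(1)[OF \<Omega>] by (intro emeasure_restrict_space) auto
    also have "\<dots> \<le> emeasure lebesgue A" using A by (intro emeasure_mono) auto
    finally show ?thesis using A by (simp add: mult_left_mono)
  qed
  have finM: "emeasure M \<Omega> < \<infinity>"
  proof -
    have "\<Omega> \<in> sets borel" using \<Omega> by (rule borel_compact)
    from le[OF this] show ?thesis
      using compact_lebesgue(2)[OF \<Omega>] \<open>\<Omega> \<in> sets borel\<close>
      by (simp add: ennreal_mult_less_top order_le_less_trans)
  qed
  define \<nu> where "\<nu> S = enn2real (outer_measure_of M (\<Omega> \<inter> S))" for S
  have \<Omega>M: "\<Omega> \<in> sets M" using sets.top[of M] sp by simp
  have fin: "outer_measure_of M (\<Omega> \<inter> S) < \<infinity>" for S
    using outer_measure_of_mono[of "\<Omega> \<inter> S" \<Omega> M] finM \<Omega>M by (simp add: order_le_less_trans)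
  have \<nu>M: "\<nu> A = measure M (\<Omega> \<inter> A)" if "A \<in> sets borel" for A
    unfolding \<nu>_def measure_def using borel_imp_sets_lebesgue_on[OF that] setsM by simp
  have kb: "{y. koranyi x y < r} \<in> sets borel" for x :: "'n heis" and r
    by (intro borel_open open_Collect_less continuous_intros)
  interpret atomless_set_function koranyi \<nu> "packing_const TYPE('n)"
  proof (intro atomless_set_function.intro koranyi_metric atomless_set_function_axioms.intro)
    fix A B :: "'n heis set"
    show "\<nu> A \<le> \<nu> B" if "A \<subseteq> B"
      unfolding \<nu>_def using that fin by (intro enn2real_mono outer_measure_of_mono) auto
    have "outer_measure_of M (\<Omega> \<inter> (A \<union> B)) \<le> outer_measure_of M (\<Omega> \<inter> A) + outer_measure_of M (\<Omega> \<inter> B)"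
      unfolding Int_Un_distrib by (rule outer_measure_of_Un) (auto simp: sp)
    then show "\<nu> (A \<union> B) \<le> \<nu> A + \<nu> B"
      unfolding \<nu>_def using fin[of A] fin[of B]
      by (subst enn2real_plus[symmetric]) (auto intro!: enn2real_mono simp: ennreal_add_less_top)
    show "\<nu> {} = 0" unfolding \<nu>_def by simp
  next
    fix m :: real assume m: "0 < m"
    define v where "v = 2 * measure lborel (ball (0 :: complex ^ 'n) 1)"
    \<comment> \<open>A ball of radius r has volume at most K' v r^(2n+2), and r \<le> 1 lowers the
      exponent to 1. The choice makes this at most m/2; the added 1 keeps the denominator
      positive.\<close>
    define r where "r = min 1 (m / (2 * (K' * v + 1)))"
    have v: "0 \<le> v" "0 \<le> K'" unfolding v_def K'_def by auto
    have r: "0 < r" "r \<le> 1" "r \<le> m / (2 * (K' * v + 1))" using m v unfolding r_def by (auto intro!: divide_pos_pos add_nonneg_pos)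
    have "\<nu> {y. koranyi x y < r} < m" for x
    proof -
      have "emeasure M (\<Omega> \<inter> {y. koranyi x y < r}) \<le> ennreal K' * emeasure lborel {y. koranyi x y < r}"
        using kb by (rule le)
      also have "\<dots> \<le> ennreal K' * emeasure lborel (cyl x r (r\<^sup>2))"
        by (intro mult_left_mono emeasure_mono koranyi_ball_subset_cyl) (auto simp: borel_cyl)
      also have "\<dots> = ennreal K' * ennreal (measure lborel (cyl x r (r\<^sup>2)))"
        using measure_cyl(2)[of "r\<^sup>2" r x] r by (subst emeasure_eq_ennreal_measure) auto
      also have "\<dots> = ennreal (K' * measure lborel (cyl x r (r\<^sup>2)))"
        using v by (simp add: ennreal_mult)
      finally have "measure M (\<Omega> \<inter> {y. koranyi x y < r}) \<le> K' * measure lborel (cyl x r (r\<^sup>2))"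
        unfolding measure_def using v by (intro enn2real_leI) auto
      also have "\<dots> = K' * v * (r\<^sup>2 * r ^ (2 * CARD('n)))"
        using measure_cyl(1)[of "r\<^sup>2" r x] r unfolding v_def by simp
      also have "\<dots> \<le> K' * v * (r * 1)"
      proof (intro mult_left_mono mult_mono)
        show "r\<^sup>2 \<le> r" using r by (simp add: power2_eq_square mult_left_le)
        show "r ^ (2 * CARD('n)) \<le> 1" using r by (intro power_le_one) auto
      qed (use r v in auto)
      also have "\<dots> \<le> (K' * v + 1) * (m / (2 * (K' * v + 1)))"
        using r v by (simp only: mult_1_right) (intro mult_mono; simp)
      also have "\<dots> = m / 2" using v by (simp add: field_simps add_nonneg_eq_0_iff)
      finally show ?thesis using \<nu>M[OF kb] m by simp
    qed
    then show "\<exists>r>0. \<forall>x. \<nu> {y. koranyi x y < r} < m" using r by blast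
  next
    have "bounded (koranyi (0 :: 'n heis) ` \<Omega>)"
      by (intro compact_imp_bounded compact_continuous_image continuous_koranyi \<Omega>)
    then obtain R where R: "\<And>x. x \<in> \<Omega> \<Longrightarrow> norm (koranyi 0 x) \<le> R"
      unfolding bounded_iff by blast
    then have "\<Omega> \<inter> {y. R + 1 \<le> koranyi 0 y} = {}" by fastforce
    then have "\<nu> {y. R + 1 \<le> koranyi 0 y} = 0" unfolding \<nu>_def by simp
    then show "\<exists>x r. \<nu> {y. r \<le> koranyi x y} = 0" by blast
  next
    fix r :: real and S :: "'n heis set" and p
    assume "0 < r" "finite S" "S \<subseteq> {y. koranyi p y \<le> 300000 * r}" "\<forall>x\<in>S. \<forall>y\<in>S. x \<noteq> y \<longrightarrow> r \<le> koranyi x y"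
    then show "card S \<le> packing_const TYPE('n)" by (rule koranyi_packing)
  qed
  have "0 < \<nu> UNIV" using \<nu>M[of UNIV] pos by simp
  from disjoint_annuli[OF k packing_const_pos this] show ?thesis
    unfolding \<nu>M[OF annulus_borel(1)] doubled_annulus_def using \<nu>M[of UNIV] by simp
qed

section \<open>The counting function\<close>

lemma sum_fun_apply: "(\<Sum>i\<in>I. f i) x = (\<Sum>i\<in>I. f i x)" for f :: "'i \<Rightarrow> 'a \<Rightarrow> 'b::comm_monoid_add"
  by (induction I rule: infinite_finite_induct) simp_all

text \<open>If \<open>g\<close> is not integrable, its Bochner integral is 0 and the bound is
  trivial. So the Dirichlet integrand, which is built from definite descriptions, only has to be
  estimated almost everywhere.\<close>

lemma integral_le_nn_integral:
  fixes g :: "'a \<Rightarrow> real"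
  assumes "AE x in M. g x \<le> h x" "\<And>x. 0 \<le> h x" "h \<in> borel_measurable M"
    and "(\<integral>\<^sup>+ x. ennreal (h x) \<partial>M) \<le> ennreal B" "0 \<le> B"
  shows "(\<integral>x. g x \<partial>M) \<le> B"
proof (cases "integrable M g")
  case True
  have h: "integrable M h"
    using assms(2-4) by (intro integrableI_nonneg) (auto simp: order_le_less_trans)
  have "(\<integral>x. g x \<partial>M) \<le> (\<integral>x. h x \<partial>M)" using True h assms(1) by (rule integral_mono_AE)
  also have "\<dots> = enn2real (\<integral>\<^sup>+ x. ennreal (h x) \<partial>M)"
    using assms(2,3) by (intro integral_eq_nn_integral) auto
  also have "\<dots> \<le> B" using assms(4,5) by (rule enn2real_leI[rotated])
  finally show ?thesis .
qed (simp add: not_integrable_integral_eq assms)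

lemma smooth_imp_continuous_on: "smooth f \<Longrightarrow> continuous_on S f"
  using continuous_on_subset[of UNIV f S] by (metis Ck_on.simps(1) subset_UNIV)

lemma finite_measure_vol:
  fixes w :: "'a::euclidean_space \<Rightarrow> real"
  assumes \<Omega>: "compact \<Omega>" and w: "continuous_on \<Omega> w"
  shows "finite_measure (density (lebesgue_on \<Omega>) (\<lambda>p. ennreal (w p)))"
proof (rule finite_measureI)
  obtain K where K: "\<And>p. p \<in> \<Omega> \<Longrightarrow> norm (w p) \<le> K"
    using compact_imp_bounded[OF compact_continuous_image[OF w \<Omega>]] unfolding bounded_iff by blast
  have m: "(\<lambda>p. ennreal (w p)) \<in> borel_measurable (lebesgue_on \<Omega>)"
    using continuous_imp_measurable_on_sets_lebesgue[OF w compact_lebesgue(1)[OF \<Omega>]] by measurable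
  have wK: "w p \<le> K" if "p \<in> \<Omega>" for p using K[OF that] by (simp add: abs_le_iff)
  have "emeasure (density (lebesgue_on \<Omega>) (\<lambda>p. ennreal (w p))) \<Omega> =
      (\<integral>\<^sup>+ p. ennreal (w p) * indicator \<Omega> p \<partial>lebesgue_on \<Omega>)"
    using m sets.top[of "lebesgue_on \<Omega>"] by (intro emeasure_density) simp_all
  also have "\<dots> \<le> (\<integral>\<^sup>+ p. ennreal K * indicator \<Omega> p \<partial>lebesgue_on \<Omega>)"
    by (intro nn_integral_mono) (auto simp: indicator_def intro!: ennreal_leI wK)
  also have "\<dots> = ennreal K * emeasure (lebesgue_on \<Omega>) \<Omega>"
    using sets.top[of "lebesgue_on \<Omega>"] by (intro nn_integral_cmult_indicator) simp
  also have "\<dots> = ennreal K * emeasure lebesgue \<Omega>"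
    using compact_lebesgue(1)[OF \<Omega>] by (subst emeasure_restrict_space) auto
  also have "\<dots> < \<infinity>" using compact_lebesgue(2)[OF \<Omega>] by (simp add: ennreal_mult_less_top)
  finally show "emeasure (density (lebesgue_on \<Omega>) (\<lambda>p. ennreal (w p)))
     (space (density (lebesgue_on \<Omega>) (\<lambda>p. ennreal (w p)))) \<noteq> \<infinity>" by simp
qed

text \<open>Disjoint supports make both quadratic forms diagonal on the span of the test functions.\<close>

lemma neumann_count_ge:
  fixes \<Omega> :: "'n::finite heis set" and \<theta> :: "'n one_form" and u :: "nat \<Rightarrow> 'n heis \<Rightarrow> real"
  assumes \<Omega>: "compact_subdomain \<Omega>" and ph: "pseudo_hermitian \<Omega> \<theta>" and lp: "levi_positive \<Omega> \<theta>"
    and lam: "0 \<le> lam"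
    and u: "\<And>i. i < k \<Longrightarrow> smooth (u i)" "\<And>i q. i < k \<Longrightarrow> (u i has_derivative D i q) (at q)"
    and S: "\<And>i q. i < k \<Longrightarrow> q \<notin> S i \<Longrightarrow> u i q = 0" "\<And>i q. i < k \<Longrightarrow> q \<notin> S i \<Longrightarrow> \<sigma> i q = 0"
    and disj: "\<And>i j. i < k \<Longrightarrow> j < k \<Longrightarrow> i \<noteq> j \<Longrightarrow> S i \<inter> S j = {}"
    and \<sigma>: "\<And>i q y. i < k \<Longrightarrow> \<bar>D i q (hlift q y)\<bar> \<le> \<sigma> i q * norm y" "\<And>i q. i < k \<Longrightarrow> 0 \<le> \<sigma> i q"
      "\<And>i. i < k \<Longrightarrow> \<sigma> i \<in> borel_measurable borel"
    and energy: "\<And>i. i < k \<Longrightarrow>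
      (\<integral>\<^sup>+ p. ennreal ((\<sigma> i p)\<^sup>2 / (4 * \<bar>blinfun_apply (\<theta> p) (0, 1)\<bar>)) \<partial>vol_measure \<Omega> \<theta>)
        < ennreal (lam * (\<integral>p. (u i p)\<^sup>2 \<partial>vol_measure \<Omega> \<theta>))"
  shows "enat k \<le> neumann_count \<Omega> \<theta> lam"
proof -
  define f where "f p = blinfun_apply (\<theta> p) (0, 1)" for p
  define M where "M = vol_measure \<Omega> \<theta>"
  have comp: "compact \<Omega>" and dom: "smooth_domain \<Omega>" using \<Omega> unfolding compact_subdomain_def by auto
  have fc: "continuous_on \<Omega> f" unfolding f_def by (rule continuous_on_theta_e[OF ph])
  obtain c where c: "0 \<le> c" "M = density (lebesgue_on \<Omega>) (\<lambda>p. ennreal (c * \<bar>f p\<bar> ^ (CARD('n) + 1)))"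
    using vol_measure_eq_density[where 'n='n] \<Omega> ph unfolding M_def f_def by blast
  have sets: "sets M = sets (lebesgue_on \<Omega>)" and space: "space M = \<Omega>" unfolding c(2) by simp_all
  interpret finite_measure M
    unfolding c(2) by (rule finite_measure_vol[OF comp]) (intro continuous_intros fc)
  have meas_cont: "g \<in> borel_measurable M" if "continuous_on \<Omega> g" for g :: "'n heis \<Rightarrow> real"
    using continuous_imp_measurable_on_sets_lebesgue[OF that compact_lebesgue(1)[OF comp]]
    by (simp cong: measurable_cong_sets add: sets)
  have meas_borel: "g \<in> borel_measurable M" if "g \<in> borel_measurable borel" for g :: "'n heis \<Rightarrow> real"
  proof -
    have "g \<in> borel_measurable (lebesgue_on \<Omega>)"
      using that by (intro measurable_restrict_space1 measurable_completion) simp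
    then show ?thesis by (simp cong: measurable_cong_sets add: sets)
  qed
  have int_cont: "integrable M g" if g: "continuous_on \<Omega> g" for g :: "'n heis \<Rightarrow> real"
  proof -
    obtain K where K: "\<And>p. p \<in> \<Omega> \<Longrightarrow> norm (g p) \<le> K"
      using compact_imp_bounded[OF compact_continuous_image[OF g comp]] unfolding bounded_iff by blast
    show ?thesis
      by (rule integrable_const_bound[of _ K, OF _ meas_cont[OF g]]) (use K space in \<open>auto intro: AE_I2\<close>)
  qed
  have uc: "continuous_on \<Omega> (u i)" if "i < k" for i
    using smooth_imp_continuous_on u(1)[OF that] by blast
  define b where "b i = (\<integral>p. (u i p)\<^sup>2 \<partial>M)" for i
  define e where "e i = enn2real (\<integral>\<^sup>+ p. ennreal ((\<sigma> i p)\<^sup>2 / (4 * \<bar>f p\<bar>)) \<partial>M)" for i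
  have b0: "0 \<le> b i" for i unfolding b_def by simp
  have e_fin: "(\<integral>\<^sup>+ p. ennreal ((\<sigma> i p)\<^sup>2 / (4 * \<bar>f p\<bar>)) \<partial>M) = ennreal (e i)" and e_less: "e i < lam * b i" and e0: "0 \<le> e i"
    if "i < k" for i
  proof -
    have l: "(\<integral>\<^sup>+ p. ennreal ((\<sigma> i p)\<^sup>2 / (4 * \<bar>f p\<bar>)) \<partial>M) < ennreal (lam * b i)"
      using energy[OF that] unfolding M_def f_def b_def .
    then have "(\<integral>\<^sup>+ p. ennreal ((\<sigma> i p)\<^sup>2 / (4 * \<bar>f p\<bar>)) \<partial>M) < top"
      using ennreal_less_top less_trans by blast
    then show eq: "(\<integral>\<^sup>+ p. ennreal ((\<sigma> i p)\<^sup>2 / (4 * \<bar>f p\<bar>)) \<partial>M) = ennreal (e i)"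
      unfolding e_def by simp
    show "0 \<le> e i" unfolding e_def by simp
    then show "e i < lam * b i" using l unfolding eq by (simp add: ennreal_less_iff)
  qed
  define U where "U i p = (if p \<in> \<Omega> then u i p else 0)" for i p
  define comb where "comb a = (\<Sum>i<k. a i *\<^sub>R U i)" for a :: "nat \<Rightarrow> real"
  have comb: "comb a p = (if p \<in> \<Omega> then (\<Sum>i<k. a i * u i p) else 0)" for a p
    unfolding comb_def sum_fun_apply U_def by (simp add: scaleR_fun_def)
  have at_most: "(\<Sum>i<k. g i) = g j" if "j < k" "p \<in> S j" "\<And>i. i < k \<Longrightarrow> p \<notin> S i \<Longrightarrow> g i = 0"
    for g :: "nat \<Rightarrow> real" and j p
  proof -
    have "(\<Sum>i<k. g i) = (\<Sum>i\<in>{j}. g i)"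
      using that disj by (intro sum.mono_neutral_right) auto
    then show ?thesis by simp
  qed
  have sq: "(\<Sum>i<k. g i)\<^sup>2 = (\<Sum>i<k. (g i)\<^sup>2)" if g: "\<And>i. i < k \<Longrightarrow> p \<notin> S i \<Longrightarrow> g i = 0"
    for g :: "nat \<Rightarrow> real" and p
  proof (cases "\<exists>j<k. p \<in> S j")
    case True
    then obtain j where j: "j < k" "p \<in> S j" by blast
    show ?thesis using at_most[OF j, of g] at_most[OF j, of "\<lambda>i. (g i)\<^sup>2"] g by simp
  qed (use g in simp)
  have L2: "L2_norm_sq \<Omega> \<theta> (comb a) = (\<Sum>i<k. (a i)\<^sup>2 * b i)" for a
  proof -
    have "L2_norm_sq \<Omega> \<theta> (comb a) = (\<integral>p. (\<Sum>i<k. (a i)\<^sup>2 * (u i p)\<^sup>2) \<partial>M)"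
      unfolding L2_norm_sq_def M_def[symmetric]
    proof (rule Bochner_Integration.integral_cong)
      fix p assume "p \<in> space M"
      then show "(comb a p)\<^sup>2 = (\<Sum>i<k. (a i)\<^sup>2 * (u i p)\<^sup>2)"
        using sq[of p "\<lambda>i. a i * u i p"] S(1) by (simp add: comb space power_mult_distrib)
    qed simp
    also have "\<dots> = (\<Sum>i<k. \<integral>p. (a i)\<^sup>2 * (u i p)\<^sup>2 \<partial>M)"
      by (intro Bochner_Integration.integral_sum int_cont continuous_intros uc) simp
    finally show ?thesis unfolding b_def by simp
  qed
  have Dir: "dirichlet_form \<Omega> \<theta> (comb a) \<le> (\<Sum>i<k. (a i)\<^sup>2 * e i)" for a
    unfolding dirichlet_form_def M_def[symmetric]
  proof (rule integral_le_nn_integral)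
    define h where "h p = (\<Sum>i<k. (a i)\<^sup>2 * ((\<sigma> i p)\<^sup>2 / (4 * \<bar>f p\<bar>)))" for p
    show "0 \<le> h p" for p unfolding h_def by (intro sum_nonneg) simp
    have [measurable]: "f \<in> borel_measurable M" using fc by (rule meas_cont)
    have \<sigma>m: "(\<lambda>p. (\<sigma> i p)\<^sup>2 / (4 * \<bar>f p\<bar>)) \<in> borel_measurable M" if "i < k" for i
    proof -
      have [measurable]: "\<sigma> i \<in> borel_measurable M" using \<sigma>(3)[OF that] by (rule meas_borel)
      show ?thesis by measurable
    qed
    show "h \<in> borel_measurable M" unfolding h_def
      by (intro borel_measurable_sum borel_measurable_times borel_measurable_const \<sigma>m) simp
    show "0 \<le> (\<Sum>i<k. (a i)\<^sup>2 * e i)" by (intro sum_nonneg mult_nonneg_nonneg e0) auto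
    have "(\<integral>\<^sup>+ p. ennreal (h p) \<partial>M) = (\<integral>\<^sup>+ p. (\<Sum>i<k. ennreal ((a i)\<^sup>2) * ennreal ((\<sigma> i p)\<^sup>2 / (4 * \<bar>f p\<bar>))) \<partial>M)"
    proof (rule nn_integral_cong)
      fix p
      have "ennreal (h p) = (\<Sum>i<k. ennreal ((a i)\<^sup>2 * ((\<sigma> i p)\<^sup>2 / (4 * \<bar>f p\<bar>))))"
        unfolding h_def by (rule sum_ennreal[symmetric]) simp
      then show "ennreal (h p) = (\<Sum>i<k. ennreal ((a i)\<^sup>2) * ennreal ((\<sigma> i p)\<^sup>2 / (4 * \<bar>f p\<bar>)))"
        by (simp only: ennreal_mult' zero_le_power2)
    qed
    also have "\<dots> = (\<Sum>i<k. \<integral>\<^sup>+ p. ennreal ((a i)\<^sup>2) * ennreal ((\<sigma> i p)\<^sup>2 / (4 * \<bar>f p\<bar>)) \<partial>M)"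
      by (intro nn_integral_sum borel_measurable_times_ennreal borel_measurable_const measurable_compose[OF \<sigma>m measurable_ennreal]) simp
    also have "\<dots> = (\<Sum>i<k. ennreal ((a i)\<^sup>2) * ennreal (e i))"
      by (intro sum.cong refl, subst nn_integral_cmult)
        (simp_all add: e_fin \<sigma>m)
    also have "\<dots> = ennreal (\<Sum>i<k. (a i)\<^sup>2 * e i)"
      by (subst sum_ennreal[symmetric]) (auto simp: ennreal_mult e0)
    finally show "(\<integral>\<^sup>+ p. ennreal (h p) \<partial>M) \<le> ennreal (\<Sum>i<k. (a i)\<^sup>2 * e i)" by simp
    have "f \<in> borel_measurable (lebesgue_on \<Omega>)"
      by (rule continuous_imp_measurable_on_sets_lebesgue[OF fc compact_lebesgue(1)[OF comp]])
    then have "(\<lambda>p. ennreal (c * \<bar>f p\<bar> ^ (CARD('n) + 1))) \<in> borel_measurable (lebesgue_on \<Omega>)"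
      by measurable
    then have "AE p in M. p \<in> interior \<Omega>"
      unfolding c(2) using AE_interior[OF comp dom] by (subst AE_density) (auto elim: eventually_mono)
    then show "AE p in M. webster_metric \<Omega> \<theta> p (sub_gradient \<Omega> \<theta> (comb a) p) (sub_gradient \<Omega> \<theta> (comb a) p) \<le> h p"
    proof eventually_elim
      case (elim p)
      then have p\<Omega>: "p \<in> \<Omega>" using interior_subset by blast
      obtain \<beta> where \<beta>: "conformal_at \<Omega> \<theta> p (f p) \<beta>"
        using conformal_at_interior[OF ph elim] unfolding f_def by blast
      have fp: "0 < f p" by (rule conformal_factor_pos[OF lp p\<Omega> \<beta>])
      define L where "L v = (\<Sum>i<k. a i * D i p v)" for v
      have "((\<lambda>q. \<Sum>i<k. a i * u i q) has_derivative L) (at p)"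
        unfolding L_def by (intro has_derivative_sum has_derivative_mult_right u(2)) simp
      then have der: "(comb a has_derivative L) (at p)"
        by (rule has_derivative_transform_within_open[of _ _ _ _ "interior \<Omega>"])
          (use elim interior_subset in \<open>auto simp: comb\<close>)
      have "frechet_derivative (comb a) (at p within \<Omega>) = L"
        unfolding at_within_interior[OF elim] using frechet_derivative_at[OF der] by simp
      moreover have "linear L" using der by (rule has_derivative_linear)
      moreover have "\<bar>L (hlift p y)\<bar> \<le> (\<Sum>i<k. \<bar>a i\<bar> * \<sigma> i p) * norm y" for y
      proof -
        have "\<bar>L (hlift p y)\<bar> \<le> (\<Sum>i<k. \<bar>a i * D i p (hlift p y)\<bar>)" unfolding L_def by (rule sum_abs)
        also have "\<dots> \<le> (\<Sum>i<k. \<bar>a i\<bar> * (\<sigma> i p * norm y))"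
          unfolding abs_mult by (intro sum_mono mult_left_mono \<sigma>(1)) auto
        finally show ?thesis by (simp add: sum_distrib_right mult.assoc)
      qed
      ultimately have "webster_metric \<Omega> \<theta> p (sub_gradient \<Omega> \<theta> (comb a) p) (sub_gradient \<Omega> \<theta> (comb a) p)
         \<le> (\<Sum>i<k. \<bar>a i\<bar> * \<sigma> i p)\<^sup>2 / (4 * f p)"
        by (rule sub_gradient_energy_le[OF \<beta> fp])
      also have "(\<Sum>i<k. \<bar>a i\<bar> * \<sigma> i p)\<^sup>2 = (\<Sum>i<k. (\<bar>a i\<bar> * \<sigma> i p)\<^sup>2)"
        by (rule sq[of p]) (simp add: S(2))
      also have "\<dots> / (4 * f p) = h p"
        unfolding h_def using fp by (simp add: sum_divide_distrib power_mult_distrib)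
      finally show ?case .
    qed
  qed
  have strict: "dirichlet_form \<Omega> \<theta> (comb a) < lam * L2_norm_sq \<Omega> \<theta> (comb a)" if nz: "\<exists>i<k. a i \<noteq> 0" for a
  proof -
    obtain j where j: "j < k" "a j \<noteq> 0" using nz by blast
    have "(\<Sum>i<k. (a i)\<^sup>2 * e i) < (\<Sum>i<k. (a i)\<^sup>2 * (lam * b i))"
    proof (rule sum_strict_mono_ex1)
      show "\<forall>i\<in>{..<k}. (a i)\<^sup>2 * e i \<le> (a i)\<^sup>2 * (lam * b i)"
        by (intro ballI mult_left_mono less_imp_le[OF e_less]) auto
      show "\<exists>i\<in>{..<k}. (a i)\<^sup>2 * e i < (a i)\<^sup>2 * (lam * b i)"
        using j e_less[OF j(1)] by (intro bexI[of _ j]) auto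
    qed simp
    then show ?thesis using Dir[of a] unfolding L2 sum_distrib_left by (simp add: ac_simps)
  qed
  have comb_inj: "\<forall>i<k. a i = 0" if "comb a = 0" for a
  proof (rule ccontr)
    assume "\<not> (\<forall>i<k. a i = 0)"
    then obtain j where j: "j < k" "a j \<noteq> 0" by blast
    have "(\<Sum>i<k. (a i)\<^sup>2 * b i) = 0"
      unfolding L2[symmetric] that L2_norm_sq_def by simp
    moreover have "(a j)\<^sup>2 * b j \<le> (\<Sum>i<k. (a i)\<^sup>2 * b i)"
      using j b0 by (intro member_le_sum) auto
    \<comment> \<open>The strict energy inequality rules out test functions that vanish almost
      everywhere on \<Omega>; linear independence rests on this.\<close>
    moreover have "0 < b j" using e0[OF j(1)] e_less[OF j(1)] lam b0[of j]
      by (metis less_eq_real_def linorder_not_less mult_zero_right)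
    ultimately show False using j by (simp add: mult_le_0_iff)
  qed
  define V where "V = range comb"
  have comb_lin: "comb a + comb a' = comb (\<lambda>i. a i + a' i)" "r *\<^sub>R comb a = comb (\<lambda>i. r * a i)" for a a' r
    unfolding comb_def by (simp_all add: scaleR_add_left sum.distrib scaleR_sum_right)
  have combV: "comb a \<in> V" for a unfolding V_def by (rule rangeI)
  have subV: "subspace V"
  proof (rule subspaceI)
    have "comb (\<lambda>_. 0) = 0" unfolding comb_def by simp
    then show "0 \<in> V" using combV by metis
    show "v + w \<in> V" if "v \<in> V" "w \<in> V" for v w
      using that combV unfolding V_def by (auto simp: comb_lin)
    show "r *\<^sub>R v \<in> V" if "v \<in> V" for r v
      using that combV unfolding V_def by (auto simp: comb_lin)
  qed
  have smV: "V \<subseteq> smooth_functions \<Omega>"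
  proof -
    have "smooth (\<lambda>q. \<Sum>i<j. a i * u i q)" if "j \<le> k" for j a
      using that
    proof (induction j)
      case (Suc j)
      then show ?case
        using u(1)[of j] by (auto intro!: Ck_on_add Ck_on_mult Ck_on_const)
    qed (simp add: Ck_on_const)
    then show ?thesis
      unfolding V_def smooth_functions_def smooth_on_def
      by (auto simp: comb intro!: exI[of _ UNIV] exI[of _ "\<lambda>q. \<Sum>i<k. _ i * u i q"])
  qed
  have strictV: "\<forall>v\<in>V - {0}. dirichlet_form \<Omega> \<theta> v < lam * L2_norm_sq \<Omega> \<theta> v"
  proof
    fix v assume "v \<in> V - {0}"
    then obtain a where a: "v = comb a" "comb a \<noteq> 0" unfolding V_def by blast
    have "\<exists>i<k. a i \<noteq> 0"
    proof (rule ccontr)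
      assume "\<not> (\<exists>i<k. a i \<noteq> 0)"
      then have "comb a = 0" unfolding comb_def by simp
      then show False using a by simp
    qed
    then show "dirichlet_form \<Omega> \<theta> v < lam * L2_norm_sq \<Omega> \<theta> v" unfolding a by (rule strict)
  qed
  have U_comb: "U i = comb (\<lambda>j. if j = i then 1 else 0)" if "i < k" for i
    unfolding comb_def using that by (simp add: if_distrib[of "\<lambda>r. r *\<^sub>R _"] cong: if_cong)
  have injU: "inj_on U {..<k}"
  proof (rule inj_onI)
    fix i j assume ij: "i \<in> {..<k}" "j \<in> {..<k}" "U i = U j"
    then have ijk: "i < k" "j < k" by auto
    have "comb (\<lambda>l. (if l = i then 1 else 0) + - 1 * (if l = j then 1 else 0)) = U i + (- 1) *\<^sub>R U j"
      unfolding U_comb[OF ijk(1)] U_comb[OF ijk(2)] comb_lin ..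
    also have "\<dots> = 0" unfolding ij(3) by (simp add: fun_eq_iff scaleR_fun_def)
    finally have "(if i = i then 1 else 0) + - 1 * (if i = j then 1 else 0) = (0 :: real)"
      using comb_inj ijk(1) by blast
    then show "i = j" by (simp split: if_splits)
  qed
  have spanU: "V = span (U ` {..<k})"
  proof
    show "V \<subseteq> span (U ` {..<k})"
    proof
      fix v assume "v \<in> V"
      then obtain a where v: "v = (\<Sum>i<k. a i *\<^sub>R U i)" unfolding V_def comb_def by blast
      show "v \<in> span (U ` {..<k})" unfolding v by (rule span_sum, rule span_scale, rule span_base) simp
    qed
    show "span (U ` {..<k}) \<subseteq> V"
      by (rule span_minimal[OF _ subV]) (use U_comb in \<open>auto simp: V_def\<close>)
  qed
  have indep: "independent (U ` {..<k})"
  proof (rule independent_if_scalars_zero)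
    fix g v assume g: "(\<Sum>w\<in>U ` {..<k}. g w *\<^sub>R w) = 0" and v: "v \<in> U ` {..<k}"
    have "comb (\<lambda>i. g (U i)) = 0"
      using g unfolding comb_def by (simp add: sum.reindex[OF injU])
    then show "g v = 0" using comb_inj v by blast
  qed simp
  have "ext_dim V = enat k"
  proof -
    have "dim V = k" unfolding spanU dim_span
      using dim_eq_card_independent[OF indep] card_image[OF injU] by simp
    moreover have "\<exists>B. finite B \<and> V \<subseteq> span B" unfolding spanU by (intro exI[of _ "U ` {..<k}"]) simp
    ultimately show ?thesis unfolding ext_dim_def by simp
  qed
  then have "enat k = ext_dim V" ..
  also have "\<dots> \<le> neumann_count \<Omega> \<theta> lam"
    unfolding neumann_count_def by (rule SUP_upper) (use subV smV strictV in simp)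
  finally show ?thesis .
qed

section \<open>Energy of the cutoff functions\<close>

lemma slope_nonneg: "0 \<le> s \<Longrightarrow> 0 < t \<Longrightarrow> 0 \<le> slope p s t q"
  unfolding slope_def by auto

lemma slope_borel: "slope p s t \<in> borel_measurable borel"
proof -
  have [measurable]: "koranyi p \<in> borel_measurable borel"
    by (intro borel_measurable_continuous_onI continuous_koranyi)
  show ?thesis unfolding slope_def doubled_annulus_def by measurable
qed

text \<open>With m = 2n+2, the factor 2^m splits the m-th power of the two terms of
  \<open>slope\<close>. In each, slope times radius is scale free, 64/t * 2t = 128 and 32/s * s =
  32; the factor 2 and the unit ball come from the cylinder volume 2 r^m v.\<close>

definition energy_const :: "'n::finite itself \<Rightarrow> real" where
  "energy_const _ = 2 ^ (2 * CARD('n) + 2) * (2 * 128 ^ (2 * CARD('n) + 2) + 2 * 32 ^ (2 * CARD('n) + 2)) *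
     measure lborel (ball (0 :: complex ^ 'n) 1)"

lemma energy_const_nonneg: "0 \<le> energy_const TYPE('n::finite)"
  unfolding energy_const_def by simp

lemma power_add_le: "(a + b) ^ m \<le> 2 ^ m * (a ^ m + b ^ m)" if "0 \<le> a" "0 \<le> b" for a b :: real
proof -
  have "(a + b) ^ m \<le> (2 * max a b) ^ m" using that by (intro power_mono) auto
  also have "\<dots> \<le> 2 ^ m * (a ^ m + b ^ m)"
    unfolding power_mult_distrib using that by (intro mult_left_mono) (auto simp: max_def)
  finally show ?thesis .
qed

text \<open>Scale invariance of the \<open>(2n + 2)\<close>-energy, the reason for a bound that depends on \<open>n\<close> only.\<close>

lemma slope_energy:
  fixes p :: "'n::finite heis"
  assumes st: "0 \<le> s" "0 < t"
  shows "(\<integral>\<^sup>+ q. ennreal (slope p s t q ^ (2 * CARD('n) + 2)) \<partial>lborel) \<le> ennreal (energy_const TYPE('n))"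
proof -
  define m where "m = 2 * CARD('n) + 2"
  define v where "v = measure lborel (ball (0 :: complex ^ 'n) 1)"
  define d where "d = (if 0 < s then 32 / s else 0)"
  have v: "0 \<le> v" unfolding v_def by simp
  have d: "0 \<le> d" unfolding d_def using st by auto
  have cyl: "emeasure lborel (cyl p r (r\<^sup>2)) = ennreal (2 * r ^ m * v)" if "0 \<le> r" for r
    using measure_cyl[of "r\<^sup>2" r p] that unfolding v_def m_def
    by (subst emeasure_eq_ennreal_measure) (auto simp: power_add power2_eq_square mult_ac)
  have le: "slope p s t q ^ m \<le> 2 ^ m * (64 / t) ^ m * indicator (cyl p (2 * t) ((2 * t)\<^sup>2)) q +
      2 ^ m * d ^ m * indicator (cyl p s (s\<^sup>2)) q" for q
  proof (cases "q \<in> doubled_annulus p s t")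
    case True
    then have 1: "q \<in> cyl p (2 * t) ((2 * t)\<^sup>2)"
      using koranyi_ball_subset_cyl[of p "2 * t"] unfolding doubled_annulus_def by auto
    define d' where "d' = (if 0 < s \<and> koranyi p q < s then 32 / s else 0)"
    have "slope p s t q ^ m = (64 / t + d') ^ m" using True unfolding slope_def d'_def by simp
    also have "\<dots> \<le> 2 ^ m * ((64 / t) ^ m + d' ^ m)"
      unfolding d'_def using st by (intro power_add_le) auto
    also have "d' ^ m \<le> d ^ m * indicator (cyl p s (s\<^sup>2)) q"
      using koranyi_ball_subset_cyl[of p s] d unfolding d'_def d_def m_def by (auto simp: indicator_def)
    finally show ?thesis using 1 by (simp add: algebra_simps)
  next
    case False
    then show ?thesis using st d by (simp add: slope_def m_def)
  qed
  have "(\<integral>\<^sup>+ q. ennreal (slope p s t q ^ m) \<partial>lborel) \<le>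
     (\<integral>\<^sup>+ q. ennreal (2 ^ m * (64 / t) ^ m) * indicator (cyl p (2 * t) ((2 * t)\<^sup>2)) q +
         ennreal (2 ^ m * d ^ m) * indicator (cyl p s (s\<^sup>2)) q \<partial>lborel)"
  proof (rule nn_integral_mono)
    fix q
    have nn: "0 \<le> 2 ^ m * (64 / t) ^ m" "0 \<le> 2 ^ m * d ^ m" using st d by auto
    show "ennreal (slope p s t q ^ m) \<le> ennreal (2 ^ m * (64 / t) ^ m) * indicator (cyl p (2 * t) ((2 * t)\<^sup>2)) q +
         ennreal (2 ^ m * d ^ m) * indicator (cyl p s (s\<^sup>2)) q"
      by (rule order_trans[OF ennreal_leI[OF le]])
        (use nn in \<open>simp add: ennreal_plus ennreal_mult'' ennreal_indicator\<close>)
  qed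
  also have "\<dots> = ennreal (2 ^ m * (64 / t) ^ m) * ennreal (2 * (2 * t) ^ m * v) +
      ennreal (2 ^ m * d ^ m) * ennreal (2 * s ^ m * v)"
  proof -
    define B1 B2 where "B1 = cyl p (2 * t) ((2 * t)\<^sup>2)" and "B2 = cyl p s (s\<^sup>2)"
    have B: "B1 \<in> sets lborel" "B2 \<in> sets lborel"
      "emeasure lborel B1 = ennreal (2 * (2 * t) ^ m * v)" "emeasure lborel B2 = ennreal (2 * s ^ m * v)"
      unfolding B1_def B2_def using cyl[of "2 * t"] cyl[of s] st by (simp_all only: sets_lborel borel_cyl)
    show ?thesis unfolding B1_def[symmetric] B2_def[symmetric] B(3,4)[symmetric]
      using B(1,2) by (subst nn_integral_add) (simp_all add: nn_integral_cmult_indicator)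
  qed
  also have "\<dots> = ennreal (2 ^ m * (64 / t) ^ m * (2 * (2 * t) ^ m * v) + 2 ^ m * d ^ m * (2 * s ^ m * v))"
    using st d v by (simp add: ennreal_mult ennreal_plus)
  also have "\<dots> \<le> ennreal (energy_const TYPE('n))"
  proof (rule ennreal_leI)
    have "(64 / t) ^ m * (2 * t) ^ m = (64 / t * (2 * t)) ^ m" by (rule power_mult_distrib[symmetric])
    also have "64 / t * (2 * t) = 128" using st by simp
    finally have "(64 / t) ^ m * (2 * t) ^ m = 128 ^ m" .
    moreover have "2 ^ m * x * (2 * y * v) = 2 ^ m * (2 * (x * y)) * v" for x y :: real
      by (simp only: mult_ac)
    ultimately have 1: "2 ^ m * (64 / t) ^ m * (2 * (2 * t) ^ m * v) = 2 ^ m * (2 * 128 ^ m) * v"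
      by metis
    have "d ^ m * s ^ m \<le> 32 ^ m"
      unfolding power_mult_distrib[symmetric] using st by (intro power_mono) (auto simp: d_def)
    then have "2 ^ m * d ^ m * (2 * s ^ m * v) \<le> 2 ^ m * (2 * 32 ^ m) * v"
      using v mult_left_mono[of "d ^ m * s ^ m" "32 ^ m" "2 ^ m * 2 * v"] by (simp add: mult_ac)
    then show "2 ^ m * (64 / t) ^ m * (2 * (2 * t) ^ m * v) + 2 ^ m * d ^ m * (2 * s ^ m * v) \<le> energy_const TYPE('n)"
      unfolding 1 energy_const_def m_def[symmetric] v_def[symmetric] by (simp add: algebra_simps)
  qed
  finally show ?thesis unfolding m_def .
qed

text \<open>This replaces Hoelder's inequality.\<close>

lemma young_power:
  fixes x \<tau> :: real
  assumes "0 \<le> x" "0 < \<tau>"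
  shows "x \<le> \<tau> + x ^ (n + 1) / \<tau> ^ n"
proof (cases "x \<le> \<tau>")
  case True
  then show ?thesis using assms by (simp add: add_increasing2)
next
  case False
  then have "x * \<tau> ^ n \<le> x * x ^ n" using assms by (intro mult_left_mono power_mono) auto
  then have "x \<le> x ^ (n + 1) / \<tau> ^ n" using assms by (simp add: le_divide_eq)
  then show ?thesis using assms by simp
qed

text \<open>The inequality \<open>young_power\<close> is applied to \<open>g\<close>, the squared
  slope divided by |f|, with threshold \<tau>. The first term is paid for by the volume of the
  doubled annulus. In the second the density c |f|^(n+1) cancels the weight in g^(n+1), which leaves
  the scale invariant energy, bounded by its value on the whole group. Where f vanishes the quotient
  \<open>g\<close> is 0, and the estimate persists.\<close>

lemma annulus_energy:
  fixes \<Omega> :: "'n::finite heis set" and f :: "'n heis \<Rightarrow> real" and c :: real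
  defines "M \<equiv> density (lebesgue_on \<Omega>) (\<lambda>p. ennreal (c * \<bar>f p\<bar> ^ (CARD('n) + 1)))"
  assumes \<Omega>: "compact \<Omega>" and f: "continuous_on \<Omega> f" and c: "0 \<le> c"
    and st: "0 \<le> s" "0 < t" and \<tau>: "0 < \<tau>"
  shows "(\<integral>\<^sup>+ q. ennreal ((slope p s t q)\<^sup>2 / (4 * \<bar>f q\<bar>)) \<partial>M) \<le>
     ennreal ((\<tau> * measure M (\<Omega> \<inter> doubled_annulus p s t) + c * energy_const TYPE('n) / \<tau> ^ CARD('n)) / 4)"
proof -
  define m where "m = CARD('n) + 1"
  define A where "A = \<Omega> \<inter> doubled_annulus p s t"
  define \<sigma> where "\<sigma> = slope p s t"
  have \<sigma>0: "0 \<le> \<sigma> q" for q unfolding \<sigma>_def using slope_nonneg st by blast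
  interpret finite_measure M
    unfolding M_def by (rule finite_measure_vol[OF \<Omega>]) (intro continuous_intros f)
  have sets: "sets M = sets (lebesgue_on \<Omega>)" unfolding M_def by simp
  have fm: "f \<in> borel_measurable (lebesgue_on \<Omega>)"
    by (rule continuous_imp_measurable_on_sets_lebesgue[OF f compact_lebesgue(1)[OF \<Omega>]])
  have \<sigma>m: "\<sigma> \<in> borel_measurable (lebesgue_on \<Omega>)"
    unfolding \<sigma>_def by (intro measurable_restrict_space1 measurable_completion) (simp add: slope_borel)
  note [measurable] = fm \<sigma>m
  have A: "A \<in> sets M" unfolding A_def sets by (intro borel_imp_sets_lebesgue_on annulus_borel)
  define g where "g q = (\<sigma> q)\<^sup>2 / \<bar>f q\<bar>" for q
  have gm: "(\<lambda>q. ennreal (g q ^ m / (4 * \<tau> ^ CARD('n)))) \<in> borel_measurable (lebesgue_on \<Omega>)"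
    unfolding g_def by measurable
  have "(\<integral>\<^sup>+ q. ennreal ((\<sigma> q)\<^sup>2 / (4 * \<bar>f q\<bar>)) \<partial>M) \<le>
     (\<integral>\<^sup>+ q. ennreal (\<tau> / 4) * indicator A q + ennreal (g q ^ m / (4 * \<tau> ^ CARD('n))) \<partial>M)"
  proof (rule nn_integral_mono)
    fix q assume "q \<in> space M"
    then have q: "q \<in> \<Omega>" unfolding M_def by simp
    show "ennreal ((\<sigma> q)\<^sup>2 / (4 * \<bar>f q\<bar>)) \<le>
      ennreal (\<tau> / 4) * indicator A q + ennreal (g q ^ m / (4 * \<tau> ^ CARD('n)))"
    proof (cases "q \<in> A")
      case True
      have "g q \<le> \<tau> + g q ^ m / \<tau> ^ CARD('n)"
        unfolding m_def by (rule young_power) (use \<tau> in \<open>auto simp: g_def\<close>)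
      then have "(\<sigma> q)\<^sup>2 / (4 * \<bar>f q\<bar>) \<le> \<tau> / 4 + g q ^ m / (4 * \<tau> ^ CARD('n))"
        unfolding g_def by (simp add: field_simps)
      then show ?thesis using True \<tau>
        by (simp add: g_def flip: ennreal_plus)
    next
      case False
      then have "\<sigma> q = 0" using q unfolding A_def \<sigma>_def slope_def by simp
      then show ?thesis by simp
    qed
  qed
  also have "\<dots> = ennreal (\<tau> / 4) * emeasure M A + (\<integral>\<^sup>+ q. ennreal (g q ^ m / (4 * \<tau> ^ CARD('n))) \<partial>M)"
    using A gm by (subst nn_integral_add) (simp_all add: nn_integral_cmult_indicator M_def)
  also have "ennreal (\<tau> / 4) * emeasure M A = ennreal (\<tau> * measure M A / 4)"
    using \<tau> by (simp add: emeasure_eq_measure flip: ennreal_mult)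
  also have "(\<integral>\<^sup>+ q. ennreal (g q ^ m / (4 * \<tau> ^ CARD('n))) \<partial>M) \<le> ennreal (c * energy_const TYPE('n) / (4 * \<tau> ^ CARD('n)))"
  proof -
    have "(\<integral>\<^sup>+ q. ennreal (g q ^ m / (4 * \<tau> ^ CARD('n))) \<partial>M) =
        (\<integral>\<^sup>+ q. ennreal (c * \<bar>f q\<bar> ^ (CARD('n) + 1)) * ennreal (g q ^ m / (4 * \<tau> ^ CARD('n))) \<partial>lebesgue_on \<Omega>)"
      unfolding M_def by (rule nn_integral_density) (use gm in measurable)
    also have "\<dots> \<le> (\<integral>\<^sup>+ q. ennreal (c / (4 * \<tau> ^ CARD('n))) * ennreal (\<sigma> q ^ (2 * CARD('n) + 2)) \<partial>lebesgue_on \<Omega>)"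
    proof (rule nn_integral_mono)
      fix q
      have "\<bar>f q\<bar> ^ m * g q ^ m \<le> \<sigma> q ^ (2 * m)"
        unfolding g_def power_mult power_mult_distrib[symmetric]
        by (intro power_mono) (auto simp: field_simps)
      then have "c / (4 * \<tau> ^ CARD('n)) * (\<bar>f q\<bar> ^ m * g q ^ m) \<le> c / (4 * \<tau> ^ CARD('n)) * \<sigma> q ^ (2 * m)"
        using c \<tau> by (intro mult_left_mono) auto
      then have "c * \<bar>f q\<bar> ^ m * (g q ^ m / (4 * \<tau> ^ CARD('n))) \<le> c / (4 * \<tau> ^ CARD('n)) * \<sigma> q ^ (2 * m)"
        by (simp add: mult_ac)
      then have "ennreal (c * \<bar>f q\<bar> ^ m * (g q ^ m / (4 * \<tau> ^ CARD('n)))) \<le> ennreal (c / (4 * \<tau> ^ CARD('n)) * \<sigma> q ^ (2 * m))"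
        by (rule ennreal_leI)
      moreover have "2 * CARD('n) + 2 = 2 * m" unfolding m_def by simp
      ultimately show "ennreal (c * \<bar>f q\<bar> ^ (CARD('n) + 1)) * ennreal (g q ^ m / (4 * \<tau> ^ CARD('n))) \<le>
         ennreal (c / (4 * \<tau> ^ CARD('n))) * ennreal (\<sigma> q ^ (2 * CARD('n) + 2))"
        unfolding m_def[symmetric] using c \<tau> \<sigma>0 by (simp add: g_def flip: ennreal_mult)
    qed
    also have "\<dots> = ennreal (c / (4 * \<tau> ^ CARD('n))) * (\<integral>\<^sup>+ q. ennreal (\<sigma> q ^ (2 * CARD('n) + 2)) \<partial>lebesgue_on \<Omega>)"
      by (rule nn_integral_cmult) measurable
    also have "(\<integral>\<^sup>+ q. ennreal (\<sigma> q ^ (2 * CARD('n) + 2)) \<partial>lebesgue_on \<Omega>) \<le>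
        (\<integral>\<^sup>+ q. ennreal (\<sigma> q ^ (2 * CARD('n) + 2)) \<partial>lebesgue)"
      using compact_lebesgue(1)[OF \<Omega>]
      by (subst nn_integral_restrict_space) (auto intro!: nn_integral_mono simp: indicator_def)
    also have "\<dots> = (\<integral>\<^sup>+ q. ennreal (\<sigma> q ^ (2 * CARD('n) + 2)) \<partial>lborel)"
      by (rule nn_integral_completion)
    also have "\<dots> \<le> ennreal (energy_const TYPE('n))"
      unfolding \<sigma>_def by (rule slope_energy[OF st])
    finally show ?thesis
      using c \<tau> energy_const_nonneg[where 'n='n] by (simp add: mult_left_mono flip: ennreal_mult)
  qed
  finally show ?thesis
    using \<tau> c energy_const_nonneg[where 'n='n] unfolding \<sigma>_def A_def
    by (simp add: add_mono add_divide_distrib mult.commute flip: ennreal_plus)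
qed

text \<open>Sets exceeding the share 1/k of the total number at most k by disjointness, so at least
  k of the 2k remain.\<close>

lemma small_disjoint_sets:
  fixes S :: "nat \<Rightarrow> 'a set"
  assumes "finite_measure M" and S: "\<And>i. i < 2 * k \<Longrightarrow> S i \<in> sets M"
    and disj: "\<And>i j. i < 2 * k \<Longrightarrow> j < 2 * k \<Longrightarrow> i \<noteq> j \<Longrightarrow> S i \<inter> S j = {}" and k: "0 < k"
  shows "\<exists>g. inj_on g {..<k} \<and> (\<forall>i<k. g i < 2 * k \<and> measure M (S (g i)) \<le> measure M (space M) / k)"
proof -
  interpret finite_measure M by fact
  define \<mu> where "\<mu> = measure M (space M)"
  define B where "B = {i. i < 2 * k \<and> \<mu> / k < measure M (S i)}"
  define G where "G = {i. i < 2 * k \<and> measure M (S i) \<le> \<mu> / k}"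
  have fin: "finite B" "finite G" unfolding B_def G_def by auto
  have "card B \<le> k"
  proof (rule ccontr)
    assume "\<not> card B \<le> k"
    then have "B \<noteq> {}" "real k \<le> card B" by auto
    have "card B * (\<mu> / k) = (\<Sum>i\<in>B. \<mu> / k)" by simp
    also have "\<dots> < (\<Sum>i\<in>B. measure M (S i))"
      using fin \<open>B \<noteq> {}\<close> by (intro sum_strict_mono) (auto simp: B_def)
    also have "\<dots> = measure M (\<Union>i\<in>B. S i)"
      using fin S disj by (intro finite_measure_finite_Union[symmetric])
        (auto simp: B_def disjoint_family_on_def)
    also have "\<dots> \<le> \<mu>" unfolding \<mu>_def by (rule bounded_measure)
    finally have "card B * (\<mu> / k) < \<mu>" .
    moreover have "k * (\<mu> / k) \<le> card B * (\<mu> / k)"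
      using \<open>real k \<le> card B\<close> by (intro mult_right_mono) (auto simp: \<mu>_def)
    ultimately show False using k by simp
  qed
  moreover have "card B + card G = 2 * k"
  proof -
    have "card B + card G = card (B \<union> G)"
      using fin by (intro card_Un_disjoint[symmetric]) (auto simp: B_def G_def)
    also have "B \<union> G = {..<2 * k}" by (auto simp: B_def G_def)
    finally show ?thesis by simp
  qed
  ultimately have "k \<le> card G" by simp
  obtain h where h: "bij_betw h {0..<card G} G" using ex_bij_betw_nat_finite[OF fin(2)] by blast
  have "inj_on h {..<k}" using h \<open>k \<le> card G\<close> unfolding bij_betw_def by (auto intro: inj_on_subset)
  moreover have "h i \<in> G" if "i < k" for i using h \<open>k \<le> card G\<close> that unfolding bij_betw_def by auto
  ultimately show ?thesis unfolding G_def \<mu>_def by blast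
qed

text \<open>On a chosen annulus the energy is at most a quarter of \<tau> \<mu>/k plus c E/\<tau>^n,
  where E is \<open>energy_const\<close>. Hypothesis \<open>le\<close> says precisely that the
  second term is smaller than \<tau> \<mu>/k, so the energy stays below \<tau> \<mu>/(2k).\<close>

lemma neumann_count_ge_of_volume:
  fixes \<Omega> :: "'n::finite heis set" and \<theta> :: "'n one_form"
  defines "M \<equiv> vol_measure \<Omega> \<theta>" and "N \<equiv> packing_const TYPE('n)"
  assumes \<Omega>: "compact_subdomain \<Omega>" and ph: "pseudo_hermitian \<Omega> \<theta>" and lp: "levi_positive \<Omega> \<theta>"
    and c: "0 \<le> c" "M = density (lebesgue_on \<Omega>) (\<lambda>p. ennreal (c * \<bar>blinfun_apply (\<theta> p) (0, 1)\<bar> ^ (CARD('n) + 1)))"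
    and lam: "0 < lam" and pos: "0 < measure M \<Omega>" and k: "0 < k"
    and le: "k * (c * energy_const TYPE('n)) < (lam * annulus_const\<^sup>2 / (18 * N)) ^ (CARD('n) + 1) * measure M \<Omega>"
  shows "enat k \<le> neumann_count \<Omega> \<theta> lam"
proof -
  define f where "f p = blinfun_apply (\<theta> p) (0, 1)" for p
  define \<mu> where "\<mu> = measure M \<Omega>"
  define \<kappa> where "\<kappa> = annulus_const"
  \<comment> \<open>Chosen so that \<tau> \<mu>/(2k) equals \<open>lam\<close> times the lower bound
    \<kappa>^2 \<mu>/(36Nk) for the L2 norms; 36 is twice 18 because 2k annuli are
    requested.\<close>
  define \<tau> where "\<tau> = lam * \<kappa>\<^sup>2 / (18 * N)"
  have N: "0 < real N" unfolding N_def using packing_const_pos[where 'n='n] by simp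
  have \<kappa>: "0 < \<kappa>" unfolding \<kappa>_def by (rule annulus_const_pos)
  have \<tau>: "0 < \<tau>" unfolding \<tau>_def using lam N \<kappa> by simp
  have comp: "compact \<Omega>" using \<Omega> unfolding compact_subdomain_def by auto
  have fc: "continuous_on \<Omega> f" unfolding f_def by (rule continuous_on_theta_e[OF ph])
  define w where "w p = c * \<bar>f p\<bar> ^ (CARD('n) + 1)" for p
  have wc: "continuous_on \<Omega> w" unfolding w_def by (intro continuous_intros fc)
  have Mw: "M = density (lebesgue_on \<Omega>) (\<lambda>p. ennreal (w p))" unfolding c(2) w_def f_def ..
  interpret finite_measure M unfolding Mw by (rule finite_measure_vol[OF comp wc])
  have space: "space M = \<Omega>" and sets: "sets M = sets (lebesgue_on \<Omega>)" unfolding Mw by simp_all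
  obtain K where K: "\<And>p. p \<in> \<Omega> \<Longrightarrow> norm (w p) \<le> K"
    using compact_imp_bounded[OF compact_continuous_image[OF wc comp]] unfolding bounded_iff by blast
  have w0: "0 \<le> w p" for p unfolding w_def using c by simp
  have wK: "w p \<le> K" if "p \<in> \<Omega>" for p using K[OF that] by (simp add: abs_le_iff)
  have wm: "w \<in> borel_measurable (lebesgue_on \<Omega>)"
    by (rule continuous_imp_measurable_on_sets_lebesgue[OF wc compact_lebesgue(1)[OF comp]])
  have k2: "0 < 2 * k" using k by simp
  note W0 = weighted_annuli[OF comp wm, of K "2 * k", folded Mw]
  have "\<exists>X s t. (\<forall>i<2 * k. 0 \<le> s i \<and> s i \<le> t i \<and> 0 < t i \<and>
        measure M \<Omega> / (18 * packing_const TYPE('n) * (2 * k)) \<le>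
          measure M (\<Omega> \<inter> {q. s i \<le> koranyi (X i) q \<and> koranyi (X i) q \<le> t i})) \<and>
      (\<forall>i<2 * k. \<forall>j<2 * k. i \<noteq> j \<longrightarrow>
          doubled_annulus (X i) (s i) (t i) \<inter> doubled_annulus (X j) (s j) (t j) = {})"
    by (rule W0) (use w0 wK k2 pos in auto)
  then obtain X s t where W: "\<forall>i<2 * k. 0 \<le> s i \<and> s i \<le> t i \<and> 0 < t i \<and>
        measure M \<Omega> / (18 * packing_const TYPE('n) * (2 * k)) \<le>
          measure M (\<Omega> \<inter> {q. s i \<le> koranyi (X i) q \<and> koranyi (X i) q \<le> t i})"
      "\<forall>i<2 * k. \<forall>j<2 * k. i \<noteq> j \<longrightarrow>
          doubled_annulus (X i) (s i) (t i) \<inter> doubled_annulus (X j) (s j) (t j) = {}"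
    by (elim exE conjE)
  have st: "0 \<le> s i" "s i \<le> t i" "0 < t i" if "i < 2 * k" for i
    using W(1)[rule_format, OF that] by simp_all
  have heavy: "\<mu> / (18 * N * real (2 * k)) \<le>
      measure M (\<Omega> \<inter> {q. s i \<le> koranyi (X i) q \<and> koranyi (X i) q \<le> t i})" if "i < 2 * k" for i
    using W(1)[rule_format, OF that] unfolding \<mu>_def N_def by simp
  have disj: "doubled_annulus (X i) (s i) (t i) \<inter> doubled_annulus (X j) (s j) (t j) = {}"
    if "i < 2 * k" "j < 2 * k" "i \<noteq> j" for i j
    using W(2)[rule_format, OF that] .
  define S where "S i = doubled_annulus (X i) (s i) (t i)" for i
  have SM: "\<Omega> \<inter> S i \<in> sets M" for i
    unfolding S_def sets by (intro borel_imp_sets_lebesgue_on annulus_borel)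
  have "\<exists>g. inj_on g {..<k} \<and> (\<forall>i<k. g i < 2 * k \<and> measure M (\<Omega> \<inter> S (g i)) \<le> measure M (space M) / k)"
  proof (rule small_disjoint_sets[OF finite_measure_axioms SM _ k])
    fix i j assume "i < 2 * k" "j < 2 * k" "i \<noteq> j"
    from disj[OF this] show "\<Omega> \<inter> S i \<inter> (\<Omega> \<inter> S j) = {}" unfolding S_def by blast
  qed
  then obtain g where g: "inj_on g {..<k}" "\<And>i. i < k \<Longrightarrow> g i < 2 * k"
      "\<And>i. i < k \<Longrightarrow> measure M (\<Omega> \<inter> S (g i)) \<le> \<mu> / k"
    unfolding \<mu>_def space by blast
  have "\<exists>z. annulus_test (X i) (s i) (t i) (fst z) (snd z)" if "i < 2 * k" for i
    using annulus_test_exists[OF st[OF that], of "X i"] by simp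
  then have "\<forall>i. \<exists>z. i < 2 * k \<longrightarrow> annulus_test (X i) (s i) (t i) (fst z) (snd z)" by blast
  from choice[OF this] obtain z
    where "\<forall>i. i < 2 * k \<longrightarrow> annulus_test (X i) (s i) (t i) (fst (z i)) (snd (z i))" ..
  then obtain u D where "annulus_test (X i) (s i) (t i) (u i) (D i)" if "i < 2 * k" for i
    using that[of "\<lambda>i. fst (z i)" "\<lambda>i. snd (z i)"] by blast
  note z = this[unfolded annulus_test_def, folded S_def \<kappa>_def]
  have u: "smooth (u i)" if "i < 2 * k" for i
    using z[OF that] by (rule conjunct1)
  have u_deriv: "(u i has_derivative D i q) (at q)" if "i < 2 * k" for i q
    using z[OF that, THEN conjunct2, THEN conjunct1] by (rule spec)
  have u_ge: "\<kappa> \<le> u i q" if "i < 2 * k" "s i \<le> koranyi (X i) q" "koranyi (X i) q \<le> t i" for i q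
    using z[OF that(1), THEN conjunct2, THEN conjunct2, THEN conjunct1] that(2,3) by blast
  have u_zero: "u i q = 0" if "i < 2 * k" "q \<notin> S i" for i q
    using z[OF that(1), THEN conjunct2, THEN conjunct2, THEN conjunct2, THEN conjunct1] that(2) by blast
  have D_le: "\<bar>D i q (hlift q y)\<bar> \<le> slope (X i) (s i) (t i) q * norm y" if "i < 2 * k" for i q y
    by (rule z[OF that, THEN conjunct2, THEN conjunct2, THEN conjunct2, THEN conjunct2, THEN spec, THEN spec])
  show ?thesis
  proof (rule neumann_count_ge[where u="\<lambda>i. u (g i)" and D="\<lambda>i. D (g i)" and S="\<lambda>i. S (g i)"
        and \<sigma>="\<lambda>i. slope (X (g i)) (s (g i)) (t (g i))", OF \<Omega> ph lp less_imp_le[OF lam]])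
    fix i assume i: "i < k"
    note i2 = g(2)[OF i]
    define A where "A = \<Omega> \<inter> {q. s (g i) \<le> koranyi (X (g i)) q \<and> koranyi (X (g i)) q \<le> t (g i)}"
    have AM: "A \<in> sets M" unfolding A_def sets by (intro borel_imp_sets_lebesgue_on annulus_borel)
    have L2: "\<kappa>\<^sup>2 * (\<mu> / (36 * N * k)) \<le> (\<integral>p. (u (g i) p)\<^sup>2 \<partial>M)"
    proof -
      have uc: "continuous_on \<Omega> (\<lambda>p. (u (g i) p)\<^sup>2)"
        using smooth_imp_continuous_on[OF u[OF i2]] by (intro continuous_intros)
      obtain R where R: "\<And>p. p \<in> \<Omega> \<Longrightarrow> norm ((u (g i) p)\<^sup>2) \<le> R"
        using compact_imp_bounded[OF compact_continuous_image[OF uc comp]] unfolding bounded_iff by blast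
      have "(\<lambda>p. (u (g i) p)\<^sup>2) \<in> borel_measurable M"
        using continuous_imp_measurable_on_sets_lebesgue[OF uc compact_lebesgue(1)[OF comp]]
        by (simp cong: measurable_cong_sets add: sets)
      then have int: "integrable M (\<lambda>p. (u (g i) p)\<^sup>2)"
        by (rule integrable_const_bound[of _ R, rotated]) (use R space in \<open>auto intro: AE_I2\<close>)
      have "\<kappa>\<^sup>2 * (\<mu> / (36 * N * k)) \<le> \<kappa>\<^sup>2 * measure M A"
        using heavy[OF i2] unfolding A_def by (intro mult_left_mono) (simp_all add: mult_ac)
      also have "\<dots> = (\<integral>p. \<kappa>\<^sup>2 * indicator A p \<partial>M)" using AM by simp
      also have "\<dots> \<le> (\<integral>p. (u (g i) p)\<^sup>2 \<partial>M)"
      proof (rule integral_mono[OF _ int])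
        show "integrable M (\<lambda>p. \<kappa>\<^sup>2 * indicator A p)" using AM by (simp add: emeasure_eq_measure)
        show "\<kappa>\<^sup>2 * indicator A p \<le> (u (g i) p)\<^sup>2" for p
          using u_ge[OF i2, of p] \<kappa> unfolding A_def by (auto simp: indicator_def intro!: power_mono)
      qed
      finally show ?thesis .
    qed
    have "(\<integral>\<^sup>+ p. ennreal ((slope (X (g i)) (s (g i)) (t (g i)) p)\<^sup>2 / (4 * \<bar>f p\<bar>)) \<partial>M) \<le>
      ennreal ((\<tau> * measure M (\<Omega> \<inter> S (g i)) + c * energy_const TYPE('n) / \<tau> ^ CARD('n)) / 4)"
      unfolding Mw w_def S_def by (rule annulus_energy[OF comp fc c(1) st(1)[OF i2] st(3)[OF i2] \<tau>])
    also have "\<dots> < ennreal (lam * (\<integral>p. (u (g i) p)\<^sup>2 \<partial>M))"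
    proof (rule ennreal_lessI)
      have k0: "0 < real k" using k by simp
      have "k * (c * energy_const TYPE('n)) < \<tau> ^ CARD('n) * (\<tau> * \<mu>)"
        using le unfolding \<tau>_def \<kappa>_def \<mu>_def by (simp add: ac_simps)
      then have "c * energy_const TYPE('n) / \<tau> ^ CARD('n) < \<tau> * (\<mu> / k)"
        using k0 \<tau> by (simp add: field_simps)
      moreover have "\<tau> * measure M (\<Omega> \<inter> S (g i)) \<le> \<tau> * (\<mu> / k)"
        using g(3)[OF i] \<tau> by (intro mult_left_mono) auto
      moreover have "(x + y) / 4 < z / 2" if "y < z" "x \<le> z" for x y z :: real
        using add_le_less_mono[OF that(2,1)] by simp
      ultimately have "(\<tau> * measure M (\<Omega> \<inter> S (g i)) + c * energy_const TYPE('n) / \<tau> ^ CARD('n)) / 4 < \<tau> * (\<mu> / k) / 2"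
        by blast
      also have "\<dots> = lam * (\<kappa>\<^sup>2 * (\<mu> / (36 * N * k)))" unfolding \<tau>_def by simp
      also have "\<dots> \<le> lam * (\<integral>p. (u (g i) p)\<^sup>2 \<partial>M)" using L2 lam by (intro mult_left_mono) auto
      finally show "(\<tau> * measure M (\<Omega> \<inter> S (g i)) + c * energy_const TYPE('n) / \<tau> ^ CARD('n)) / 4 <
          lam * (\<integral>p. (u (g i) p)\<^sup>2 \<partial>M)" .
      have "0 < \<mu>" using pos unfolding \<mu>_def .
      then have "0 < lam * (\<kappa>\<^sup>2 * (\<mu> / (36 * N * k)))" using lam \<kappa> N k0 by simp
      also have "\<dots> \<le> lam * (\<integral>p. (u (g i) p)\<^sup>2 \<partial>M)" using L2 lam by (intro mult_left_mono) auto
      finally show "0 < lam * (\<integral>p. (u (g i) p)\<^sup>2 \<partial>M)" .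
    qed
    finally show "(\<integral>\<^sup>+ p. ennreal ((slope (X (g i)) (s (g i)) (t (g i)) p)\<^sup>2 / (4 * \<bar>blinfun_apply (\<theta> p) (0, 1)\<bar>)) \<partial>vol_measure \<Omega> \<theta>)
        < ennreal (lam * (\<integral>p. (u (g i) p)\<^sup>2 \<partial>vol_measure \<Omega> \<theta>))"
      unfolding M_def f_def .
  next
    fix i j assume "i < k" "j < k" "i \<noteq> j"
    moreover from this have "g i \<noteq> g j" using g(1) by (auto dest: inj_onD)
    ultimately show "S (g i) \<inter> S (g j) = {}" using disj g(2) unfolding S_def by blast
  next
    fix i q assume i: "i < k"
    show "slope (X (g i)) (s (g i)) (t (g i)) q = 0" if "q \<notin> S (g i)"
      using that unfolding S_def slope_def by simp
    show "0 \<le> slope (X (g i)) (s (g i)) (t (g i)) q"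
      using slope_nonneg st g(2)[OF i] by blast
    show "(u (g i) has_derivative D (g i) q) (at q)" by (rule u_deriv[OF g(2)[OF i]])
    show "u (g i) q = 0" if "q \<notin> S (g i)" by (rule u_zero[OF g(2)[OF i] that])
    show "\<bar>D (g i) q (hlift q y)\<bar> \<le> slope (X (g i)) (s (g i)) (t (g i)) q * norm y" for y
      by (rule D_le[OF g(2)[OF i]])
    show "smooth (u (g i))" by (rule u[OF g(2)[OF i]])
    show "slope (X (g i)) (s (g i)) (t (g i)) \<in> borel_measurable borel" by (rule slope_borel)
  qed
qed

text \<open>Constants have zero energy. This covers a positive lower bound of at most 1, where
  rounding up to an integer may cost more than a factor 2.\<close>

lemma neumann_count_ge_1:
  fixes \<Omega> :: "'n::finite heis set" and \<theta> :: "'n one_form"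
  assumes \<Omega>: "compact_subdomain \<Omega>" "pseudo_hermitian \<Omega> \<theta>" "levi_positive \<Omega> \<theta>"
    and lam: "0 < lam" and pos: "0 < measure (vol_measure \<Omega> \<theta>) \<Omega>"
  shows "enat 1 \<le> neumann_count \<Omega> \<theta> lam"
proof (rule neumann_count_ge[where u="\<lambda>_ _. 1" and D="\<lambda>_ _ _. 0" and S="\<lambda>_. UNIV" and \<sigma>="\<lambda>_ _. 0",
      OF \<Omega> less_imp_le[OF lam]])
  have "space (vol_measure \<Omega> \<theta>) = \<Omega>" unfolding vol_measure_def by simp
  then have "(\<integral>p. 1\<^sup>2 \<partial>vol_measure \<Omega> \<theta>) = measure (vol_measure \<Omega> \<theta>) \<Omega>" by simp
  then show "(\<integral>\<^sup>+ p. ennreal (0\<^sup>2 / (4 * \<bar>blinfun_apply (\<theta> p) (0, 1)\<bar>)) \<partial>vol_measure \<Omega> \<theta>)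
      < ennreal (lam * (\<integral>p. 1\<^sup>2 \<partial>vol_measure \<Omega> \<theta>))"
    using lam pos by simp
qed (auto intro: Ck_on_const)

theorem theorem1p3:
  shows "\<exists>C::real. C > 0 \<and>
    (\<forall>(\<Omega> :: 'n::finite heis set) (\<theta> :: 'n one_form) (lam :: real).
       compact_subdomain \<Omega> \<longrightarrow> pseudo_hermitian \<Omega> \<theta> \<longrightarrow> levi_positive \<Omega> \<theta> \<longrightarrow> lam \<ge> 0 \<longrightarrow>
       ennreal_of_enat (neumann_count \<Omega> \<theta> lam) \<ge>
         ennreal C * emeasure (vol_measure \<Omega> \<theta>) \<Omega> * ennreal lam ^ (CARD('n) + 1))"
proof -
  obtain c where c: "0 \<le> c" "\<And>\<Omega> (\<theta> :: 'n one_form). compact_subdomain \<Omega> \<Longrightarrow> pseudo_hermitian \<Omega> \<theta> \<Longrightarrow>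
     vol_measure \<Omega> \<theta> =
       density (lebesgue_on \<Omega>) (\<lambda>p. ennreal (c * \<bar>blinfun_apply (\<theta> p) (0, 1)\<bar> ^ (CARD('n) + 1)))"
    using vol_measure_eq_density[where 'n='n] by blast
  define E where "E = c * energy_const TYPE('n)"
  define a where "a = annulus_const\<^sup>2 / (18 * packing_const TYPE('n))"
  \<comment> \<open>The factor 2 absorbs the rounding k < x + 1 < 2x for x > 1. Since
    \<open>E\<close> may be 0, division is by E + 1, which also makes the inequality for k
    strict.\<close>
  define C where "C = a ^ (CARD('n) + 1) / (2 * (E + 1))"
  have E: "0 \<le> E" unfolding E_def using c(1) energy_const_nonneg[where 'n='n] by simp
  have a: "0 < a" unfolding a_def using annulus_const_pos packing_const_pos[where 'n='n] by simp
  have C: "0 < C" unfolding C_def using a E by simp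
  have "ennreal C * emeasure (vol_measure \<Omega> \<theta>) \<Omega> * ennreal lam ^ (CARD('n) + 1)
     \<le> ennreal_of_enat (neumann_count \<Omega> \<theta> lam)"
    if \<Omega>: "compact_subdomain \<Omega>" "pseudo_hermitian \<Omega> \<theta>" "levi_positive \<Omega> \<theta>" and lam: "0 \<le> lam"
    for \<Omega> and \<theta> :: "'n one_form" and lam
  proof -
    define M where "M = vol_measure \<Omega> \<theta>"
    define x where "x = C * measure M \<Omega> * lam ^ (CARD('n) + 1)"
    have "compact \<Omega>" using \<Omega>(1) unfolding compact_subdomain_def by blast
    then interpret finite_measure M
      unfolding M_def c(2)[OF \<Omega>(1,2)]
      by (rule finite_measure_vol) (intro continuous_intros continuous_on_theta_e[OF \<Omega>(2)])
    have x: "ennreal C * emeasure M \<Omega> * ennreal lam ^ (CARD('n) + 1) = ennreal x"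
      unfolding x_def emeasure_eq_measure using C lam by (simp add: ennreal_mult ennreal_power)
    have "ennreal x \<le> ennreal_of_enat (neumann_count \<Omega> \<theta> lam)"
    proof (cases "x \<le> 0")
      case True
      then show ?thesis by (simp add: ennreal_neg)
    next
      case False
      then have "x \<noteq> 0" by simp
      then have "lam \<noteq> 0" "measure M \<Omega> \<noteq> 0" unfolding x_def by auto
      then have lam': "0 < lam" and pos: "0 < measure M \<Omega>" using lam by (simp_all add: order_less_le)
      define k where "k = nat \<lceil>x\<rceil>"
      have k: "0 < k" "x \<le> k" "real k < x + 1" unfolding k_def using False by linarith+
      have "enat k \<le> neumann_count \<Omega> \<theta> lam"
      proof (cases "x \<le> 1")
        case True
        then have "k = 1" using k by linarith
        then show ?thesis using neumann_count_ge_1[OF \<Omega> lam'] pos unfolding M_def by simp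
      next
        case False
        show ?thesis
        proof -
          have "real k * (E + 1) \<le> 2 * x * (E + 1)" using k(3) False E by (intro mult_right_mono) auto
          also have "\<dots> = (lam * a) ^ (CARD('n) + 1) * measure M \<Omega>"
            unfolding x_def C_def power_mult_distrib using E by (simp add: field_simps)
          finally have "real k * (E + 1) \<le> (lam * a) ^ (CARD('n) + 1) * measure M \<Omega>" .
          moreover have "real k * E < real k * (E + 1)" using k(1) by simp
          ultimately have "real k * E < (lam * a) ^ (CARD('n) + 1) * measure M \<Omega>" by linarith
          then have "real k * (c * energy_const TYPE('n)) <
            (lam * annulus_const\<^sup>2 / (18 * packing_const TYPE('n))) ^ (CARD('n) + 1) * measure (vol_measure \<Omega> \<theta>) \<Omega>"
            unfolding E_def a_def M_def by simp
          then show ?thesis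
            by (intro neumann_count_ge_of_volume[OF \<Omega> c(1) c(2)[OF \<Omega>(1,2)] lam' pos[unfolded M_def] k(1)]) simp
        qed
      qed
      then have "ennreal_of_enat (enat k) \<le> ennreal_of_enat (neumann_count \<Omega> \<theta> lam)"
        by (simp only: ennreal_of_enat_le_iff)
      moreover have "ennreal x \<le> ennreal_of_enat (enat k)"
        using k(2) by (simp add: ennreal_of_nat_eq_real_of_nat ennreal_leI)
      ultimately show ?thesis by (rule order_trans[rotated])
    qed
    then show ?thesis using x unfolding M_def by simp
  qed
  then show ?thesis using C by (intro exI[of _ C]) blast
qed

end
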